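(* For every space $\mathcal{BL}_D(\{\mathcal{F}_1,\dots,\mathcal{F}_{B_{\mathcal{G}}}\})$ of jointly bandlimited DTVGS with joint bandwidth $B$, there exists a stable sampling set $\mathcal{S}$ (allowing perfect reconstruction) with total sampling ratio $R_D(\mathcal{S})=B/N$ and with vertex projection $\mathcal{S}_{\mathcal{G}}=\{v:(v,n)\in\mathcal{S}\}$ satisfying $|\mathcal{S}_{\mathcal{G}}|\le B_{\mathcal{G}}$. Hence critical sampling of jointly bandlimited DTVGS is achievable.
   Context: $\mathcal{G}$ undirected graph with $N$ vertices and orthonormal Laplacian eigenvector matrix $\mathbf{U}_{\mathcal{G}}$ (columns $\mathbf{u}_i$). DTVGS $\mathbf{X}$ with $\mathbf{X}(v,\cdot)\in\ell^2(\mathbb{Z})$; JFT $\mathcal{F}_{\mathcal{J}}(\mathbf{X})(i,f)=\sum_v\mathbf{u}_i(v)\sum_n\mathbf{X}(v,n)e^{-j2\pi fn}$, normalized frequency $f\in[-\tfrac12,\tfrac12)$; $\mathcal{F}_i$ is the support of the $i$-th JFT component in one period (finite union of intervals, known location); $\mathcal{I}=\{i:\mathcal{F}_i\neq\emptyset\}$, $B_{\mathcal{G}}=|\mathcal{I}|$, joint bandwidth $B=\sum_i\mu(\mathcal{F}_i)$. $\mathcal{BL}_D$: DTVGS whose JFT vanishes for $f\notin\mathcal{F}_i$ (arbitrary on $\mathcal{F}_i$). A sampling set $\mathcal{S}$ of pairs $(v,n)$ is stable if $A\|\mathbf{X}\|^2\le\sum_{(v,n)\in\mathcal{S}}|\mathbf{X}(v,n)|^2\le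 A'\|\mathbf{X}\|^2$ for some $0<A\le A'<\infty$ and all $\mathbf{X}$ in the space. $R_D(\mathcal{S})=\liminf_{n\to\infty}|\mathcal{S}\cap(\mathcal{V}_{\mathcal{G}}\times[-n,n])|/(2nN)$. *)

theory Defs
  imports "HOL-Analysis.Analysis" "HOL-Library.Liminf_Limsup"
begin

definition undirected_graph :: "('v::finite \<Rightarrow> 'v \<Rightarrow> real) \<Rightarrow> bool" where
  "undirected_graph W \<longleftrightarrow> (\<forall>v w. W v w = W w v \<and> W v w \<ge> 0) \<and> (\<forall>v. W v v = 0)"

definition laplacian :: "('v::finite \<Rightarrow> 'v \<Rightarrow> real) \<Rightarrow> ('v \<Rightarrow> real) \<Rightarrow> 'v \<Rightarrow> real" where
  "laplacian W x v = (\<Sum>w\<in>UNIV. W v w * (x v - x w))"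

definition laplacian_eigenbasis ::
  "('v::finite \<Rightarrow> 'v \<Rightarrow> real) \<Rightarrow> ('i::finite \<Rightarrow> 'v \<Rightarrow> real) \<Rightarrow> bool" where
  "laplacian_eigenbasis W u \<longleftrightarrow> CARD('i) = CARD('v) \<and>
     (\<forall>i k. (\<Sum>v\<in>UNIV. u i v * u k v) = (if i = k then 1 else 0)) \<and>
     (\<forall>i. \<exists>lam. \<forall>v. laplacian W (u i) v = lam * u i v)"

definition finite_union_intervals :: "real set \<Rightarrow> bool" where
  "finite_union_intervals F \<longleftrightarrow> F \<subseteq> {-1/2..<1/2} \<and>
     (\<exists>\<I>. finite \<I> \<and> (\<forall>I\<in>\<I>. is_interval I \<and> bounded I) \<and> F = \<Union>\<I>)"

definition l2_seq :: "(int \<Rightarrow> complex) \<Rightarrow> bool" where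
  "l2_seq y \<longleftrightarrow> (\<lambda>n. (cmod (y n))\<^sup>2) summable_on UNIV"

text \<open>A sequence in \<open>\<ell>\<^sup>2(\<int>)\<close> whose DTFT vanishes outside F (F inside one period):
  it is the inverse DTFT of a square-integrable function supported on F,
  \<open>y n = \<integral>_F g(f) e^{j 2\<pi> f n} df\<close>.\<close>
definition dtft_supported_in :: "real set \<Rightarrow> (int \<Rightarrow> complex) \<Rightarrow> bool" where
  "dtft_supported_in F y \<longleftrightarrow>
     (\<exists>g :: real \<Rightarrow> complex. g \<in> borel_measurable lborel \<and>
        set_integrable lborel F (\<lambda>f. (cmod (g f))\<^sup>2) \<and>
        (\<forall>n. y n = (LINT f:F|lborel. g f * exp (\<i> * complex_of_real (2 * pi * f * real_of_int n)))))"

text \<open>Graph-Fourier component i of a DTVGS: \<open>\<Sum>v u_i(v) X(v,n)\<close>; its DTFT is the i-th JFT row.\<close>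
definition gft_component :: "('i \<Rightarrow> 'v::finite \<Rightarrow> real) \<Rightarrow> ('v \<Rightarrow> int \<Rightarrow> complex) \<Rightarrow> 'i \<Rightarrow> int \<Rightarrow> complex" where
  "gft_component u X i n = (\<Sum>v\<in>UNIV. complex_of_real (u i v) * X v n)"

definition BL_D :: "('i \<Rightarrow> 'v::finite \<Rightarrow> real) \<Rightarrow> ('i \<Rightarrow> real set) \<Rightarrow> ('v \<Rightarrow> int \<Rightarrow> complex) set" where
  "BL_D u F = {X. (\<forall>v. l2_seq (X v)) \<and> (\<forall>i. dtft_supported_in (F i) (gft_component u X i))}"

definition sig_norm2 :: "('v::finite \<Rightarrow> int \<Rightarrow> complex) \<Rightarrow> real" where
  "sig_norm2 X = (\<Sum>\<^sub>\<infinity>p\<in>UNIV. (cmod (X (fst p) (snd p)))\<^sup>2)"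

definition stable_sampling_set :: "('v::finite \<times> int) set \<Rightarrow> ('v \<Rightarrow> int \<Rightarrow> complex) set \<Rightarrow> bool" where
  "stable_sampling_set S BL \<longleftrightarrow> (\<exists>A A'. 0 < A \<and> A \<le> A' \<and>
     (\<forall>X\<in>BL. A * sig_norm2 X \<le> (\<Sum>\<^sub>\<infinity>p\<in>S. (cmod (X (fst p) (snd p)))\<^sup>2) \<and>
              (\<Sum>\<^sub>\<infinity>p\<in>S. (cmod (X (fst p) (snd p)))\<^sup>2) \<le> A' * sig_norm2 X))"

definition sampling_ratio :: "('v::finite \<times> int) set \<Rightarrow> ereal" where
  "sampling_ratio S = liminf (\<lambda>n::nat. ereal (real (card (S \<inter> (UNIV \<times> {-int n..int n})))
                                           / (2 * real n * real CARD('v))))"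

end

theory Submission
  imports Defs "HOL-Computational_Algebra.Polynomial"
begin

text \<open>
  \<^emph>\<open>Reduction to one channel.\<close> At a frequency with set \<open>J\<close> of active graph components, choose vertices
  greedily: a vertex is kept if its row of eigenvector entries, restricted to \<open>J\<close>, is independent of the
  rows of the earlier vertices. This keeps exactly \<open>|J|\<close> vertices, all among those kept for the set of
  all nonempty components. Sampling vertex \<open>v\<close> along a set that is stable for the frequencies at which
  \<open>v\<close> is kept recovers the signals vertex by vertex, since elsewhere its signal is a combination of those
  already known; the densities add up to \<open>B\<close>.

  \<^emph>\<open>One channel.\<close> A finite union of intervals on the circle has a critical set of integer frequencies
  (following Kozma and Nitzan, \<^emph>\<open>Combining Riesz bases\<close>). Folding the circle \<open>M\<close> times turns the set into
  a counting function on the circle; critical sets for its superlevel sets combine into one for the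
  original set, because any \<open>n\<close> consecutive rows of a Vandermonde matrix determine \<open>n\<close> unknowns. If
  for some \<open>M\<close> every superlevel set has fewer boundary points, use induction on their number \<open>m\<close>.
  Otherwise, for every \<open>M\<close>, the counting function takes just two consecutive values; Bessel's inequality
  for its first two harmonics bounds \<open>|S(M)|\<^sup>2 + |S(2M)|\<^sup>2/4\<close> by \<open>\<pi>\<^sup>2/2\<close>, where \<open>S\<close> is the signed
  exponential sum over the boundary points, while its average over \<open>M\<close> is \<open>5m/4\<close>. So \<open>m < 4\<close>, and the
  set is an arc. Folding an arc suitably leaves a single short arc, of length \<open>\<alpha> \<le> 1/10\<close> relative to the
  period, for which the rounded multiples of \<open>1/\<alpha>\<close> are a small perturbation of an orthogonal basis.
\<close>

section \<open>Square-integrable functions on the unit interval\<close>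

text \<open>One triangular scheme serves twice. Folding sorts Fourier coefficients by residue modulo
  \<open>M\<close>; where at most \<open>r\<close> of the \<open>M\<close> preimages lie in the set,
  row \<open>r\<close> is a combination of earlier rows, so it has to be sampled only for the
  \<open>r\<close>-th superlevel set. The measures of these sets, divided by \<open>M\<close>, add
  up to that of the original set. In the graph problem, vertices take the place of rows.

  Folding never creates boundary points. The induction stalls only if, for every \<open>M\<close>,
  multiplication by \<open>M\<close> is injective on them and some superlevel set keeps them all.
  The second harmonic is what closes the argument: the first alone gives
  \<open>m \<le> pi^2 / 2 < 4.94\<close>, which leaves \<open>m = 4\<close> open, whereas
  \<open>5 * m / 4 \<le> pi^2 / 2\<close> excludes it. Rising and falling boundary points are
  equally many, so \<open>m\<close> is even and only 0 and 2 remain.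

  The bound 1/10 on short arcs keeps the frequency error at 1/20, for which
  \<open>exp (2 * pi / 20) - 1 < 1/2\<close> is a contraction factor.\<close>

definition ee :: "real \<Rightarrow> complex" where
  "ee x = cis (2 * pi * x)"

lemma ee_add: "ee (x + y) = ee x * ee y"
  by (simp add: ee_def cis_mult algebra_simps)

lemma norm_ee [simp]: "cmod (ee x) = 1"
  by (simp add: ee_def)

lemma ee_0 [simp]: "ee 0 = 1"
  by (simp add: ee_def)

lemma cnj_ee: "cnj (ee x) = ee (- x)"
  by (simp add: ee_def cis_cnj)

lemma ee_of_int [simp]: "ee (of_int n) = 1"
  by (metis cis_multiple_2pi Ints_of_int ee_def)

lemma ee_eq_1_iff: "ee x = 1 \<longleftrightarrow> x \<in> \<int>"
proof
  assume "ee x = 1"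
  then have "cos (2 * pi * x) = 1"
    by (simp add: ee_def complex_eq_iff)
  then obtain k :: int where "2 * pi * x = of_int k * 2 * pi"
    using cos_one_2pi_int by auto
  then show "x \<in> \<int>" by simp
next
  assume "x \<in> \<int>" then show "ee x = 1"
    by (metis Ints_cases ee_of_int)
qed

lemma ee_eq_exp: "ee x = exp (\<i> * complex_of_real (2 * pi * x))"
  by (simp add: ee_def cis_conv_exp)

lemma continuous_on_ee [continuous_intros]:
  "continuous_on S f \<Longrightarrow> continuous_on S (\<lambda>x. ee (f x))"
  unfolding ee_eq_exp by (intro continuous_intros)

lemma measurable_ee [measurable]: "ee \<in> borel_measurable borel"
  by (intro borel_measurable_continuous_onI continuous_intros)

lemma measurable_cnj [measurable]: "cnj \<in> borel_measurable borel"
  by (intro borel_measurable_continuous_onI continuous_intros)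

lemma integral_ee:
  assumes "a \<le> b" "s \<noteq> 0"
  shows "(\<integral>x. indicator {a..<b} x *\<^sub>R ee (s * x) \<partial>lborel) = (ee (s * b) - ee (s * a)) / (2 * pi * \<i> * s)"
proof -
  have "((\<lambda>x. ee (s * x) / (2 * pi * \<i> * s)) has_vector_derivative ee (s * x)) (at x within {a..b})" for x
  proof -
    let ?A = "2 * pi * \<i> * complex_of_real s"
    have "((\<lambda>x. exp (x *\<^sub>R ?A) / ?A) has_vector_derivative exp (x *\<^sub>R ?A) * ?A / ?A) (at x within {a..b})"
      by (intro has_vector_derivative_divide exp_scaleR_has_vector_derivative_right)
    then show ?thesis using assms(2) by (simp add: ee_eq_exp scaleR_conv_of_real mult_ac)
  qed
  then have "(\<integral>x. indicator {a..b} x *\<^sub>R ee (s * x) \<partial>lborel) =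
      ee (s * b) / (2 * pi * \<i> * s) - ee (s * a) / (2 * pi * \<i> * s)"
    by (intro integral_FTC_Icc assms) (auto intro!: continuous_intros)
  moreover have "(\<integral>x. indicator {a..<b} x *\<^sub>R ee (s * x) \<partial>lborel) = (\<integral>x. indicator {a..b} x *\<^sub>R ee (s * x) \<partial>lborel)"
    by (intro integral_cong_AE AE_I'[where N="{b}"]) (auto split: split_indicator)
  ultimately show ?thesis by (simp add: diff_divide_distrib)
qed

lemma cnj_indicator [simp]: "cnj (indicator A x) = indicator A x"
  by (simp add: indicator_def)

lemma cmod_indicator [simp]: "cmod (indicator A x) = indicator A x"
  by (simp add: indicator_def)

lemma indicator_square [simp]: "(indicator A x)\<^sup>2 = (indicator A x :: 'a :: semiring_1)"
  by (simp add: indicator_def)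

text \<open>Vanishing off \<open>A\<close> is required at every point, not just almost everywhere:
  the dependences between folded rows are read off from pointwise values.\<close>

definition l2_on :: "real set \<Rightarrow> (real \<Rightarrow> complex) \<Rightarrow> bool" where
  "l2_on A g \<longleftrightarrow> g \<in> borel_measurable borel \<and> integrable lborel (\<lambda>x. (cmod (g x))\<^sup>2) \<and> (\<forall>x. x \<notin> A \<longrightarrow> g x = 0)"

definition energy :: "(real \<Rightarrow> complex) \<Rightarrow> real" where
  "energy g = (\<integral>x. (cmod (g x))\<^sup>2 \<partial>lborel)"

definition ft :: "(real \<Rightarrow> complex) \<Rightarrow> real \<Rightarrow> complex" where
  "ft g s = (\<integral>x. g x * ee (s * x) \<partial>lborel)"

lemma energy_nonneg [simp]: "energy g \<ge> 0"
  by (simp add: energy_def)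

lemma l2_on_measurable: "l2_on A g \<Longrightarrow> g \<in> borel_measurable borel"
  by (simp add: l2_on_def)

lemma l2_on_integrable_square: "l2_on A g \<Longrightarrow> integrable lborel (\<lambda>x. (cmod (g x))\<^sup>2)"
  by (simp add: l2_on_def)

lemma l2_on_mono: "l2_on A g \<Longrightarrow> A \<subseteq> B \<Longrightarrow> l2_on B g"
  by (auto simp: l2_on_def)

lemma l2_onI_dominated:
  assumes "integrable lborel w" "g \<in> borel_measurable borel" "\<And>x. (cmod (g x))\<^sup>2 \<le> w x" "\<And>x. x \<notin> A \<Longrightarrow> g x = 0"
  shows "l2_on A g"
  unfolding l2_on_def
proof (intro conjI)
  show "integrable lborel (\<lambda>x. (cmod (g x))\<^sup>2)"
    by (rule Bochner_Integration.integrable_bound[OF assms(1)])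
      (use assms(2,3) in \<open>auto intro: order_trans[OF _ abs_ge_self]\<close>)
qed (use assms in auto)

lemma l2_on_add:
  assumes "l2_on A g" "l2_on A h"
  shows "l2_on A (\<lambda>x. g x + h x)"
    and "energy (\<lambda>x. g x + h x) \<le> 2 * energy g + 2 * energy h"
proof -
  note [measurable] = assms[THEN l2_on_measurable]
  have le: "(cmod (g x + h x))\<^sup>2 \<le> 2 * (cmod (g x))\<^sup>2 + 2 * (cmod (h x))\<^sup>2" for x
  proof -
    have "(cmod (g x + h x))\<^sup>2 \<le> (cmod (g x) + cmod (h x))\<^sup>2"
      by (intro power_mono norm_triangle_ineq) auto
    also have "\<dots> \<le> 2 * (cmod (g x))\<^sup>2 + 2 * (cmod (h x))\<^sup>2"
      using sum_squares_bound[of "cmod (g x)" "cmod (h x)"] by (simp add: power2_sum)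
    finally show ?thesis .
  qed
  have i: "integrable lborel (\<lambda>x. 2 * (cmod (g x))\<^sup>2 + 2 * (cmod (h x))\<^sup>2)"
    using assms by (auto simp: l2_on_def)
  show l: "l2_on A (\<lambda>x. g x + h x)"
    by (rule l2_onI_dominated[OF i]) (use le assms in \<open>auto simp: l2_on_def\<close>)
  have "energy (\<lambda>x. g x + h x) \<le> (\<integral>x. 2 * (cmod (g x))\<^sup>2 + 2 * (cmod (h x))\<^sup>2 \<partial>lborel)"
    unfolding energy_def by (intro integral_mono i le l2_on_integrable_square[OF l])
  also have "\<dots> = 2 * energy g + 2 * energy h"
    using assms by (subst Bochner_Integration.integral_add) (auto simp: l2_on_def energy_def)
  finally show "energy (\<lambda>x. g x + h x) \<le> 2 * energy g + 2 * energy h" .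
qed

lemma l2_on_mult_bounded:
  assumes "l2_on A g" "b \<in> borel_measurable borel" "\<And>x. x \<in> A \<Longrightarrow> cmod (b x) \<le> C"
  shows "l2_on A (\<lambda>x. b x * g x)"
    and "energy (\<lambda>x. b x * g x) \<le> C\<^sup>2 * energy g"
proof -
  note [measurable] = assms(1)[THEN l2_on_measurable] assms(2)
  have le: "(cmod (b x * g x))\<^sup>2 \<le> C\<^sup>2 * (cmod (g x))\<^sup>2" for x
  proof (cases "x \<in> A")
    case True
    then show ?thesis
      using power_mono[OF assms(3)[OF True], of 2] by (simp add: norm_mult power_mult_distrib mult_right_mono)
  qed (use assms(1) in \<open>auto simp: l2_on_def\<close>)
  have i: "integrable lborel (\<lambda>x. C\<^sup>2 * (cmod (g x))\<^sup>2)"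
    using assms by (auto simp: l2_on_def)
  show l: "l2_on A (\<lambda>x. b x * g x)"
    by (rule l2_onI_dominated[OF i]) (use le assms(1) in \<open>auto simp: l2_on_def\<close>)
  show "energy (\<lambda>x. b x * g x) \<le> C\<^sup>2 * energy g"
    unfolding energy_def using integral_mono[OF l2_on_integrable_square[OF l] i le] by simp
qed

lemma l2_on_cmult: "l2_on A g \<Longrightarrow> l2_on A (\<lambda>x. c * g x)"
  by (rule l2_on_mult_bounded(1)[where C="cmod c"]) auto

lemma energy_cmult: "energy (\<lambda>x. c * g x) = (cmod c)\<^sup>2 * energy g"
  by (simp add: energy_def norm_mult power_mult_distrib)

lemma l2_on_diff:
  assumes "l2_on A g" "l2_on A h"
  shows "l2_on A (\<lambda>x. g x - h x)"
  using l2_on_add(1)[OF assms(1) l2_on_cmult[OF assms(2), of "-1"]] by simp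

lemma l2_on_zero [simp]: "l2_on A (\<lambda>x. 0)"
  by (simp add: l2_on_def)

lemma l2_on_sum: "(\<And>i. i \<in> I \<Longrightarrow> l2_on A (g i)) \<Longrightarrow> l2_on A (\<lambda>x. \<Sum>i\<in>I. g i x)"
  by (induction I rule: infinite_finite_induct) (auto intro: l2_on_add)

lemma l2_on_restrict:
  assumes "l2_on A g" "B \<in> sets borel"
  shows "l2_on (A \<inter> B) (\<lambda>x. indicator B x * g x)"
proof -
  have "l2_on A (\<lambda>x. indicator B x * g x)"
    by (rule l2_on_mult_bounded(1)[OF assms(1), of _ 1]) (use assms(2) in \<open>auto split: split_indicator\<close>)
  then show ?thesis using assms by (auto simp: l2_on_def)
qed

lemma energy_split:
  assumes "l2_on A g" "B \<in> sets borel"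
  shows "energy g = energy (\<lambda>x. indicator B x * g x) + energy (\<lambda>x. indicator (- B) x * g x)"
proof -
  have "- B \<in> sets borel" using assms(2) by auto
  note l = l2_on_restrict[OF assms] l2_on_restrict[OF assms(1) this]
  have "energy g = (\<integral>x. (cmod (indicator B x * g x))\<^sup>2 + (cmod (indicator (- B) x * g x))\<^sup>2 \<partial>lborel)"
    unfolding energy_def by (intro Bochner_Integration.integral_cong) (auto simp: indicator_def)
  also have "\<dots> = energy (\<lambda>x. indicator B x * g x) + energy (\<lambda>x. indicator (- B) x * g x)"
    unfolding energy_def by (intro Bochner_Integration.integral_add l[THEN l2_on_integrable_square])
  finally show ?thesis .
qed

lemma l2_on_integrable_prod:
  assumes "l2_on A g" "l2_on B h"
  shows "integrable lborel (\<lambda>x. g x * cnj (h x))"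
proof (rule Bochner_Integration.integrable_bound)
  show "integrable lborel (\<lambda>x. (cmod (g x))\<^sup>2 + (cmod (h x))\<^sup>2)"
    using assms by (auto simp: l2_on_def)
  show "AE x in lborel. norm (g x * cnj (h x)) \<le> norm ((cmod (g x))\<^sup>2 + (cmod (h x))\<^sup>2)"
  proof (rule AE_I2)
    fix x
    have "2 * (cmod (g x) * cmod (h x)) \<le> (cmod (g x))\<^sup>2 + (cmod (h x))\<^sup>2"
      using sum_squares_bound[of "cmod (g x)" "cmod (h x)"] by simp
    moreover have "0 \<le> cmod (g x) * cmod (h x)" by simp
    ultimately show "norm (g x * cnj (h x)) \<le> norm ((cmod (g x))\<^sup>2 + (cmod (h x))\<^sup>2)"
      unfolding norm_mult complex_mod_cnj real_norm_def by linarith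
  qed
qed (use assms in \<open>auto simp: l2_on_def\<close>)

lemma l2_on_unit:
  assumes "b \<in> borel_measurable borel" "\<And>x. x \<in> {0..<1} \<Longrightarrow> cmod (b x) \<le> C"
  shows "l2_on {0..<1} (\<lambda>x. indicator {0..<1} x * b x)"
    and "energy (\<lambda>x. indicator {0..<1} x * b x) \<le> C\<^sup>2"
proof -
  have "l2_on {0..<1} (indicator {0..<1} :: real \<Rightarrow> complex)"
    by (rule l2_onI_dominated[where w="indicator {0..<1}"]) (auto split: split_indicator)
  from l2_on_mult_bounded[OF this assms]
  show "l2_on {0..<1} (\<lambda>x. indicator {0..<1} x * b x)"
    "energy (\<lambda>x. indicator {0..<1} x * b x) \<le> C\<^sup>2"
    by (auto simp: mult.commute energy_def)
qed

lemma l2_on_integrable: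
  assumes "l2_on {0..<1} g" "b \<in> borel_measurable borel" "\<And>x. cmod (b x) \<le> C"
  shows "integrable lborel (\<lambda>x. g x * b x)"
proof -
  have "l2_on {0..<1} (\<lambda>x. indicator {0..<1} x * cnj (b x))"
    by (rule l2_on_unit) (use assms in auto)
  from l2_on_integrable_prod[OF assms(1) this] 
  have "integrable lborel (\<lambda>x. g x * (indicator {0..<1} x * b x))"
    by simp
  moreover have "(\<lambda>x. g x * (indicator {0..<1} x * b x)) = (\<lambda>x. g x * b x)"
    using assms(1) by (auto simp: l2_on_def fun_eq_iff indicator_def)
  ultimately show ?thesis by simp
qed

lemma l2_on_ft_integrable: "l2_on {0..<1} g \<Longrightarrow> integrable lborel (\<lambda>x. g x * ee (s * x))"
  by (rule l2_on_integrable[where C=1]) auto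

lemma ft_add:
  assumes "l2_on {0..<1} g" "l2_on {0..<1} h"
  shows "ft (\<lambda>x. g x + h x) s = ft g s + ft h s"
  unfolding ft_def ring_distribs by (intro Bochner_Integration.integral_add l2_on_ft_integrable assms)

lemma ft_cmult: "ft (\<lambda>x. c * g x) s = c * ft g s"
  unfolding ft_def mult.assoc by simp

lemma ft_sum:
  assumes "\<And>i. i \<in> I \<Longrightarrow> l2_on {0..<1} (g i)"
  shows "ft (\<lambda>x. \<Sum>i\<in>I. g i x) s = (\<Sum>i\<in>I. ft (g i) s)"
  unfolding ft_def sum_distrib_right by (intro Bochner_Integration.integral_sum l2_on_ft_integrable assms)

section \<open>Trigonometric polynomials and Bessel's inequality\<close>

definition trig_poly :: "int set \<Rightarrow> (int \<Rightarrow> complex) \<Rightarrow> real \<Rightarrow> complex" where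
  "trig_poly N c x = indicator {0..<1} x * (\<Sum>n\<in>N. c n * ee (- of_int n * x))"

lemma l2_on_trig_poly: "l2_on {0..<1} (trig_poly N c)"
  unfolding trig_poly_def
proof (rule l2_on_unit(1))
  show "cmod (\<Sum>n\<in>N. c n * ee (- of_int n * x)) \<le> (\<Sum>n\<in>N. cmod (c n))" for x
    by (rule sum_norm_le) (simp add: norm_mult)
qed auto

lemma integral_mult_cnj_trig_poly:
  assumes "l2_on {0..<1} g"
  shows "(\<integral>x. g x * cnj (trig_poly N c x) \<partial>lborel) = (\<Sum>n\<in>N. cnj (c n) * ft g (of_int n))"
proof -
  have "(\<integral>x. g x * cnj (trig_poly N c x) \<partial>lborel) = (\<integral>x. (\<Sum>n\<in>N. cnj (c n) * (g x * ee (of_int n * x))) \<partial>lborel)"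
  proof (intro Bochner_Integration.integral_cong refl)
    fix x
    show "g x * cnj (trig_poly N c x) = (\<Sum>n\<in>N. cnj (c n) * (g x * ee (of_int n * x)))"
    proof (cases "x \<in> {0..<1}")
      case False
      then have "g x = 0" using assms by (auto simp: l2_on_def)
      then show ?thesis by simp
    qed (simp add: trig_poly_def sum_distrib_left cnj_ee mult_ac)
  qed
  also have "\<dots> = (\<Sum>n\<in>N. cnj (c n) * ft g (of_int n))"
    unfolding ft_def by (subst Bochner_Integration.integral_sum) (auto intro!: l2_on_ft_integrable assms)
  finally show ?thesis .
qed

lemma integral_ee_unit: "(\<integral>x. indicator {0..<1} x *\<^sub>R ee (of_int n * x) \<partial>lborel) = (if n = 0 then 1 else 0)"
proof (cases "n = 0")
  case False
  with integral_ee[of 0 1 "of_int n"] show ?thesis by simp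
qed (simp add: lebesgue_integral_const)

text \<open>\<open>trig_poly\<close> carries the sign opposite to \<open>ft\<close>, so the
  coefficients come back unreflected.\<close>

lemma ft_trig_poly:
  assumes "finite N"
  shows "ft (trig_poly N c) (of_int m) = (if m \<in> N then c m else 0)"
proof -
  have i: "integrable lborel (\<lambda>x. indicator {0..<1} x *\<^sub>R ee (s * x))" for s
    using l2_on_integrable[OF l2_on_unit(1)[of "\<lambda>_. 1" 1], of "\<lambda>x. ee (s * x)" 1]
    by (simp add: scaleR_conv_of_real of_real_indicator)
  have "ft (trig_poly N c) (of_int m) = (\<integral>x. (\<Sum>n\<in>N. c n * (indicator {0..<1} x *\<^sub>R ee (of_int (m - n) * x))) \<partial>lborel)"
    unfolding ft_def trig_poly_def
    by (intro Bochner_Integration.integral_cong refl)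
      (auto simp: sum_distrib_left sum_distrib_right indicator_def algebra_simps ee_add[symmetric] intro!: sum.cong)
  also have "\<dots> = (\<Sum>n\<in>N. c n * (if m - n = 0 then 1 else 0))"
    by (subst Bochner_Integration.integral_sum) (use i in \<open>auto simp only: integral_mult_right_zero integral_ee_unit intro!: integrable_mult_right\<close>)
  also have "\<dots> = (\<Sum>n\<in>N. if n = m then c n else 0)"
    by (intro sum.cong) auto
  also have "\<dots> = (if m \<in> N then c m else 0)"
    using assms by simp
  finally show ?thesis .
qed

lemma of_real_energy: "of_real (energy g) = (\<integral>x. g x * cnj (g x) \<partial>lborel)"
  unfolding energy_def complex_norm_square[symmetric] by (subst integral_complex_of_real[symmetric]) simp

text \<open>Expanding the energy and completing the square in \<open>c\<close>. Taking
  \<open>c\<close> to be the Fourier coefficients gives Bessel's inequality; dropping the last sum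
  turns any good approximation into a lower bound for the energy captured by the
  coefficients.\<close>

lemma energy_diff_trig_poly:
  assumes g: "l2_on {0..<1} g" and N: "finite N"
  shows "energy (\<lambda>x. g x - trig_poly N c x) =
    energy g - (\<Sum>n\<in>N. (cmod (ft g (of_int n)))\<^sup>2) + (\<Sum>n\<in>N. (cmod (c n - ft g (of_int n)))\<^sup>2)"
proof -
  let ?p = "trig_poly N c" and ?f = "\<lambda>n. ft g (of_int n)"
  note l = l2_on_trig_poly[of N c]
  have 1: "(\<integral>x. g x * cnj (?p x) \<partial>lborel) = (\<Sum>n\<in>N. cnj (c n) * ?f n)"
    by (rule integral_mult_cnj_trig_poly[OF g])
  have "(\<integral>x. ?p x * cnj (g x) \<partial>lborel) = (\<integral>x. cnj (g x * cnj (?p x)) \<partial>lborel)"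
    by (simp add: mult.commute)
  also have "\<dots> = cnj (\<integral>x. g x * cnj (?p x) \<partial>lborel)"
    by (rule integral_bounded_linear[OF bounded_linear_cnj l2_on_integrable_prod[OF g l]])
  finally have 2: "(\<integral>x. ?p x * cnj (g x) \<partial>lborel) = (\<Sum>n\<in>N. c n * cnj (?f n))"
    by (simp add: 1)
  have 3: "(\<integral>x. ?p x * cnj (?p x) \<partial>lborel) = (\<Sum>n\<in>N. c n * cnj (c n))"
    by (simp add: integral_mult_cnj_trig_poly[OF l] ft_trig_poly[OF N] mult.commute)
  have "of_real (energy (\<lambda>x. g x - ?p x)) =
      (\<integral>x. g x * cnj (g x) - g x * cnj (?p x) - ?p x * cnj (g x) + ?p x * cnj (?p x) \<partial>lborel)"
    unfolding of_real_energy by (intro Bochner_Integration.integral_cong) (auto simp: algebra_simps)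
  also have "\<dots> = of_real (energy g) - (\<Sum>n\<in>N. cnj (c n) * ?f n) - (\<Sum>n\<in>N. c n * cnj (?f n)) + (\<Sum>n\<in>N. c n * cnj (c n))"
    unfolding of_real_energy 1[symmetric] 2[symmetric] 3[symmetric]
    by (simp add: l2_on_integrable_prod[OF g g] l2_on_integrable_prod[OF g l] l2_on_integrable_prod[OF l g] l2_on_integrable_prod[OF l l])
  also have "\<dots> = of_real (energy g) - (\<Sum>n\<in>N. ?f n * cnj (?f n)) + (\<Sum>n\<in>N. (c n - ?f n) * cnj (c n - ?f n))"
    by (simp add: sum_subtractf sum.distrib algebra_simps)
  also have "\<dots> = of_real (energy g - (\<Sum>n\<in>N. (cmod (?f n))\<^sup>2) + (\<Sum>n\<in>N. (cmod (c n - ?f n))\<^sup>2))"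
    unfolding complex_norm_square[symmetric] by simp
  finally show ?thesis using of_real_eq_iff by blast
qed

lemma bessel_inequality:
  assumes "l2_on {0..<1} g" "finite N"
  shows "(\<Sum>n\<in>N. (cmod (ft g (of_int n)))\<^sup>2) \<le> energy g"
  using energy_diff_trig_poly[OF assms, of "\<lambda>n. ft g (of_int n)"] energy_nonneg[of "\<lambda>x. g x - trig_poly N (\<lambda>n. ft g (of_int n)) x"]
  by simp

text \<open>A divergent sum would have the value 0 here and spoil every lower bound; Bessel's
  inequality guarantees convergence for square-integrable signals on the unit interval.\<close>

definition sample_energy :: "int set \<Rightarrow> (real \<Rightarrow> complex) \<Rightarrow> real" where
  "sample_energy \<Lambda> g = (\<Sum>\<^sub>\<infinity>n\<in>\<Lambda>. (cmod (ft g (of_int n)))\<^sup>2)"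

lemma sample_energy_summable:
  assumes "l2_on {0..<1} g"
  shows "(\<lambda>n. (cmod (ft g (of_int n)))\<^sup>2) summable_on \<Lambda>"
  by (rule nonneg_bdd_above_summable_on)
    (auto intro!: bdd_aboveI[where M="energy g"] bessel_inequality[OF assms])

lemma sample_energy_le:
  assumes "l2_on {0..<1} g"
  shows "sample_energy \<Lambda> g \<le> energy g"
  unfolding sample_energy_def
  by (rule infsum_le_finite_sums[OF sample_energy_summable[OF assms]]) (rule bessel_inequality[OF assms])

lemma sum_le_sample_energy:
  assumes "l2_on {0..<1} g" "finite N" "N \<subseteq> \<Lambda>"
  shows "(\<Sum>n\<in>N. (cmod (ft g (of_int n)))\<^sup>2) \<le> sample_energy \<Lambda> g"
  unfolding sample_energy_def using assms
  by (intro finite_sum_le_infsum sample_energy_summable) auto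

lemma sample_energy_nonneg [simp]: "0 \<le> sample_energy \<Lambda> g"
  unfolding sample_energy_def by (intro infsum_nonneg) auto

lemma sample_energy_add:
  assumes "l2_on {0..<1} g" "l2_on {0..<1} h"
  shows "sample_energy \<Lambda> (\<lambda>x. g x + h x) \<le> 2 * sample_energy \<Lambda> g + 2 * sample_energy \<Lambda> h"
proof -
  have "sample_energy \<Lambda> (\<lambda>x. g x + h x) \<le>
      (\<Sum>\<^sub>\<infinity>n\<in>\<Lambda>. 2 * (cmod (ft g (of_int n)))\<^sup>2 + 2 * (cmod (ft h (of_int n)))\<^sup>2)"
    unfolding sample_energy_def
  proof (rule infsum_mono)
    show "(\<lambda>n. (cmod (ft (\<lambda>x. g x + h x) (of_int n)))\<^sup>2) summable_on \<Lambda>"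
      by (intro sample_energy_summable l2_on_add assms)
    show "(\<lambda>n. 2 * (cmod (ft g (of_int n)))\<^sup>2 + 2 * (cmod (ft h (of_int n)))\<^sup>2) summable_on \<Lambda>"
      by (intro summable_on_add summable_on_cmult_right sample_energy_summable assms)
    fix n
    have "(cmod (ft g (of_int n) + ft h (of_int n)))\<^sup>2 \<le> (cmod (ft g (of_int n)) + cmod (ft h (of_int n)))\<^sup>2"
      by (intro power_mono norm_triangle_ineq) auto
    also have "\<dots> \<le> 2 * (cmod (ft g (of_int n)))\<^sup>2 + 2 * (cmod (ft h (of_int n)))\<^sup>2"
      using sum_squares_bound[of "cmod (ft g (of_int n))" "cmod (ft h (of_int n))"] by (simp add: power2_sum)
    finally show "(cmod (ft (\<lambda>x. g x + h x) (of_int n)))\<^sup>2 \<le> 2 * (cmod (ft g (of_int n)))\<^sup>2 + 2 * (cmod (ft h (of_int n)))\<^sup>2"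
      by (simp add: ft_add assms)
  qed
  also have "\<dots> = 2 * sample_energy \<Lambda> g + 2 * sample_energy \<Lambda> h"
    unfolding sample_energy_def
    by (subst infsum_add) (auto intro!: summable_on_cmult_right sample_energy_summable assms simp: infsum_cmult_right sample_energy_summable assms)
  finally show ?thesis .
qed

section \<open>Parseval's inequality\<close>

text \<open>Membership in the L^2 closure of the trigonometric polynomials, phrased with functions
  instead of equivalence classes. That it holds for every square-integrable function is the
  completeness behind Parseval's identity.\<close>

definition trig_closed :: "(real \<Rightarrow> complex) \<Rightarrow> bool" where
  "trig_closed g \<longleftrightarrow> l2_on {0..<1} g \<and>
     (\<forall>\<epsilon>>0. \<exists>N c. finite N \<and> energy (\<lambda>x. g x - trig_poly N c x) < \<epsilon>)"

lemma trig_closed_l2: "trig_closed g \<Longrightarrow> l2_on {0..<1} g"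
  by (simp add: trig_closed_def)

lemma trig_closedD:
  assumes "trig_closed g" "\<epsilon> > 0"
  obtains N c where "finite N" "energy (\<lambda>x. g x - trig_poly N c x) < \<epsilon>"
  using assms by (auto simp: trig_closed_def)

lemma trig_poly_add:
  assumes "finite N" "finite M"
  shows "trig_poly N c x + trig_poly M d x =
    trig_poly (N \<union> M) (\<lambda>n. (if n \<in> N then c n else 0) + (if n \<in> M then d n else 0)) x"
proof -
  have "(\<Sum>n\<in>N. c n * ee (- of_int n * x)) = (\<Sum>n\<in>N \<union> M. (if n \<in> N then c n else 0) * ee (- of_int n * x))"
    "(\<Sum>n\<in>M. d n * ee (- of_int n * x)) = (\<Sum>n\<in>N \<union> M. (if n \<in> M then d n else 0) * ee (- of_int n * x))"
    using assms by (intro sum.mono_neutral_cong_left; auto)+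
  then show ?thesis by (simp add: trig_poly_def sum.distrib ring_distribs)
qed

lemma trig_closed_trig_poly: "finite N \<Longrightarrow> trig_closed (trig_poly N c)"
  unfolding trig_closed_def
  by (auto intro!: l2_on_trig_poly exI[of _ N] exI[of _ c] simp: energy_def)

lemma trig_closed_limit:
  assumes "l2_on {0..<1} g" "\<And>\<epsilon>. \<epsilon> > 0 \<Longrightarrow> \<exists>h. trig_closed h \<and> energy (\<lambda>x. g x - h x) < \<epsilon>"
  shows "trig_closed g"
  unfolding trig_closed_def
proof (intro conjI allI impI assms(1))
  fix \<epsilon> :: real assume "\<epsilon> > 0"
  then have e4: "\<epsilon> / 4 > 0" by simp
  obtain h where h: "trig_closed h" "energy (\<lambda>x. g x - h x) < \<epsilon> / 4"
    using assms(2)[OF e4] by auto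
  obtain N c where N: "finite N" "energy (\<lambda>x. h x - trig_poly N c x) < \<epsilon> / 4"
    using trig_closedD[OF h(1) e4] .
  have "energy (\<lambda>x. (g x - h x) + (h x - trig_poly N c x)) \<le>
      2 * energy (\<lambda>x. g x - h x) + 2 * energy (\<lambda>x. h x - trig_poly N c x)"
    by (intro l2_on_add(2)[where A="{0..<1}"] l2_on_diff assms(1) trig_closed_l2[OF h(1)] l2_on_trig_poly)
  with h N show "\<exists>N c. finite N \<and> energy (\<lambda>x. g x - trig_poly N c x) < \<epsilon>"
    by (intro exI[of _ N] exI[of _ c]) simp
qed

lemma trig_closed_add:
  assumes "trig_closed g" "trig_closed h"
  shows "trig_closed (\<lambda>x. g x + h x)"
  unfolding trig_closed_def
proof (intro conjI allI impI)
  note l = assms[THEN trig_closed_l2]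
  show "l2_on {0..<1} (\<lambda>x. g x + h x)" using l by (rule l2_on_add)
  fix \<epsilon> :: real assume "\<epsilon> > 0"
  then have e4: "\<epsilon> / 4 > 0" by simp
  obtain N c where N: "finite N" "energy (\<lambda>x. g x - trig_poly N c x) < \<epsilon> / 4"
    using trig_closedD[OF assms(1) e4] .
  obtain M d where M: "finite M" "energy (\<lambda>x. h x - trig_poly M d x) < \<epsilon> / 4"
    using trig_closedD[OF assms(2) e4] .
  have "energy (\<lambda>x. (g x - trig_poly N c x) + (h x - trig_poly M d x)) \<le>
      2 * energy (\<lambda>x. g x - trig_poly N c x) + 2 * energy (\<lambda>x. h x - trig_poly M d x)"
    by (intro l2_on_add(2)[where A="{0..<1}"] l2_on_diff l l2_on_trig_poly)
  then have "energy (\<lambda>x. (g x + h x) - (trig_poly N c x + trig_poly M d x)) < \<epsilon>"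
    using N M by (simp add: algebra_simps)
  then show "\<exists>N c. finite N \<and> energy (\<lambda>x. (g x + h x) - trig_poly N c x) < \<epsilon>"
    unfolding trig_poly_add[OF N(1) M(1)] using N M by blast
qed

lemma trig_closed_cmult:
  assumes "trig_closed g"
  shows "trig_closed (\<lambda>x. a * g x)"
  unfolding trig_closed_def
proof (intro conjI allI impI)
  show "l2_on {0..<1} (\<lambda>x. a * g x)" using assms by (intro l2_on_cmult trig_closed_l2)
  fix \<epsilon> :: real assume "\<epsilon> > 0"
  then have e: "\<epsilon> / ((cmod a)\<^sup>2 + 1) > 0" by (intro divide_pos_pos) (auto intro: add_nonneg_pos)
  obtain N c where N: "finite N" "energy (\<lambda>x. g x - trig_poly N c x) < \<epsilon> / ((cmod a)\<^sup>2 + 1)"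
    using trig_closedD[OF assms e] .
  have "energy (\<lambda>x. a * g x - trig_poly N (\<lambda>n. a * c n) x) = (cmod a)\<^sup>2 * energy (\<lambda>x. g x - trig_poly N c x)"
    unfolding energy_cmult[symmetric]
    by (simp add: trig_poly_def sum_distrib_left algebra_simps)
  also have "\<dots> \<le> ((cmod a)\<^sup>2 + 1) * energy (\<lambda>x. g x - trig_poly N c x)"
    by (intro mult_right_mono) auto
  also have "\<dots> < \<epsilon>"
    using N(2) by (subst mult.commute, subst pos_less_divide_eq[symmetric]) (auto intro: add_nonneg_pos)
  finally show "\<exists>N c. finite N \<and> energy (\<lambda>x. a * g x - trig_poly N c x) < \<epsilon>"
    using N(1) by blast
qed

lemma trig_closed_zero [simp]: "trig_closed (\<lambda>x. 0)"
  using trig_closed_trig_poly[of "{}" "\<lambda>_. 0"] by (simp add: trig_poly_def[abs_def])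

lemma trig_closed_sum: "(\<And>i. i \<in> I \<Longrightarrow> trig_closed (g i)) \<Longrightarrow> trig_closed (\<lambda>x. \<Sum>i\<in>I. g i x)"
  by (induction I rule: infinite_finite_induct) (auto intro: trig_closed_add)

lemma trig_closed_modulate:
  assumes "trig_closed g"
  shows "trig_closed (\<lambda>x. ee (- of_int k * x) * g x)"
  unfolding trig_closed_def
proof (intro conjI allI impI)
  note l = trig_closed_l2[OF assms]
  show "l2_on {0..<1} (\<lambda>x. ee (- of_int k * x) * g x)" by (rule l2_on_mult_bounded(1)[OF l, where C=1]) auto
  fix \<epsilon> :: real assume e: "\<epsilon> > 0"
  obtain N c where N: "finite N" "energy (\<lambda>x. g x - trig_poly N c x) < \<epsilon>"
    using trig_closedD[OF assms e] .
  have *: "trig_poly ((+) k ` N) (\<lambda>n. c (n - k)) x = ee (- of_int k * x) * trig_poly N c x" for x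
    unfolding trig_poly_def
    by (subst sum.reindex) (auto simp: sum_distrib_left algebra_simps ee_add[symmetric] intro!: sum.cong)
  have "energy (\<lambda>x. ee (- of_int k * x) * g x - trig_poly ((+) k ` N) (\<lambda>n. c (n - k)) x) =
      energy (\<lambda>x. ee (- of_int k * x) * (g x - trig_poly N c x))"
    unfolding * by (simp add: algebra_simps)
  also have "\<dots> \<le> 1\<^sup>2 * energy (\<lambda>x. g x - trig_poly N c x)"
    by (rule l2_on_mult_bounded(2)[OF l2_on_diff[OF l l2_on_trig_poly]]) auto
  finally show "\<exists>N c. finite N \<and> energy (\<lambda>x. ee (- of_int k * x) * g x - trig_poly N c x) < \<epsilon>"
    using N by (intro exI[of _ "(+) k ` N"] exI[of _ "\<lambda>n. c (n - k)"]) auto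
qed

lemma ft_ident:
  "ft (\<lambda>x. indicator {0..<1} x * complex_of_real x) (of_int n) = (if n = 0 then 1/2 else 1 / (2 * pi * \<i> * of_int n))"
proof -
  have ind: "indicator {0..<1} x = (indicator {0..1} x :: complex)" if "x \<noteq> 1" for x :: real
    using that by (auto simp: indicator_def)
  have eq: "ft (\<lambda>x. indicator {0..<1} x * complex_of_real x) s =
      (\<integral>x. indicator {0..1} x *\<^sub>R (of_real x * ee (s * x)) \<partial>lborel)" for s
    unfolding ft_def
    by (intro integral_cong_AE AE_I'[where N="{1}"]) (auto simp: indicator_def)
  show ?thesis
  proof (cases "n = 0")
    case True
    have "((\<lambda>x. complex_of_real (x\<^sup>2 / 2)) has_vector_derivative of_real x) (at x within {0..1})" for x
      by (rule has_vector_derivative_of_real) (auto intro!: derivative_eq_intros)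
    then have "((\<lambda>x. complex_of_real (x\<^sup>2 / 2)) has_vector_derivative of_real x * ee (0 * x)) (at x within {0..1})" for x
      by simp
    then have "(\<integral>x. indicator {0..1} x *\<^sub>R (of_real x * ee (0 * x)) \<partial>lborel) = complex_of_real (1\<^sup>2 / 2) - complex_of_real (0\<^sup>2 / 2)"
      by (intro integral_FTC_Icc) (auto intro!: continuous_intros)
    then show ?thesis using eq[of 0] True by simp
  next
    case False
    define A where "A = 2 * pi * \<i> * complex_of_int n"
    have A: "A \<noteq> 0" using False by (simp add: A_def)
    have ee: "ee (of_int n * x) = exp (x *\<^sub>R A)" for x
      by (simp add: ee_eq_exp A_def scaleR_conv_of_real mult_ac)
    have "((\<lambda>x. of_real x * exp (x *\<^sub>R A) / A - exp (x *\<^sub>R A) / A\<^sup>2) has_vector_derivative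
        of_real x * exp (x *\<^sub>R A)) (at x within {0..1})" for x
    proof -
      have "((\<lambda>x. of_real x * exp (x *\<^sub>R A) / A - exp (x *\<^sub>R A) / A\<^sup>2) has_vector_derivative
        (of_real x * (exp (x *\<^sub>R A) * A) + of_real 1 * exp (x *\<^sub>R A)) / A - (exp (x *\<^sub>R A) * A) / A\<^sup>2) (at x within {0..1})"
        by (intro has_vector_derivative_diff has_vector_derivative_divide has_vector_derivative_mult
            exp_scaleR_has_vector_derivative_right has_vector_derivative_of_real DERIV_ident)
      then show ?thesis using A by (simp add: field_simps power2_eq_square)
    qed
    then have "(\<integral>x. indicator {0..1} x *\<^sub>R (of_real x * exp (x *\<^sub>R A)) \<partial>lborel) =
        (of_real 1 * exp (1 *\<^sub>R A) / A - exp (1 *\<^sub>R A) / A\<^sup>2) - (of_real 0 * exp (0 *\<^sub>R A) / A - exp (0 *\<^sub>R A) / A\<^sup>2)"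
      by (intro integral_FTC_Icc) (auto intro!: continuous_intros)
    moreover have "exp A = 1" using ee[of 1] by simp
    ultimately show ?thesis using eq[of "of_int n"] False A by (simp add: ee A_def)
  qed
qed

lemma energy_ident: "energy (\<lambda>x. indicator {0..<1} x * complex_of_real x) = 1 / 3"
proof -
  have "energy (\<lambda>x. indicator {0..<1} x * complex_of_real x) = (\<integral>x. x\<^sup>2 * indicator {0..1} x \<partial>lborel)"
    unfolding energy_def
    by (intro integral_cong_AE AE_I'[where N="{1}"]) (auto simp: indicator_def)
  also have "\<dots> = 1^3 / 3 - 0^3 / 3"
    by (rule integral_FTC_Icc_real) (auto intro!: derivative_eq_intros simp: power2_eq_square)
  finally show ?thesis by simp
qed

text \<open>Parseval's identity for \<open>x\<close> is the evaluation of \<open>\<zeta>(2)\<close>; since the closure of the trigonometric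
  polynomials is stable under multiplication by \<open>x\<close>, it then contains all polynomials.\<close>

lemma trig_closed_ident: "trig_closed (\<lambda>x. indicator {0..<1} x * complex_of_real x)"
  unfolding trig_closed_def
proof (intro conjI allI impI)
  let ?g = "\<lambda>x. indicator {0..<1} x * complex_of_real x"
  show l: "l2_on {0..<1} ?g"
    by (rule l2_on_unit(1)[where C=1]) auto
  fix \<epsilon> :: real assume e: "\<epsilon> > 0"
  let ?N = "\<lambda>K::nat. {- int K..int K}"
  have sum: "(\<Sum>n\<in>?N K. (cmod (ft ?g (of_int n)))\<^sup>2) = 1/4 + (\<Sum>k<K. 1 / (real k + 1)\<^sup>2) / (2 * pi\<^sup>2)" for K
  proof (induction K)
    case 0
    have "(cmod (ft ?g (of_int 0)))\<^sup>2 = 1 / 4" unfolding ft_ident by (simp add: norm_divide power_divide)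
    then show ?case by simp
  next
    case (Suc K)
    have "?N (Suc K) = insert (int K + 1) (insert (- (int K + 1)) (?N K))" by auto
    then have "(\<Sum>n\<in>?N (Suc K). (cmod (ft ?g (of_int n)))\<^sup>2) =
        (cmod (ft ?g (of_int (int K + 1))))\<^sup>2 + ((cmod (ft ?g (of_int (- (int K + 1)))))\<^sup>2 + (\<Sum>n\<in>?N K. (cmod (ft ?g (of_int n)))\<^sup>2))"
      by simp
    also have "(cmod (ft ?g (of_int (int K + 1))))\<^sup>2 = 1 / (4 * pi\<^sup>2 * (real K + 1)\<^sup>2)"
      unfolding ft_ident by (simp add: norm_divide norm_mult power_divide power_mult_distrib del: of_int_add of_int_diff)
    also have "(cmod (ft ?g (of_int (- (int K + 1)))))\<^sup>2 = 1 / (4 * pi\<^sup>2 * (real K + 1)\<^sup>2)"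
      unfolding ft_ident by (simp add: norm_divide norm_mult power_divide power_mult_distrib del: of_int_add of_int_diff)
        (simp add: power2_eq_square algebra_simps)
    finally show ?case
      unfolding Suc by (simp add: add_divide_distrib divide_divide_eq_left)
  qed
  have S: "(\<lambda>K. \<Sum>k<K. 1 / (real k + 1)\<^sup>2) \<longlonglongrightarrow> pi\<^sup>2 / 6"
    using inverse_squares_sums unfolding sums_def by (simp add: add.commute)
  \<comment> \<open>The limit is 1/4 + 1/12 = 1/3, exactly the value in \<open>energy_ident\<close>:
    no energy escapes the coefficients.\<close>
  have "(\<lambda>K. 1/4 + (\<Sum>k<K. 1 / (real k + 1)\<^sup>2) / (2 * pi\<^sup>2)) \<longlonglongrightarrow> 1/4 + (pi\<^sup>2 / 6) / (2 * pi\<^sup>2)"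
    by (intro tendsto_intros S) auto
  then have "(\<lambda>K. 1/3 - (\<Sum>n\<in>?N K. (cmod (ft ?g (of_int n)))\<^sup>2)) \<longlonglongrightarrow> 1/3 - (1/4 + (pi\<^sup>2 / 6) / (2 * pi\<^sup>2))"
    unfolding sum by (intro tendsto_diff tendsto_const)
  then have "(\<lambda>K. 1/3 - (\<Sum>n\<in>?N K. (cmod (ft ?g (of_int n)))\<^sup>2)) \<longlonglongrightarrow> 0"
    by simp
  then obtain K where K: "1/3 - (\<Sum>n\<in>?N K. (cmod (ft ?g (of_int n)))\<^sup>2) < \<epsilon>"
    using eventually_happens'[OF sequentially_bot order_tendstoD(2)[OF _ e]] by blast
  have "energy (\<lambda>x. ?g x - trig_poly (?N K) (\<lambda>n. ft ?g (of_int n)) x) < \<epsilon>"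
    using energy_diff_trig_poly[OF l, of "?N K" "\<lambda>n. ft ?g (of_int n)"] K by (simp add: energy_ident)
  then show "\<exists>N c. finite N \<and> energy (\<lambda>x. ?g x - trig_poly N c x) < \<epsilon>"
    by blast
qed

text \<open>With a trigonometric polynomial \<open>p\<close> close to \<open>x\<close>, the error
  \<open>x q - p q = q (x - p)\<close> is small because \<open>q\<close> is bounded, and
  \<open>p q\<close> is a combination of modulations of \<open>q\<close>, which stay in the
  closure.\<close>

lemma trig_closed_mult_ident:
  assumes "trig_closed q" "\<And>x. cmod (q x) \<le> C"
  shows "trig_closed (\<lambda>x. of_real x * q x)"
proof (rule trig_closed_limit)
  note l = trig_closed_l2[OF assms(1)]
  show l': "l2_on {0..<1} (\<lambda>x. of_real x * q x)" by (rule l2_on_mult_bounded(1)[OF l, where C=1]) auto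
  fix \<epsilon> :: real assume "\<epsilon> > 0"
  then have e: "\<epsilon> / (C\<^sup>2 + 1) > 0" by (intro divide_pos_pos) (auto intro: add_nonneg_pos)
  let ?i = "\<lambda>x. indicator {0..<1} x * complex_of_real x"
  obtain N c where N: "finite N" "energy (\<lambda>x. ?i x - trig_poly N c x) < \<epsilon> / (C\<^sup>2 + 1)"
    using trig_closedD[OF trig_closed_ident e] .
  let ?h = "\<lambda>x. \<Sum>n\<in>N. c n * (ee (- of_int n * x) * q x)"
  have "trig_closed ?h"
    by (intro trig_closed_sum trig_closed_cmult trig_closed_modulate assms)
  moreover have "energy (\<lambda>x. of_real x * q x - ?h x) < \<epsilon>"
  proof -
    have *: "of_real x * q x - ?h x = q x * (?i x - trig_poly N c x)" for x
    proof (cases "x \<in> {0..<1}")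
      case False then have "q x = 0" using l by (auto simp: l2_on_def)
      then show ?thesis by simp
    next
      case True
      then show ?thesis by (simp add: trig_poly_def sum_distrib_left algebra_simps)
    qed
    have "energy (\<lambda>x. of_real x * q x - ?h x) \<le> C\<^sup>2 * energy (\<lambda>x. ?i x - trig_poly N c x)"
      unfolding * using l2_on_measurable[OF l] assms(2)
      by (intro l2_on_mult_bounded(2)[OF l2_on_diff[OF trig_closed_l2[OF trig_closed_ident] l2_on_trig_poly]]) auto
    also have "\<dots> \<le> (C\<^sup>2 + 1) * energy (\<lambda>x. ?i x - trig_poly N c x)"
      by (intro mult_right_mono) auto
    also have "\<dots> < \<epsilon>"
      using N(2) by (subst mult.commute, subst pos_less_divide_eq[symmetric]) (auto intro: add_nonneg_pos)
    finally show ?thesis .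
  qed
  ultimately show "\<exists>h. trig_closed h \<and> energy (\<lambda>x. of_real x * q x - h x) < \<epsilon>" by blast
qed

lemma trig_closed_power: "trig_closed (\<lambda>x. indicator {0..<1} x * complex_of_real x ^ i)"
proof (induction i)
  case 0
  show ?case using trig_closed_trig_poly[of "{0}" "\<lambda>_. 1"] by (simp add: trig_poly_def[abs_def])
next
  case (Suc i)
  have "trig_closed (\<lambda>x. of_real x * (indicator {0..<1} x * complex_of_real x ^ i))"
    by (rule trig_closed_mult_ident[OF Suc, where C=1])
      (auto simp: indicator_def norm_power intro: power_le_one)
  then show ?case by (simp add: mult_ac)
qed

lemma trig_closed_real_polynomial_function:
  assumes "real_polynomial_function p"
  shows "trig_closed (\<lambda>x. indicator {0..<1} x * complex_of_real (p x))"
proof -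
  obtain a n where p: "p = (\<lambda>x. \<Sum>i\<le>n. a i * x ^ i)"
    using assms unfolding real_polynomial_function_iff_sum by auto
  have "trig_closed (\<lambda>x. \<Sum>i\<le>n. of_real (a i) * (indicator {0..<1} x * complex_of_real x ^ i))"
    by (intro trig_closed_sum trig_closed_cmult trig_closed_power)
  then show ?thesis by (simp add: p sum_distrib_left mult_ac)
qed

section \<open>Density of the trigonometric polynomials in L^2\<close>

lemma trig_closed_continuous_real:
  assumes "continuous_on UNIV h"
  shows "trig_closed (\<lambda>x. indicator {0..<1} x * complex_of_real (h x))"
proof (rule trig_closed_limit)
  have [measurable]: "h \<in> borel_measurable borel"
    using assms by (rule borel_measurable_continuous_onI)
  have cont: "continuous_on {0..1} h" using assms continuous_on_subset by blast
  then have "compact (h ` {0..1})" by (intro compact_continuous_image) auto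
  then have "bounded (h ` {0..1})" by (rule compact_imp_bounded)
  then obtain C where "\<forall>y\<in>h ` {0..1}. norm y \<le> C" unfolding bounded_iff ..
  then have C: "\<bar>h x\<bar> \<le> C" if "x \<in> {0..1}" for x using that by auto
  show "l2_on {0..<1} (\<lambda>x. indicator {0..<1} x * complex_of_real (h x))"
    by (rule l2_on_unit(1)[where C=C]) (use C in auto)
  fix \<epsilon> :: real assume e: "\<epsilon> > 0"
  \<comment> \<open>Algebraic polynomials are the right tool: \<open>h 0\<close> and
    \<open>h 1\<close> may differ, and then uniform approximation by trigonometric polynomials would
    fail.\<close>
  obtain p where p: "real_polynomial_function p" "\<And>x. x \<in> {0..1} \<Longrightarrow> \<bar>h x - p x\<bar> < sqrt (\<epsilon> / 2)"
    using Stone_Weierstrass_real_polynomial_function[of "{0..1::real}" h "sqrt (\<epsilon> / 2)"] cont e by auto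
  have [measurable]: "p \<in> borel_measurable borel"
    by (intro borel_measurable_continuous_onI continuous_on_polymonial_function) (use p(1) in \<open>simp add: real_polynomial_function_eq\<close>)
  have "energy (\<lambda>x. indicator {0..<1} x * complex_of_real (h x - p x)) \<le> (sqrt (\<epsilon> / 2))\<^sup>2"
    by (rule l2_on_unit(2)) (use p in \<open>auto simp del: of_real_diff intro!: less_imp_le\<close>)
  then have "energy (\<lambda>x. indicator {0..<1} x * complex_of_real (h x) - indicator {0..<1} x * complex_of_real (p x)) < \<epsilon>"
    using e by (simp add: algebra_simps)
  then show "\<exists>g. trig_closed g \<and> energy (\<lambda>x. indicator {0..<1} x * complex_of_real (h x) - g x) < \<epsilon>"
    using trig_closed_real_polynomial_function[OF p(1)] by blast
qed

lemma trig_closed_continuous: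
  fixes h :: "real \<Rightarrow> complex"
  assumes "continuous_on UNIV h"
  shows "trig_closed (\<lambda>x. indicator {0..<1} x * h x)"
proof -
  have "trig_closed (\<lambda>x. indicator {0..<1} x * complex_of_real (Re (h x)) + \<i> * (indicator {0..<1} x * complex_of_real (Im (h x))))"
    by (intro trig_closed_add trig_closed_cmult trig_closed_continuous_real continuous_intros assms)
  moreover have "(\<lambda>x. indicator {0..<1} x * complex_of_real (Re (h x)) + \<i> * (indicator {0..<1} x * complex_of_real (Im (h x)))) =
      (\<lambda>x. indicator {0..<1} x * h x)"
    by (auto simp: fun_eq_iff complex_eq_iff indicator_def)
  ultimately show ?thesis by simp
qed

lemma trig_closed_AE_limit:
  assumes g: "l2_on {0..<1} g" and h: "\<And>n. trig_closed (h n)" and w: "integrable lborel w"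
    and le: "\<And>n x. (cmod (g x - h n x))\<^sup>2 \<le> w x"
    and lim: "AE x in lborel. (\<lambda>n. h n x) \<longlonglongrightarrow> g x"
  shows "trig_closed g"
proof (rule trig_closed_limit[OF g])
  fix \<epsilon> :: real assume e: "\<epsilon> > 0"
  note [measurable] = l2_on_measurable[OF g] l2_on_measurable[OF trig_closed_l2[OF h]]
  have "(\<lambda>n. energy (\<lambda>x. g x - h n x)) \<longlonglongrightarrow> (\<integral>x. 0 \<partial>(lborel :: real measure))"
    unfolding energy_def
  proof (rule Bochner_Integration.integral_dominated_convergence[where w=w and f="\<lambda>_. 0" and s="\<lambda>n x. (cmod (g x - h n x))\<^sup>2"])
    show "AE x in lborel. (\<lambda>n. (cmod (g x - h n x))\<^sup>2) \<longlonglongrightarrow> 0"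
      using lim
    proof eventually_elim
      case (elim x)
      then have "(\<lambda>n. (cmod (g x - h n x))\<^sup>2) \<longlonglongrightarrow> (cmod (g x - g x))\<^sup>2"
        by (intro tendsto_intros)
      then show ?case by simp
    qed
  qed (use le w in auto)
  then have "eventually (\<lambda>n. energy (\<lambda>x. g x - h n x) < \<epsilon>) sequentially"
    using e by (intro order_tendstoD) auto
  then show "\<exists>h. trig_closed h \<and> energy (\<lambda>x. g x - h x) < \<epsilon>"
    using h by (auto simp: eventually_sequentially)
qed

text \<open>\<open>clip K\<close> is the radial retraction onto the disc of radius \<open>K\<close>, written so as to be visibly continuous.\<close>

definition clip :: "real \<Rightarrow> complex \<Rightarrow> complex" where
  "clip K z = of_real (K / max K (cmod z)) * z"

lemma cmod_clip: "K > 0 \<Longrightarrow> cmod (clip K z) \<le> K"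
  by (auto simp: clip_def norm_mult norm_divide max_def field_simps)

lemma clip_eq: "cmod z \<le> K \<Longrightarrow> K > 0 \<Longrightarrow> clip K z = z"
  by (simp add: clip_def max_def)

lemma cmod_diff_clip: "K > 0 \<Longrightarrow> cmod (z - clip K z) \<le> cmod z"
proof -
  assume K: "K > 0"
  have "z - clip K z = of_real (1 - K / max K (cmod z)) * z"
    by (simp add: clip_def algebra_simps)
  moreover have "0 \<le> K / max K (cmod z)" "K / max K (cmod z) \<le> 1"
    using K by (auto simp: max_def divide_le_eq_1)
  then have "\<bar>1 - K / max K (cmod z)\<bar> \<le> 1" by simp
  ultimately show ?thesis
    by (metis mult_left_le_one_le norm_ge_zero norm_mult norm_of_real abs_ge_zero)
qed

lemma continuous_on_clip [continuous_intros]: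
  "K > 0 \<Longrightarrow> continuous_on S f \<Longrightarrow> continuous_on S (\<lambda>x. clip K (f x))"
  unfolding clip_def by (intro continuous_intros) auto

text \<open>A measurable function is an almost everywhere limit of continuous ones; clipping these
  at the bound \<open>K\<close> supplies the dominating function and does not disturb the
  limit.\<close>

lemma l2_on_trig_closed_bounded:
  assumes g: "l2_on {0..<1} g" and K: "K > 0" "\<And>x. cmod (g x) \<le> K"
  shows "trig_closed g"
proof -
  have "g \<in> borel_measurable lebesgue"
    using l2_on_measurable[OF g] by (intro measurable_completion) simp
  then have "g measurable_on UNIV"
    by (intro lebesgue_measurable_imp_measurable_on) auto
  then obtain N \<phi> where N: "negligible N" and \<phi>: "\<And>n. continuous_on UNIV (\<phi> n)"
      "\<And>x. x \<notin> N \<Longrightarrow> (\<lambda>n. \<phi> n x) \<longlonglongrightarrow> g x"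
    unfolding measurable_on_def by auto
  show ?thesis
  proof (rule trig_closed_AE_limit[OF g, where h="\<lambda>n x. indicator {0..<1} x * clip K (\<phi> n x)" and w="\<lambda>x. indicator {0..<1} x * (2 * K)\<^sup>2"])
    show "trig_closed (\<lambda>x. indicator {0..<1} x * clip K (\<phi> n x))" for n
      by (intro trig_closed_continuous continuous_intros \<phi> K)
    show "integrable lborel (\<lambda>x. indicator {0..<1::real} x * (2 * K)\<^sup>2)" by simp
    show "(cmod (g x - indicator {0..<1} x * clip K (\<phi> n x)))\<^sup>2 \<le> indicator {0..<1} x * (2 * K)\<^sup>2" for n x
    proof (cases "x \<in> {0..<1}")
      case True
      have "cmod (g x - clip K (\<phi> n x)) \<le> 2 * K"
        using K(2)[of x] cmod_clip[OF K(1), of "\<phi> n x"] norm_triangle_ineq4[of "g x" "clip K (\<phi> n x)"] by linarith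
      then show ?thesis using True K power_mono[of "cmod (g x - clip K (\<phi> n x))" "2 * K" 2] by simp
    qed (use g in \<open>auto simp: l2_on_def\<close>)
    have "AE x in lebesgue. x \<notin> N"
      using N by (intro AE_not_in) (simp add: negligible_iff_null_sets)
    then have "AE x in lborel. x \<notin> N" by (simp add: AE_completion_iff)
    then show "AE x in lborel. (\<lambda>n. indicator {0..<1} x * clip K (\<phi> n x)) \<longlonglongrightarrow> g x"
    proof eventually_elim
      case (elim x)
      have "isCont (clip K) (g x)"
        using continuous_on_clip[OF K(1), of UNIV "\<lambda>x. x"] by (simp add: continuous_on_eq_continuous_at)
      then have "(\<lambda>n. clip K (\<phi> n x)) \<longlonglongrightarrow> clip K (g x)"
        using \<phi>(2)[OF elim] isCont_tendsto_compose by blast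
      then have "(\<lambda>n. indicator {0..<1} x * clip K (\<phi> n x)) \<longlonglongrightarrow> indicator {0..<1} x * clip K (g x)"
        by (intro tendsto_intros)
      moreover have "indicator {0..<1} x * clip K (g x) = g x"
        using g clip_eq[OF K(2) K(1)] by (auto simp: l2_on_def indicator_def)
      ultimately show ?case by simp
    qed
  qed
qed

text \<open>Truncations at height \<open>n + 1\<close> are bounded, converge pointwise, and leave an
  error dominated by the function itself.\<close>

lemma l2_on_trig_closed:
  assumes g: "l2_on {0..<1} g"
  shows "trig_closed g"
proof (rule trig_closed_AE_limit[OF g, where h="\<lambda>n x. clip (real (Suc n)) (g x)" and w="\<lambda>x. (cmod (g x))\<^sup>2"])
  show "integrable lborel (\<lambda>x. (cmod (g x))\<^sup>2)" using g by (simp add: l2_on_def)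
  show "(cmod (g x - clip (real (Suc n)) (g x)))\<^sup>2 \<le> (cmod (g x))\<^sup>2" for n x
    by (intro power_mono cmod_diff_clip) auto
  show "AE x in lborel. (\<lambda>n. clip (real (Suc n)) (g x)) \<longlonglongrightarrow> g x"
  proof (rule AE_I2, rule tendsto_eventually)
    fix x
    have "eventually (\<lambda>n. cmod (g x) \<le> real (Suc n)) sequentially"
      by (rule eventually_sequentiallyI[of "nat \<lceil>cmod (g x)\<rceil>"]) linarith
    then show "eventually (\<lambda>n. clip (real (Suc n)) (g x) = g x) sequentially"
      by eventually_elim (simp add: clip_eq)
  qed
  fix n
  have clip_meas: "(\<lambda>x. complex_of_real (real (Suc n) / max (real (Suc n)) (cmod (g x)))) \<in> borel_measurable borel"
    using l2_on_measurable[OF g] by measurable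
  have "l2_on {0..<1} (\<lambda>x. clip (real (Suc n)) (g x))"
    unfolding clip_def by (rule l2_on_mult_bounded(1)[OF g clip_meas, where C=1]) (auto simp: max_def norm_divide divide_le_eq_1 simp del: of_nat_Suc)
  then show "trig_closed (\<lambda>x. clip (real (Suc n)) (g x))"
    by (rule l2_on_trig_closed_bounded[where K="real (Suc n)"]) (auto intro!: cmod_clip simp del: of_nat_Suc)
qed

text \<open>A form free of infinite sums; together with Bessel's inequality it amounts to Parseval's
  identity.\<close>

lemma parseval_approx:
  assumes g: "l2_on {0..<1} g" and "\<epsilon> > 0"
  obtains N where "finite N" "energy g \<le> (\<Sum>n\<in>N. (cmod (ft g (of_int n)))\<^sup>2) + \<epsilon>"
proof -
  obtain N c where N: "finite N" "energy (\<lambda>x. g x - trig_poly N c x) < \<epsilon>"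
    using trig_closedD[OF l2_on_trig_closed[OF g] assms(2)] .
  have "0 \<le> (\<Sum>n\<in>N. (cmod (c n - ft g (of_int n)))\<^sup>2)" by (intro sum_nonneg) auto
  with N that[of N] energy_diff_trig_poly[OF g N(1), of c] show ?thesis by simp
qed

section \<open>Folding\<close>

text \<open>Only the lower frame bound is recorded; the upper one is
  \<open>sample_energy_le\<close>, with constant 1.\<close>

definition sampling :: "real set \<Rightarrow> int set \<Rightarrow> bool" where
  "sampling A \<Lambda> \<longleftrightarrow> (\<exists>C\<ge>0. \<forall>g. l2_on A g \<longrightarrow> energy g \<le> C * sample_energy \<Lambda> g)"

lemma sample_energy_cmult:
  "sample_energy \<Lambda> (\<lambda>x. c * g x) = (cmod c)\<^sup>2 * sample_energy \<Lambda> g"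
  by (simp add: sample_energy_def ft_cmult norm_mult power_mult_distrib infsum_cmult_right')

lemma energy_le_sum:
  assumes "\<And>q. q \<in> Q \<Longrightarrow> l2_on B (h q)" "l2_on B f" "K \<ge> 0" "finite Q"
    and "\<And>x. cmod (f x) \<le> K * (\<Sum>q\<in>Q. cmod (h q x))"
  shows "energy f \<le> K\<^sup>2 * card Q * (\<Sum>q\<in>Q. energy (h q))"
proof -
  have le: "(cmod (f x))\<^sup>2 \<le> K\<^sup>2 * card Q * (\<Sum>q\<in>Q. (cmod (h q x))\<^sup>2)" for x
  proof -
    have "(cmod (f x))\<^sup>2 \<le> (K * (\<Sum>q\<in>Q. cmod (h q x)))\<^sup>2"
      by (intro power_mono assms) auto
    also have "\<dots> \<le> K\<^sup>2 * (card Q * (\<Sum>q\<in>Q. (cmod (h q x))\<^sup>2))"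
      using sum_squared_le_sum_of_squares[of "\<lambda>q. cmod (h q x)" Q]
      by (auto simp: power_mult_distrib mult.commute intro!: mult_left_mono)
    finally show ?thesis by (simp add: mult.assoc)
  qed
  have "energy f \<le> (\<integral>x. K\<^sup>2 * card Q * (\<Sum>q\<in>Q. (cmod (h q x))\<^sup>2) \<partial>lborel)"
    unfolding energy_def
    by (rule integral_mono[OF l2_on_integrable_square[OF assms(2)] _ le])
      (auto intro!: integrable_mult_right Bochner_Integration.integrable_sum l2_on_integrable_square[OF assms(1)])
  also have "\<dots> = K\<^sup>2 * card Q * (\<Sum>q\<in>Q. energy (h q))"
    unfolding energy_def using l2_on_integrable_square[OF assms(1)]
    by (subst integral_mult_right_zero) (auto simp: Bochner_Integration.integral_sum)
  finally show ?thesis .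
qed

text \<open>Row \<open>r\<close> is sampled along a set that only suffices for \<open>A r\<close>; off \<open>A r\<close> it is controlled by the
  earlier rows, whose contribution is subtracted before the sampling inequality is applied.\<close>

lemma triangular_sampling:
  fixes m :: nat
  assumes "\<And>r. r < m \<Longrightarrow> A r \<in> sets borel \<and> A r \<subseteq> {0..<1} \<and> sampling (A r) (\<Lambda> r)" "K \<ge> 0"
  shows "\<exists>C\<ge>0. \<forall>h. (\<forall>r<m. l2_on {0..<1} (h r) \<and> (\<forall>x\<in>{0..<1} - A r. cmod (h r x) \<le> K * (\<Sum>q<r. cmod (h q x)))) \<longrightarrow>
    (\<Sum>r<m. energy (h r)) \<le> C * (\<Sum>r<m. sample_energy (\<Lambda> r) (h r))"
  using assms(1)
proof (induction m)
  case 0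
  show ?case by (intro exI[of _ 0]) auto
next
  case (Suc m)
  have "A r \<in> sets borel \<and> A r \<subseteq> {0..<1} \<and> sampling (A r) (\<Lambda> r)" if "r < m" for r
    using Suc.prems that by simp
  from Suc.IH[OF this] obtain C where C: "C \<ge> 0" "\<forall>h. (\<forall>r<m. l2_on {0..<1} (h r) \<and> (\<forall>x\<in>{0..<1} - A r. cmod (h r x) \<le> K * (\<Sum>q<r. cmod (h q x)))) \<longrightarrow>
    (\<Sum>r<m. energy (h r)) \<le> C * (\<Sum>r<m. sample_energy (\<Lambda> r) (h r))"
    by blast
  have m: "A m \<in> sets borel" "A m \<subseteq> {0..<1}" "sampling (A m) (\<Lambda> m)" using Suc.prems by auto
  then obtain D where D: "D \<ge> 0" "\<And>g. l2_on (A m) g \<Longrightarrow> energy g \<le> D * sample_energy (\<Lambda> m) g"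
    unfolding sampling_def by auto
  \<comment> \<open>\<open>C\<close> bounds the earlier rows, \<open>2 * D\<close> weighs the
    samples of row \<open>m\<close>, and the last term pays for the part of row \<open>m\<close> off
    \<open>A m\<close>: once directly, and \<open>2 * D\<close> times through the samples from which
    that part is subtracted.\<close>
  let ?C = "C + (2 * D + (1 + 2 * D) * (K\<^sup>2 * m * C))"
  show ?case
  proof (intro exI[of _ ?C] conjI allI impI)
    show "?C \<ge> 0" using C(1) D(1) by simp
    fix h assume h: "\<forall>r<Suc m. l2_on {0..<1} (h r) \<and> (\<forall>x\<in>{0..<1} - A r. cmod (h r x) \<le> K * (\<Sum>q<r. cmod (h q x)))"
    let ?S = "\<Sum>r<m. sample_energy (\<Lambda> r) (h r)"
    have IH: "(\<Sum>r<m. energy (h r)) \<le> C * ?S" using h by (intro C(2)[rule_format]) auto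
    have l: "l2_on {0..<1} (h m)" using h by simp
    let ?in = "\<lambda>x. indicator (A m) x * h m x" and ?out = "\<lambda>x. indicator (- A m) x * h m x"
    have "- A m \<in> sets borel" using m(1) by auto
    then have lout: "l2_on {0..<1} ?out" using l2_on_restrict[OF l] l2_on_mono by blast
    have lin: "l2_on (A m) ?in" using l2_on_restrict[OF l m(1)] l2_on_mono by blast
    have "energy ?out \<le> K\<^sup>2 * card {..<m} * (\<Sum>q<m. energy (h q))"
    proof (rule energy_le_sum[OF _ lout assms(2)])
      show "cmod (?out x) \<le> K * (\<Sum>q<m. cmod (h q x))" for x
      proof (cases "x \<in> {0..<1} - A m")
        case False
        then have "?out x = 0" using l by (auto simp: l2_on_def indicator_def)
        moreover have "0 \<le> K * (\<Sum>q<m. cmod (h q x))" using assms(2) by (intro mult_nonneg_nonneg sum_nonneg) auto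
        ultimately show ?thesis by (metis norm_zero)
      qed (use h in auto)
    qed (use h in auto)
    also have "\<dots> \<le> K\<^sup>2 * m * (C * ?S)"
      using IH by (auto intro!: mult_left_mono)
    finally have out: "energy ?out \<le> K\<^sup>2 * m * C * ?S" by (simp add: mult.assoc)
    have in_eq: "?in = (\<lambda>x. h m x + (-1) * ?out x)" by (auto simp: indicator_def)
    have "sample_energy (\<Lambda> m) ?in \<le> 2 * sample_energy (\<Lambda> m) (h m) + 2 * sample_energy (\<Lambda> m) (\<lambda>x. (-1) * ?out x)"
      unfolding in_eq by (rule sample_energy_add[OF l l2_on_cmult[OF lout]])
    also have "sample_energy (\<Lambda> m) (\<lambda>x. (-1) * ?out x) = sample_energy (\<Lambda> m) ?out"
      by (subst sample_energy_cmult) simp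
    also have "\<dots> \<le> energy ?out" by (rule sample_energy_le[OF lout])
    finally have "energy ?in \<le> D * (2 * sample_energy (\<Lambda> m) (h m) + 2 * energy ?out)"
      using D(2)[OF lin] D(1) by (meson mult_left_mono order_trans add_left_mono zero_le_numeral)
    then have "energy (h m) \<le> 2 * D * sample_energy (\<Lambda> m) (h m) + (1 + 2 * D) * energy ?out"
      unfolding energy_split[OF l m(1)] by (simp add: algebra_simps)
    also have "\<dots> \<le> 2 * D * sample_energy (\<Lambda> m) (h m) + (1 + 2 * D) * (K\<^sup>2 * m * C * ?S)"
      using out D(1) by (intro add_left_mono mult_left_mono) auto
    finally have "(\<Sum>r<Suc m. energy (h r)) \<le> C * ?S + (2 * D * sample_energy (\<Lambda> m) (h m) + (1 + 2 * D) * (K\<^sup>2 * m * C * ?S))"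
      using IH by simp
    also have "\<dots> \<le> ?C * (?S + sample_energy (\<Lambda> m) (h m))"
    proof -
      have "0 \<le> (C + (1 + 2 * D) * (K\<^sup>2 * m * C)) * sample_energy (\<Lambda> m) (h m) + 2 * D * ?S"
        using C(1) D(1) by (intro add_nonneg_nonneg mult_nonneg_nonneg sum_nonneg) auto
      then show ?thesis by (simp add: algebra_simps)
    qed
    finally show "(\<Sum>r<Suc m. energy (h r)) \<le> ?C * (\<Sum>r<Suc m. sample_energy (\<Lambda> r) (h r))" by simp
  qed
qed

section \<open>Splitting a signal into its residue rows\<close>

lemma integral_fold:
  fixes F :: "real \<Rightarrow> 'a :: {banach, second_countable_topology}" and M :: nat
  assumes F: "integrable lborel F" and supp: "\<And>x. x \<notin> {0..<1} \<Longrightarrow> F x = 0" and M: "M > 0"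
  shows "integral\<^sup>L lborel F = (\<Sum>j<M. (1 / M) *\<^sub>R (\<integral>s. indicator {0..<1} s *\<^sub>R F ((s + real j) / M) \<partial>lborel))"
proof -
  let ?I = "\<lambda>j::nat. {j / M..<(j + 1) / M}"
  have eq: "F x = (\<Sum>j<M. indicator (?I j) x *\<^sub>R F x)" for x
  proof (cases "x \<in> {0..<1}")
    case True
    define k where "k = nat \<lfloor>M * x\<rfloor>"
    have k: "real k \<le> M * x" "M * x < real k + 1" using True by (simp_all add: k_def)
    have "real M * x < real M * 1" using True M by (intro mult_strict_left_mono) auto
    then have kM: "k < M" using k by linarith
    have "x \<in> ?I j \<longleftrightarrow> j = k" for j
    proof -
      have "x \<in> ?I j \<longleftrightarrow> real j \<le> M * x \<and> M * x < j + 1"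
        using M by (auto simp: field_simps)
      then show ?thesis using k by (auto simp: order.antisym)
    qed
    then have "(\<Sum>j<M. indicator (?I j) x *\<^sub>R F x) = (\<Sum>j<M. if j = k then F x else 0)"
      by (intro sum.cong) (auto simp: indicator_def)
    then show ?thesis using kM by simp
  qed (simp add: supp)
  have int: "integrable lborel (\<lambda>x. indicator (?I j) x *\<^sub>R F x)" for j :: nat
    by (rule integrable_mult_indicator[OF _ F]) simp
  have "integral\<^sup>L lborel F = (\<Sum>j<M. \<integral>x. indicator (?I j) x *\<^sub>R F x \<partial>lborel)"
    by (subst eq[abs_def], subst Bochner_Integration.integral_sum) (use int in auto)
  also have "\<dots> = (\<Sum>j<M. (1 / M) *\<^sub>R (\<integral>s. indicator {0..<1} s *\<^sub>R F ((s + real j) / M) \<partial>lborel))"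
  proof (intro sum.cong refl)
    fix j
    have ind: "indicator (?I j) (j / M + 1 / M * s) = (indicator {0..<1} s :: real)" for s
      using M by (auto simp: indicator_def field_simps)
    have arg: "j / M + 1 / M * s = (s + real j) / M" for s by (simp add: add_divide_distrib)
    have "(\<integral>x. indicator (?I j) x *\<^sub>R F x \<partial>lborel) = \<bar>1 / M\<bar> *\<^sub>R (\<integral>s. indicator (?I j) (j / M + 1 / M * s) *\<^sub>R F (j / M + 1 / M * s) \<partial>lborel)"
      using M by (intro lborel_integral_real_affine) auto
    then show "(\<integral>x. indicator (?I j) x *\<^sub>R F x \<partial>lborel) = (1 / M) *\<^sub>R (\<integral>s. indicator {0..<1} s *\<^sub>R F ((s + real j) / M) \<partial>lborel)"
      unfolding ind unfolding arg by simp
  qed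
  finally show ?thesis .
qed

text \<open>The row of Fourier coefficients with index congruent to \<open>r\<close> modulo
  \<open>M\<close>, see \<open>ft_fold_row\<close>; \<open>1 / M\<close> is the Jacobian of
  \<open>x = (s + j) / M\<close>.\<close>

definition fold_row :: "nat \<Rightarrow> (real \<Rightarrow> complex) \<Rightarrow> nat \<Rightarrow> real \<Rightarrow> complex" where
  "fold_row M g r s = (\<Sum>j<M. of_real (1 / real M) * (ee (r * ((s + real j) / M)) * (indicator {0..<1} s * g ((s + real j) / M))))"

lemma l2_on_fold_piece:
  assumes g: "l2_on {0..<1} g" and M: "M > 0"
  shows "l2_on {0..<1} (\<lambda>s. indicator {0..<1} s * g ((s + real j) / real M))"
proof -
  have "integrable lborel (\<lambda>s. (cmod (g (j / M + 1 / M * s)))\<^sup>2)"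
    using lborel_integrable_real_affine[OF l2_on_integrable_square[OF g], of "1 / M" "j / M"] M by simp
  then have i: "integrable lborel (\<lambda>s. (cmod (g ((s + real j) / M)))\<^sup>2)" by (simp add: add_divide_distrib add.commute)
  show ?thesis
    using l2_on_measurable[OF g] by (intro l2_onI_dominated[OF i]) (auto simp: indicator_def)
qed

lemma l2_on_fold_row:
  assumes "l2_on {0..<1} g" "M > 0"
  shows "l2_on {0..<1} (fold_row M g r)"
  unfolding fold_row_def[abs_def]
  by (intro l2_on_sum l2_on_cmult l2_on_mult_bounded(1)[where C=1] l2_on_fold_piece assms) auto

lemma ft_fold_row:
  assumes g: "l2_on {0..<1} g" and M: "M > 0"
  shows "ft (fold_row M g r) (of_int l) = ft g (of_int (int M * l + int r))"
proof -
  \<comment> \<open>The exponent equals \<open>r (s + j) / M + l s + l j\<close>, and the integer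
    \<open>l j\<close> has no effect.\<close>
  have e: "ee (of_int (int M * l + int r) * ((s + real j) / M)) = ee (r * ((s + real j) / M)) * ee (of_int l * s)" for s j
  proof -
    have "of_int (int M * l + int r) * ((s + real j) / M) = r * ((s + real j) / M) + of_int l * s + of_int (l * int j)"
      using M by (simp add: field_simps)
    then show ?thesis by (simp only: ee_add ee_of_int mult_1_right)
  qed
  have l: "l2_on {0..<1} (\<lambda>s. of_real (1 / real M) * (ee (r * ((s + real j) / M)) * (indicator {0..<1} s * g ((s + real j) / M))))" for j
    by (intro l2_on_cmult l2_on_mult_bounded(1)[where C=1] l2_on_fold_piece g M) auto
  have "ft g (of_int (int M * l + int r)) = (\<Sum>j<M. (1 / M) *\<^sub>R (\<integral>s. indicator {0..<1} s *\<^sub>R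
      (g ((s + real j) / M) * ee (of_int (int M * l + int r) * ((s + real j) / M))) \<partial>lborel))"
    unfolding ft_def
    by (rule integral_fold[OF l2_on_ft_integrable[OF g] _ M]) (use g in \<open>auto simp: l2_on_def\<close>)
  also have "\<dots> = (\<Sum>j<M. ft (\<lambda>s. of_real (1 / real M) * (ee (r * ((s + real j) / M)) * (indicator {0..<1} s * g ((s + real j) / M)))) (of_int l))"
    unfolding e ft_cmult
    by (simp add: ft_def scaleR_conv_of_real of_real_indicator mult_ac)
  also have "\<dots> = ft (fold_row M g r) (of_int l)"
    unfolding fold_row_def[abs_def] by (rule ft_sum[symmetric, OF l])
  finally show ?thesis ..
qed

lemma ee_of_nat_mult: "ee (of_nat n * x) = ee x ^ n"
  by (induction n) (simp_all add: distrib_right ee_add)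

lemma sum_roots_of_unity:
  fixes M j k :: nat
  assumes "j < M" "k < M"
  shows "(\<Sum>r<M. ee (real r * ((real j - real k) / M))) = (if j = k then of_nat M else 0)"
proof (cases "j = k")
  case False
  let ?z = "ee ((real j - real k) / M)"
  have pow: "ee (r * ((real j - real k) / M)) = ?z ^ r" for r :: nat
    by (rule ee_of_nat_mult)
  have "(real j - real k) / M \<notin> \<int>"
  proof
    assume "(real j - real k) / M \<in> \<int>"
    then obtain i where "(real j - real k) / M = of_int i" by (auto elim: Ints_cases)
    then have "real j - real k = of_int i * M" using assms by (simp add: field_simps)
    then have "real_of_int (int j - int k) = real_of_int (i * int M)" by simp
    then have "int j - int k = i * int M" by (simp only: of_int_eq_iff)
    then have "int j mod int M = int k mod int M" by (simp add: mod_eq_dvd_iff)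
    then show False using assms False by simp
  qed
  then have "?z \<noteq> 1" by (simp add: ee_eq_1_iff)
  moreover have "?z ^ M = 1"
    unfolding pow[symmetric] ee_eq_1_iff using assms by simp
  ultimately have "(\<Sum>r<M. ?z ^ r) = 0" by (simp add: sum_gp_strict)
  then show ?thesis unfolding pow using False by simp
qed simp

text \<open>In each product of a term with a conjugate term the shift \<open>s\<close> cancels, and
  summing over \<open>r\<close> leaves only the diagonal, by orthogonality of the roots of
  unity.\<close>

lemma dft_parseval:
  fixes a :: "nat \<Rightarrow> complex" and s :: real
  assumes "M > 0"
  shows "(\<Sum>r<M. (cmod (\<Sum>j<M. ee (real r * ((s + real j) / M)) * a j))\<^sup>2) = M * (\<Sum>j<M. (cmod (a j))\<^sup>2)"
proof -
  have "complex_of_real (\<Sum>r<M. (cmod (\<Sum>j<M. ee (real r * ((s + real j) / M)) * a j))\<^sup>2) =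
      (\<Sum>r<M. \<Sum>j<M. \<Sum>k<M. ee (real r * ((real j - real k) / M)) * (a j * cnj (a k)))"
  proof -
    have "ee (r * ((s + real j) / M)) * a j * cnj (ee (r * ((s + real k) / M)) * a k) =
        ee (r * ((real j - real k) / M)) * (a j * cnj (a k))" for r j k :: nat
    proof -
      have "ee (r * ((s + real j) / M)) * cnj (ee (r * ((s + real k) / M))) = ee (r * ((real j - real k) / M))"
        unfolding cnj_ee ee_add[symmetric] by (rule arg_cong[of _ _ ee]) (simp add: add_divide_distrib diff_divide_distrib algebra_simps)
      moreover have "x * a j * cnj (y * a k) = (x * cnj y) * (a j * cnj (a k))" for x y
        by simp
      ultimately show ?thesis by simp
    qed
    then show ?thesis
      by (simp only: of_real_sum complex_norm_square cnj_sum sum_product)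
  qed
  also have "\<dots> = (\<Sum>j<M. \<Sum>k<M. \<Sum>r<M. ee (real r * ((real j - real k) / M)) * (a j * cnj (a k)))"
    by (subst sum.swap, rule sum.cong[OF refl], rule sum.swap)
  also have "\<dots> = (\<Sum>j<M. \<Sum>k<M. (if j = k then of_nat M else 0) * (a j * cnj (a k)))"
    by (intro sum.cong refl) (simp only: sum_distrib_right[symmetric] sum_roots_of_unity lessThan_iff)
  also have "\<dots> = (\<Sum>j<M. \<Sum>k<M. if k = j then of_nat M * (a j * cnj (a j)) else 0)"
    by (intro sum.cong refl) auto
  also have "\<dots> = complex_of_real (M * (\<Sum>j<M. (cmod (a j))\<^sup>2))"
    by (simp add: sum_distrib_left complex_norm_square[symmetric])
  finally show ?thesis using of_real_eq_iff by blast
qed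

text \<open>The factor \<open>(1 / M)^2\<close> of the squared rows times the \<open>M\<close> of
  \<open>dft_parseval\<close> leaves \<open>1 / M\<close>, the Jacobian of the folding, so no energy
  is lost.\<close>

lemma energy_fold_row:
  assumes g: "l2_on {0..<1} g" and M: "M > 0"
  shows "(\<Sum>r<M. energy (fold_row M g r)) = energy g"
proof -
  have row: "(cmod (fold_row M g r s))\<^sup>2 = (1 / M)\<^sup>2 * (cmod (\<Sum>j<M. ee (real r * ((s + real j) / M)) * (indicator {0..<1} s * g ((s + real j) / M))))\<^sup>2" for r s
    unfolding fold_row_def sum_distrib_left[symmetric]
    by (simp add: norm_mult power_mult_distrib norm_divide power_divide)
  have p: "(\<Sum>r<M. (cmod (fold_row M g r s))\<^sup>2) = (\<Sum>j<M. (1 / M) * (indicator {0..<1} s *\<^sub>R (cmod (g ((s + real j) / M)))\<^sup>2))" for s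
  proof -
    have "(\<Sum>r<M. (cmod (fold_row M g r s))\<^sup>2) = (1 / M)\<^sup>2 * (M * (\<Sum>j<M. (cmod (indicator {0..<1} s * g ((s + real j) / M)))\<^sup>2))"
      unfolding row by (subst dft_parseval[OF M, of s, symmetric]) (rule sum_distrib_left[symmetric])
    also have "\<dots> = (\<Sum>j<M. (1 / M) * (indicator {0..<1} s *\<^sub>R (cmod (g ((s + real j) / M)))\<^sup>2))"
      using M by (cases "s \<in> {0..<1}") (simp_all add: power2_eq_square[of "1 / real M"] sum_distrib_left)
    finally show ?thesis .
  qed
  have i: "integrable lborel (\<lambda>s. indicator {0..<1} s *\<^sub>R (cmod (g ((s + real j) / M)))\<^sup>2)" for j
    using l2_on_integrable_square[OF l2_on_fold_piece[OF g M, of j]] by (simp add: norm_mult power_mult_distrib)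
  have "(\<Sum>r<M. energy (fold_row M g r)) = (\<integral>s. (\<Sum>r<M. (cmod (fold_row M g r s))\<^sup>2) \<partial>lborel)"
    unfolding energy_def
    by (subst Bochner_Integration.integral_sum) (auto intro!: l2_on_integrable_square[OF l2_on_fold_row[OF g M]])
  also have "\<dots> = (\<Sum>j<M. (1 / M) *\<^sub>R (\<integral>s. indicator {0..<1} s *\<^sub>R (cmod (g ((s + real j) / M)))\<^sup>2 \<partial>lborel))"
    unfolding p by (subst Bochner_Integration.integral_sum) (use i in auto)
  also have "\<dots> = energy g"
    unfolding energy_def
    by (rule integral_fold[symmetric, OF l2_on_integrable_square[OF g] _ M]) (use g in \<open>auto simp: l2_on_def\<close>)
  finally show ?thesis .
qed

text \<open>The remainder of \<open>X^r\<close> modulo the polynomial with roots \<open>w j\<close>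
  has degree below \<open>card J\<close> and agrees with \<open>X^r\<close> at every root; its
  coefficients are the witness. This yields the dependence of Vandermonde rows without inverting a
  matrix.\<close>

lemma power_reduction:
  fixes w :: "nat \<Rightarrow> complex"
  assumes "finite J"
  shows "\<exists>c. \<forall>j\<in>J. w j ^ r = (\<Sum>q<card J. c q * w j ^ q)"
proof -
  define P where "P = (\<Prod>j\<in>J. [:- w j, 1:])"
  define R where "R = monom 1 r mod P"
  have P0: "P \<noteq> 0" unfolding P_def using assms by (simp add: prod_zero_iff)
  have deg: "degree P = card J"
    unfolding P_def by (subst degree_prod_eq_sum_degree) auto
  have "poly R (w j) = (\<Sum>q<card J. coeff R q * w j ^ q)" if "j \<in> J" for j
  proof -
    have "coeff R q = 0" if "q \<ge> card J" for q
    proof (cases "R = 0")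
      case False
      then have "degree R < card J"
        unfolding R_def using degree_mod_less[of P "monom 1 r"] P0 deg by auto
      then show ?thesis using that by (simp add: coeff_eq_0)
    qed simp
    moreover have "poly R (w j) = (\<Sum>q<Suc (max (degree R) (card J)). coeff R q * w j ^ q)"
      unfolding poly_altdef by (rule sum.mono_neutral_left) (auto simp: coeff_eq_0)
    moreover have "\<dots> = (\<Sum>q<card J. coeff R q * w j ^ q)"
      by (rule sum.mono_neutral_right) (auto simp: calculation(1))
    ultimately show ?thesis by simp
  qed
  moreover have "poly R (w j) = w j ^ r" if "j \<in> J" for j
  proof -
    have "poly P (w j) = 0" unfolding P_def poly_prod using assms that by (auto simp: prod_zero_iff)
    moreover have "monom 1 r = monom 1 r div P * P + R" unfolding R_def by simp
    then have "poly (monom 1 r) (w j) = poly (monom 1 r div P) (w j) * poly P (w j) + poly R (w j)"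
      by (metis poly_add poly_mult)
    ultimately show ?thesis by (simp add: poly_monom)
  qed
  ultimately show ?thesis by (intro exI[of _ "coeff R"]) auto
qed

text \<open>A bounded error at every window size is stronger than a density: it is additive over
  disjoint sets and passes to progressions, whereas lower densities are merely superadditive. The
  factor 2 stems from the length \<open>2 * n\<close> of the window.\<close>

definition bounded_discrepancy :: "int set \<Rightarrow> real \<Rightarrow> bool" where
  "bounded_discrepancy \<Lambda> d \<longleftrightarrow> (\<exists>C. \<forall>n::nat. \<bar>real (card (\<Lambda> \<inter> {- int n..int n})) - 2 * d * real n\<bar> \<le> C)"

definition critical :: "real set \<Rightarrow> int set \<Rightarrow> bool" where
  "critical A \<Lambda> \<longleftrightarrow> sampling A \<Lambda> \<and> bounded_discrepancy \<Lambda> (measure lborel A)"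

lemma bounded_discrepancy_empty: "bounded_discrepancy {} 0"
  by (auto simp: bounded_discrepancy_def)

lemma bounded_discrepancy_Un:
  assumes "bounded_discrepancy \<Lambda> d" "bounded_discrepancy \<Lambda>' d'" "\<Lambda> \<inter> \<Lambda>' = {}"
  shows "bounded_discrepancy (\<Lambda> \<union> \<Lambda>') (d + d')"
proof -
  obtain C C' where C: "\<And>n::nat. \<bar>real (card (\<Lambda> \<inter> {- int n..int n})) - 2 * d * real n\<bar> \<le> C"
    and C': "\<And>n::nat. \<bar>real (card (\<Lambda>' \<inter> {- int n..int n})) - 2 * d' * real n\<bar> \<le> C'"
    using assms unfolding bounded_discrepancy_def by auto
  have "\<bar>real (card ((\<Lambda> \<union> \<Lambda>') \<inter> {- int n..int n})) - 2 * (d + d') * real n\<bar> \<le> C + C'" for n :: nat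
  proof -
    have "card ((\<Lambda> \<union> \<Lambda>') \<inter> {- int n..int n}) = card (\<Lambda> \<inter> {- int n..int n}) + card (\<Lambda>' \<inter> {- int n..int n})"
      unfolding Int_Un_distrib2 using assms(3) by (intro card_Un_disjoint) auto
    then show ?thesis using C[of n] C'[of n] by (simp add: algebra_simps)
  qed
  then show ?thesis unfolding bounded_discrepancy_def by blast
qed

lemma bounded_discrepancy_UN:
  assumes "finite R" "\<And>r. r \<in> R \<Longrightarrow> bounded_discrepancy (\<Lambda> r) (d r)" "disjoint_family_on \<Lambda> R"
  shows "bounded_discrepancy (\<Union>r\<in>R. \<Lambda> r) (\<Sum>r\<in>R. d r)"
  using assms
proof (induction R rule: finite_induct)
  case empty
  show ?case by (simp add: bounded_discrepancy_empty)
next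
  case (insert x R)
  have "bounded_discrepancy (\<Lambda> x \<union> (\<Union>r\<in>R. \<Lambda> r)) (d x + (\<Sum>r\<in>R. d r))"
  proof (rule bounded_discrepancy_Un)
    show "bounded_discrepancy (\<Union>r\<in>R. \<Lambda> r) (\<Sum>r\<in>R. d r)"
      using insert by (auto simp: disjoint_family_on_def)
    show "\<Lambda> x \<inter> (\<Union>r\<in>R. \<Lambda> r) = {}"
      using insert by (fastforce simp: disjoint_family_on_def)
  qed (use insert in auto)
  then show ?case using insert by simp
qed

lemma bounded_discrepancy_affine:
  fixes M r :: nat
  assumes "bounded_discrepancy \<Lambda> d" "r < M" "d \<ge> 0"
  shows "bounded_discrepancy ((\<lambda>l. int M * l + int r) ` \<Lambda>) (d / M)"
proof -
  obtain C where C: "\<And>n::nat. \<bar>real (card (\<Lambda> \<inter> {- int n..int n})) - 2 * d * real n\<bar> \<le> C"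
    using assms unfolding bounded_discrepancy_def by auto
  have "\<bar>real (card ((\<lambda>l. int M * l + int r) ` \<Lambda> \<inter> {- int n..int n})) - 2 * (d / M) * real n\<bar> \<le> C + 1 + 2 * d" for n :: nat
  proof -
    define k where "k = n div M"
    have k: "M * k \<le> n" "n < M * k + M"
      using mult_div_mod_eq[of M n] mod_less_divisor[of M n] assms(2) unfolding k_def by linarith+
    let ?T = "{l \<in> \<Lambda>. - int n \<le> int M * l + int r \<and> int M * l + int r \<le> int n}" and ?K = "\<Lambda> \<inter> {- int k..int k}"
    have "(\<lambda>l. int M * l + int r) ` \<Lambda> \<inter> {- int n..int n} = (\<lambda>l. int M * l + int r) ` ?T" by auto
    moreover have "inj_on (\<lambda>l. int M * l + int r) ?T" using assms(2) by (auto simp: inj_on_def)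
    ultimately have card: "card ((\<lambda>l. int M * l + int r) ` \<Lambda> \<inter> {- int n..int n}) = card ?T"
      by (simp add: card_image)
    have kz: "int M * int k \<le> int n" "int n < int M * int k + int M"
      using k by (metis of_nat_mult of_nat_le_iff, metis of_nat_add of_nat_less_iff of_nat_mult)
    \<comment> \<open>The offset \<open>r < M\<close> shifts the window by less than one step: only
      \<open>l = -k - 1\<close> can enter and only \<open>l = k\<close> can drop out.\<close>
    have sub1: "?T \<subseteq> ?K \<union> {- int k - 1}"
    proof
      fix l assume l: "l \<in> ?T"
      have "l \<le> int k"
      proof (rule ccontr)
        assume "\<not> l \<le> int k"
        then have "int M * (int k + 1) \<le> int M * l" by (intro mult_left_mono) auto
        with l kz show False by (auto simp: algebra_simps)
      qed
      moreover have "- int k - 1 \<le> l"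
      proof (rule ccontr)
        assume "\<not> - int k - 1 \<le> l"
        then have "int M * l \<le> int M * (- int k - 2)" by (intro mult_left_mono) auto
        with l kz assms(2) show False by (auto simp: algebra_simps)
      qed
      ultimately show "l \<in> ?K \<union> {- int k - 1}" using l by auto
    qed
    have sub2: "?K \<subseteq> ?T \<union> {int k}"
    proof
      fix l assume l: "l \<in> ?K"
      show "l \<in> ?T \<union> {int k}"
      proof (cases "l = int k")
        case False
        then have "int M * l \<le> int M * (int k - 1)" "int M * (- int k) \<le> int M * l"
          using l mult_left_mono[of "- int k" l "int M"] by (auto intro!: mult_left_mono)
        with l kz assms(2) show ?thesis by (auto simp: algebra_simps)
      qed auto
    qed
    have finK: "finite ?K" by simp
    have finT: "finite ?T" using sub1 finK by (meson finite.emptyI finite_UnI finite_insert finite_subset)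
    have "card ?T \<le> card ?K + 1"
      using card_mono[OF _ sub1] card_Un_le[of ?K "{- int k - 1}"] finK by simp
    moreover have "card ?K \<le> card ?T + 1"
      using card_mono[OF _ sub2] card_Un_le[of ?T "{int k}"] finT by simp
    ultimately have "\<bar>real (card ?T) - real (card ?K)\<bar> \<le> 1" by linarith
    moreover have "\<bar>2 * d * real k - 2 * (d / M) * real n\<bar> \<le> 2 * d"
    proof -
      have M: "real M > 0" using assms(2) by simp
      have "real M * real k \<le> real n" "real n \<le> real M * real k + real M"
        using k by (metis of_nat_mult of_nat_le_iff, metis of_nat_add less_imp_le of_nat_less_iff of_nat_mult)
      then have "real k \<le> real n / M" "real n / M \<le> real k + 1"
        using M by (auto simp: field_simps)
      then have "\<bar>real k - real n / M\<bar> \<le> 1" by linarith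
      then have "2 * d * \<bar>real k - real n / M\<bar> \<le> 2 * d * 1"
        using assms(3) by (intro mult_left_mono) auto
      moreover have "2 * d * real k - 2 * (d / M) * real n = 2 * d * (real k - real n / M)" by (simp add: algebra_simps)
      ultimately show ?thesis using assms(3) by (simp add: abs_mult)
    qed
    ultimately show ?thesis unfolding card using C[of k] by linarith
  qed
  then show ?thesis unfolding bounded_discrepancy_def by blast
qed

lemma sample_energy_UN:
  assumes "l2_on {0..<1} g" "finite R" "disjoint_family_on \<Lambda> R"
  shows "sample_energy (\<Union>r\<in>R. \<Lambda> r) g = (\<Sum>r\<in>R. sample_energy (\<Lambda> r) g)"
  using assms(2,3)
proof (induction R rule: finite_induct)
  case (insert x R)
  have "\<Lambda> x \<inter> (\<Union>r\<in>R. \<Lambda> r) = {}"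
    using insert by (fastforce simp: disjoint_family_on_def)
  then have "sample_energy (\<Lambda> x \<union> (\<Union>r\<in>R. \<Lambda> r)) g = sample_energy (\<Lambda> x) g + sample_energy (\<Union>r\<in>R. \<Lambda> r) g"
    unfolding sample_energy_def by (intro infsum_Un_disjoint sample_energy_summable assms)
  moreover have "disjoint_family_on \<Lambda> R" using insert by (auto simp: disjoint_family_on_def)
  ultimately show ?case using insert by simp
qed (simp add: sample_energy_def)

section \<open>Superlevel sets of the counting function\<close>

definition fold_level :: "nat \<Rightarrow> real set \<Rightarrow> nat \<Rightarrow> real set" where
  "fold_level M A r = {s \<in> {0..<1}. r < card {j. j < M \<and> (s + real j) / real M \<in> A}}"

lemma fold_level_borel:
  assumes [measurable]: "A \<in> sets borel"
  shows "fold_level M A r \<in> sets borel"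
proof -
  have "card {j. j < M \<and> (s + real j) / real M \<in> A} = (\<Sum>j<M. if (s + real j) / real M \<in> A then 1 else 0)" for s
    by (subst sum.If_cases) (auto intro!: arg_cong[of _ _ card])
  then have "fold_level M A r = {s \<in> space borel. 0 \<le> s \<and> s < 1 \<and> r < (\<Sum>j<M. if (s + real j) / real M \<in> A then 1 else 0)}"
    by (auto simp: fold_level_def)
  also have "\<dots> \<in> sets borel" by measurable
  finally show ?thesis .
qed

text \<open>Up to a unimodular factor the rows at \<open>s\<close> are Vandermonde rows in the nodes
  \<open>ee (j / M)\<close> of the preimages inside \<open>A\<close>; with at most \<open>r\<close>
  of them, \<open>power_reduction\<close> expresses row \<open>r\<close> through earlier ones.
  \<open>K\<close> sums over all node sets and exponents, finitely many, so it depends on neither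
  \<open>g\<close> nor \<open>s\<close>.\<close>

lemma fold_row_dependent:
  assumes M: "M > 0"
  shows "\<exists>K\<ge>0. \<forall>g r s. (\<forall>x. x \<notin> A \<longrightarrow> g x = 0) \<and> r < M \<and> card {j. j < M \<and> (s + real j) / real M \<in> A} \<le> r \<longrightarrow>
    cmod (fold_row M g r s) \<le> K * (\<Sum>q<r. cmod (fold_row M g q s))"
proof -
  let ?w = "\<lambda>j::nat. ee (j / M)"
  have "\<forall>J r. \<exists>c. finite J \<longrightarrow> (\<forall>j\<in>J. ?w j ^ r = (\<Sum>q<card J. c q * ?w j ^ q))"
    using power_reduction[of _ ?w] by blast
  then obtain c where c: "\<And>J r j. finite J \<Longrightarrow> j \<in> J \<Longrightarrow> ?w j ^ r = (\<Sum>q<card J. c J r q * ?w j ^ q)"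
    by metis
  define K where "K = (\<Sum>J\<in>Pow {..<M}. \<Sum>r<M. \<Sum>q<M. cmod (c J r q))"
  show ?thesis
  proof (intro exI[of _ K] conjI allI impI; (elim conjE)?)
    show "K \<ge> 0" unfolding K_def by (intro sum_nonneg) auto
    fix g :: "real \<Rightarrow> complex" and r :: nat and s :: real
    assume g: "\<forall>x. x \<notin> A \<longrightarrow> g x = 0" and r: "r < M" and card: "card {j. j < M \<and> (s + real j) / real M \<in> A} \<le> r"
    define J where "J = {j. j < M \<and> (s + real j) / real M \<in> A}"
    have J: "J \<subseteq> {..<M}" "finite J" "card J \<le> r" using card by (auto simp: J_def)
    let ?a = "\<lambda>j. of_real (1 / real M) * (indicator {0..<1} s * g ((s + real j) / M))"
    have row: "fold_row M g q s = ee (q * (s / M)) * (\<Sum>j\<in>J. ?w j ^ q * ?a j)" for q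
    proof -
      have "fold_row M g q s = (\<Sum>j\<in>J. of_real (1 / real M) * (ee (q * ((s + real j) / M)) * (indicator {0..<1} s * g ((s + real j) / M))))"
        unfolding fold_row_def using J(1) g by (intro sum.mono_neutral_right) (auto simp: J_def)
      also have "\<dots> = (\<Sum>j\<in>J. ee (q * (s / M)) * (?w j ^ q * ?a j))"
        by (intro sum.cong refl) (simp add: add_divide_distrib distrib_left ee_add ee_of_nat_mult[symmetric])
      finally show ?thesis by (simp add: sum_distrib_left)
    qed
    have "(\<Sum>j\<in>J. ?w j ^ r * ?a j) = (\<Sum>j\<in>J. \<Sum>q<card J. c J r q * (?w j ^ q * ?a j))"
      by (intro sum.cong refl) (subst c[OF J(2)], auto simp: sum_distrib_right sum_divide_distrib mult.assoc)
    also have "\<dots> = (\<Sum>q<card J. c J r q * (\<Sum>j\<in>J. ?w j ^ q * ?a j))"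
      by (subst sum.swap) (simp add: sum_distrib_left)
    finally have "cmod (fold_row M g r s) = cmod (\<Sum>q<card J. c J r q * (\<Sum>j\<in>J. ?w j ^ q * ?a j))"
      unfolding row[of r] by (simp add: norm_mult)
    also have "\<dots> \<le> (\<Sum>q<card J. cmod (c J r q) * cmod (\<Sum>j\<in>J. ?w j ^ q * ?a j))"
      by (intro sum_norm_le) (simp add: norm_mult)
    also have "\<dots> = (\<Sum>q<card J. cmod (c J r q) * cmod (fold_row M g q s))"
      unfolding row by (simp add: norm_mult)
    also have "\<dots> \<le> (\<Sum>q<card J. K * cmod (fold_row M g q s))"
    proof (intro sum_mono mult_right_mono norm_ge_zero)
      fix q assume "q \<in> {..<card J}"
      then have "q < M" using J(3) r by simp
      then have "cmod (c J r q) \<le> (\<Sum>q<M. cmod (c J r q))" by (intro member_le_sum) auto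
      also have "\<dots> \<le> (\<Sum>r<M. \<Sum>q<M. cmod (c J r q))"
        using r by (intro member_le_sum[where f="\<lambda>r. \<Sum>q<M. cmod (c J r q)"]) (auto intro: sum_nonneg)
      also have "\<dots> \<le> K"
        unfolding K_def using J by (intro member_le_sum[where f="\<lambda>J. \<Sum>r<M. \<Sum>q<M. cmod (c J r q)"]) (auto intro!: sum_nonneg)
      finally show "cmod (c J r q) \<le> K" .
    qed
    also have "\<dots> \<le> (\<Sum>q<r. K * cmod (fold_row M g q s))"
      using J(3) \<open>K \<ge> 0\<close> by (intro sum_mono2) auto
    finally show "cmod (fold_row M g r s) \<le> K * (\<Sum>q<r. cmod (fold_row M g q s))"
      by (simp add: sum_distrib_left)
  qed
qed

text \<open>A point with \<open>c\<close> preimages in \<open>A\<close> lies in exactly the levels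
  \<open>r < c\<close>; this count is integrated and divided by \<open>M\<close>, the factor by
  which folding stretches.\<close>

lemma measure_fold_level:
  assumes A: "A \<in> sets borel" "A \<subseteq> {0..<1}" and M: "M > 0"
  shows "(\<Sum>r<M. measure lborel (fold_level M A r) / M) = measure lborel A"
proof -
  have finA: "emeasure lborel A < \<infinity>"
    using emeasure_mono[of A "{0..<1}" lborel] A by (auto simp: less_top[symmetric] top_unique)
  have fin: "emeasure lborel (fold_level M A r) < \<infinity>" for r
  proof -
    have "emeasure lborel (fold_level M A r) \<le> emeasure lborel {0..<1::real}"
      by (intro emeasure_mono) (auto simp: fold_level_def)
    then show ?thesis by (auto simp: less_top[symmetric] top_unique)
  qed
  have iA: "integrable lborel (indicator A :: real \<Rightarrow> real)"
    using A finA by simp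
  have p: "(\<Sum>j<M. indicator {0..<1} s * indicator A ((s + real j) / M)) = (\<Sum>r<M. indicator (fold_level M A r) s :: real)" for s
  proof (cases "s \<in> {0..<1}")
    case True
    define J where "J = {j. j < M \<and> (s + real j) / real M \<in> A}"
    have "card J \<le> card {..<M}" by (intro card_mono) (auto simp: J_def)
    then have J: "card J \<le> M" by simp
    have "(\<Sum>j<M. indicator {0..<1} s * indicator A ((s + real j) / M)) = (\<Sum>j<M. if j \<in> J then 1 else 0 :: real)"
      using True by (intro sum.cong refl) (auto simp: J_def indicator_def)
    also have "\<dots> = card J"
      by (subst sum.If_cases) (auto simp: J_def intro!: arg_cong[of _ _ card])
    also have "real (card J) = (\<Sum>r<M. if r < card J then 1 else 0)"
    proof -
      have "{..<M} \<inter> {r. r < card J} = {..<card J}" using J by auto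
      then show ?thesis by (simp add: sum.If_cases)
    qed
    also have "\<dots> = (\<Sum>r<M. indicator (fold_level M A r) s)"
      using True by (intro sum.cong refl) (auto simp: fold_level_def J_def indicator_def)
    finally show ?thesis .
  qed (auto simp: fold_level_def indicator_def)
  have int: "integrable lborel (\<lambda>s. indicator {0..<1} s * indicator A ((s + real j) / M) :: real)" for j
  proof -
    have "integrable lborel (\<lambda>s. indicator A (real j / M + 1 / M * s) :: real)"
      using lborel_integrable_real_affine[OF iA, of "1 / M" "j / M"] M by simp
    then have "integrable lborel (\<lambda>s. indicator {0..<1} s *\<^sub>R (indicator A ((s + real j) / M) :: real))"
      by (intro integrable_mult_indicator) (auto simp: add_divide_distrib add.commute)
    then show ?thesis by simp
  qed
  have "measure lborel A = (\<integral>x. indicator A x \<partial>lborel)" by simp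
  also have "\<dots> = (\<Sum>j<M. (1 / M) *\<^sub>R (\<integral>s. indicator {0..<1} s *\<^sub>R indicator A ((s + real j) / M) \<partial>lborel))"
    by (rule integral_fold[OF iA _ M]) (use A in \<open>auto simp: indicator_def\<close>)
  also have "\<dots> = (1 / M) * (\<integral>s. (\<Sum>j<M. indicator {0..<1} s * indicator A ((s + real j) / M)) \<partial>lborel)"
    by (subst Bochner_Integration.integral_sum) (use int in \<open>auto simp: sum_distrib_left\<close>)
  also have "\<dots> = (1 / M) * (\<Sum>r<M. measure lborel (fold_level M A r))"
    unfolding p using fold_level_borel[OF A(1)] fin
    by (subst Bochner_Integration.integral_sum) auto
  finally show ?thesis by (simp add: sum_divide_distrib)
qed

text \<open>The samples of the signal at \<open>M * l + r\<close> are the samples of row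
  \<open>r\<close> at \<open>l\<close>, so the rows are recovered in turn by
  \<open>triangular_sampling\<close>. Distinct rows use distinct residues, so their densities add
  up, by \<open>measure_fold_level\<close>, to the measure of \<open>A\<close>.\<close>

lemma critical_fold:
  assumes A: "A \<in> sets borel" "A \<subseteq> {0..<1}" and M: "M > 0"
    and \<Lambda>: "\<And>r. r < M \<Longrightarrow> critical (fold_level M A r) (\<Lambda> r)"
  shows "critical A (\<Union>r<M. (\<lambda>l. int M * l + int r) ` \<Lambda> r)"
  unfolding critical_def
proof
  let ?L = "\<lambda>r. (\<lambda>l. int M * l + int r) ` \<Lambda> r"
  have disj: "disjoint_family_on ?L {..<M}"
  proof -
    have "r = r'" if "int M * l + int r = int M * l' + int r'" "r < M" "r' < M" for l l' r r'
    proof -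
      have "(int M * l + int r) mod int M = int r" "(int M * l' + int r') mod int M = int r'" using that(2,3) by simp_all
      then have "int r = int r'" using that(1) by metis
      then show ?thesis by simp
    qed
    then show ?thesis by (auto simp: disjoint_family_on_def)
  qed
  have "bounded_discrepancy (\<Union>r<M. ?L r) (\<Sum>r<M. measure lborel (fold_level M A r) / M)"
    using \<Lambda> by (intro bounded_discrepancy_UN disj bounded_discrepancy_affine) (auto simp: critical_def)
  then show "bounded_discrepancy (\<Union>r<M. ?L r) (measure lborel A)"
    unfolding measure_fold_level[OF A M] .
  let ?P = "\<lambda>K. K \<ge> 0 \<and> (\<forall>g r s. (\<forall>x. x \<notin> A \<longrightarrow> g x = 0) \<and> r < M \<and> card {j. j < M \<and> (s + real j) / real M \<in> A} \<le> r \<longrightarrow>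
    cmod (fold_row M g r s) \<le> K * (\<Sum>q<r. cmod (fold_row M g q s)))"
  obtain K where K: "?P K"
    by (rule exE[where P="?P"], rule fold_row_dependent[OF M], rule that, assumption)
  have level: "fold_level M A r \<in> sets borel \<and> fold_level M A r \<subseteq> {0..<1} \<and> sampling (fold_level M A r) (\<Lambda> r)" if "r < M" for r
  proof (intro conjI fold_level_borel A(1))
    show "fold_level M A r \<subseteq> {0..<1}" by (auto simp: fold_level_def)
    show "sampling (fold_level M A r) (\<Lambda> r)" using \<Lambda>[OF that] by (simp add: critical_def)
  qed
  let ?Q = "\<lambda>C. C \<ge> 0 \<and> (\<forall>h. (\<forall>r<M. l2_on {0..<1} (h r) \<and> (\<forall>x\<in>{0..<1} - fold_level M A r. cmod (h r x) \<le> K * (\<Sum>q<r. cmod (h q x)))) \<longrightarrow>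
    (\<Sum>r<M. energy (h r)) \<le> C * (\<Sum>r<M. sample_energy (\<Lambda> r) (h r)))"
  obtain C where C: "?Q C"
    by (rule exE[where P="?Q"], rule triangular_sampling, rule level, assumption, rule conjunct1[OF K], rule that, assumption)
  have "energy g \<le> C * sample_energy (\<Union>r<M. ?L r) g" if g: "l2_on A g" for g
  proof -
    have gU: "l2_on {0..<1} g" using g A(2) by (rule l2_on_mono)
    have "energy g = (\<Sum>r<M. energy (fold_row M g r))" using energy_fold_row[OF gU M] by simp
    also have "\<dots> \<le> C * (\<Sum>r<M. sample_energy (\<Lambda> r) (fold_row M g r))"
    proof (rule conjunct2[OF C, rule_format], intro conjI ballI)
      fix r x assume "r < M" "x \<in> {0..<1} - fold_level M A r"
      then show "cmod (fold_row M g r x) \<le> K * (\<Sum>q<r. cmod (fold_row M g q x))"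
        using g by (intro conjunct2[OF K, rule_format]) (auto simp: l2_on_def fold_level_def)
    qed (rule l2_on_fold_row[OF gU M])
    also have "(\<Sum>r<M. sample_energy (\<Lambda> r) (fold_row M g r)) = (\<Sum>r<M. sample_energy (?L r) g)"
    proof (intro sum.cong refl)
      fix r
      have "inj_on (\<lambda>l. int M * l + int r) (\<Lambda> r)" using M by (auto simp: inj_on_def)
      then show "sample_energy (\<Lambda> r) (fold_row M g r) = sample_energy (?L r) g"
        unfolding sample_energy_def ft_fold_row[OF gU M] by (subst infsum_reindex) (auto simp: o_def)
    qed
    also have "\<dots> = sample_energy (\<Union>r<M. ?L r) g"
      by (rule sample_energy_UN[symmetric, OF gU _ disj]) simp
    finally show ?thesis .
  qed
  then show "sampling A (\<Union>r<M. ?L r)" unfolding sampling_def using conjunct1[OF C] by blast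
qed

section \<open>Short arcs\<close>

lemma exp_taylor_le:
  assumes "(d :: real) \<ge> 0"
  shows "(\<Sum>k<K. d ^ k / fact k) \<le> exp d"
proof -
  have "(\<lambda>k. d ^ k / fact k) sums exp d"
    using exp_converges[of d] by (simp add: scaleR_conv_of_real field_simps)
  then show ?thesis
    using sum_le_suminf[of "\<lambda>k. d ^ k / fact k" "{..<K}"] assms by (auto simp: sums_iff)
qed

text \<open>The exponential series in the perturbation separates the variables, so that Bessel's inequality
  applies to each term.\<close>

lemma perturbed_ft_bound:
  assumes g: "l2_on {0..<1} g" and \<epsilon>: "\<And>n. \<bar>\<epsilon> n\<bar> \<le> \<delta>" and N: "finite N"
  shows "L2_set (\<lambda>n. cmod (ft g (of_int n + \<epsilon> n) - ft g (of_int n))) N \<le> (exp (2 * pi * \<delta>) - 1) * sqrt (energy g)"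
proof -
  \<comment> \<open>\<open>G k\<close> holds the part of the \<open>k\<close>-th term that depends
    on \<open>x\<close>, and \<open>T K n\<close> is the \<open>K\<close>-th partial sum. Since
    \<open>x < 1\<close> on the support, the norm of \<open>G k\<close> is at most
    \<open>(2 * pi)^k\<close> times that of \<open>g\<close>.\<close>
  define G where "G = (\<lambda>k x. (2 * pi * \<i> * of_real x) ^ k * g x)"
  define T where "T = (\<lambda>K n. \<Sum>k<K. of_real (\<epsilon> n ^ k / fact k) * ft (G k) (of_int n))"
  have \<delta>: "\<delta> \<ge> 0" using \<epsilon>[of 0] by linarith
  have G: "l2_on {0..<1} (G k)" "energy (G k) \<le> ((2 * pi) ^ k)\<^sup>2 * energy g" for k
  proof -
    have "cmod ((2 * pi * \<i> * of_real x) ^ k) \<le> (2 * pi) ^ k" if "x \<in> {0..<1}" for x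
      using that by (simp add: norm_power norm_mult power_mult_distrib mult_left_le power_le_one)
    from l2_on_mult_bounded[OF g _ this] show "l2_on {0..<1} (G k)" "energy (G k) \<le> ((2 * pi) ^ k)\<^sup>2 * energy g"
      unfolding G_def by auto
  qed
  have lim: "(\<lambda>K. T K n) \<longlonglongrightarrow> ft g (of_int n + \<epsilon> n)" for n
  proof -
    let ?s = "\<lambda>K x. (\<Sum>k<K. (2 * pi * \<i> * of_real x * of_real (\<epsilon> n)) ^ k /\<^sub>R fact k) * (g x * ee (of_int n * x))"
    have T: "T K n = (\<integral>x. ?s K x \<partial>lborel)" for K
    proof -
      have "T K n = (\<integral>x. (\<Sum>k<K. of_real (\<epsilon> n ^ k / fact k) * (G k x * ee (of_int n * x))) \<partial>lborel)"
        unfolding T_def ft_def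
        by (subst Bochner_Integration.integral_sum) (auto intro!: l2_on_ft_integrable G)
      also have "\<dots> = (\<integral>x. ?s K x \<partial>lborel)"
        by (intro Bochner_Integration.integral_cong refl)
          (simp only: sum_distrib_right, intro sum.cong refl,
            simp add: G_def power_mult_distrib scaleR_conv_of_real field_simps)
      finally show ?thesis .
    qed
    have ft: "ft g (of_int n + \<epsilon> n) = (\<integral>x. exp (2 * pi * \<i> * of_real x * of_real (\<epsilon> n)) * (g x * ee (of_int n * x)) \<partial>lborel)"
      unfolding ft_def
      by (intro Bochner_Integration.integral_cong refl) (simp only: distrib_right ee_add, simp add: ee_eq_exp mult_ac)
    note [measurable] = l2_on_measurable[OF g]
    show ?thesis unfolding T ft
    proof (rule Bochner_Integration.integral_dominated_convergence[where w="\<lambda>x. exp (2 * pi * \<delta>) * cmod (g x)"])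
      show "integrable lborel (\<lambda>x. exp (2 * pi * \<delta>) * cmod (g x))"
        using l2_on_integrable[OF g, of "\<lambda>_. 1" 1] by (intro integrable_mult_right integrable_norm) simp
      show "AE x in lborel. (\<lambda>K. ?s K x) \<longlonglongrightarrow> exp (2 * pi * \<i> * of_real x * of_real (\<epsilon> n)) * (g x * ee (of_int n * x))"
        using exp_converges unfolding sums_def by (intro AE_I2 tendsto_mult tendsto_const) blast
      show "AE x in lborel. norm (?s K x) \<le> exp (2 * pi * \<delta>) * cmod (g x)" for K
      proof (rule AE_I2)
        fix x
        show "norm (?s K x) \<le> exp (2 * pi * \<delta>) * cmod (g x)"
        proof (cases "x \<in> {0..<1}")
          case True
          have "cmod (\<Sum>k<K. (2 * pi * \<i> * of_real x * of_real (\<epsilon> n)) ^ k /\<^sub>R fact k) \<le> (\<Sum>k<K. (2 * pi * \<delta>) ^ k / fact k)"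
          proof (rule sum_norm_le)
            fix k
            have "cmod (2 * pi * \<i> * of_real x * of_real (\<epsilon> n)) = 2 * pi * (x * \<bar>\<epsilon> n\<bar>)"
              using True by (simp add: norm_mult)
            also have "\<dots> \<le> 2 * pi * (1 * \<delta>)"
              using True \<epsilon>[of n] by (intro mult_left_mono mult_mono) auto
            finally show "norm ((2 * pi * \<i> * of_real x * of_real (\<epsilon> n)) ^ k /\<^sub>R fact k) \<le> (2 * pi * \<delta>) ^ k / fact k"
              by (simp add: norm_power divide_inverse mult.commute[of _ "inverse (fact k)"] power_mono)
          qed
          also have "\<dots> \<le> exp (2 * pi * \<delta>)"
            using \<delta> by (intro exp_taylor_le) simp
          finally show ?thesis by (simp add: norm_mult mult_right_mono)
        qed (use g in \<open>auto simp: l2_on_def\<close>)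
      qed
    qed measurable
  qed
  have bound: "L2_set (\<lambda>n. cmod (T K n - ft g (of_int n))) N \<le> (exp (2 * pi * \<delta>) - 1) * sqrt (energy g)" if "K \<ge> 1" for K
  proof -
    have piece: "L2_set (\<lambda>n. cmod (of_real (\<epsilon> n ^ k / fact k) * ft (G k) (of_int n))) N \<le> (2 * pi * \<delta>) ^ k / fact k * sqrt (energy g)" for k
    proof -
      have "L2_set (\<lambda>n. cmod (of_real (\<epsilon> n ^ k / fact k) * ft (G k) (of_int n))) N \<le> L2_set (\<lambda>n. \<delta> ^ k / fact k * cmod (ft (G k) (of_int n))) N"
      proof (rule L2_set_mono)
        fix n
        have "\<bar>\<epsilon> n\<bar> ^ k \<le> \<delta> ^ k" using \<epsilon> by (intro power_mono) auto
        then show "cmod (of_real (\<epsilon> n ^ k / fact k) * ft (G k) (of_int n)) \<le> \<delta> ^ k / fact k * cmod (ft (G k) (of_int n))"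
          by (simp add: norm_mult norm_divide norm_power power_abs mult_right_mono divide_right_mono)
      qed simp
      also have "\<dots> = \<delta> ^ k / fact k * L2_set (\<lambda>n. cmod (ft (G k) (of_int n))) N"
        using \<delta> by (subst L2_set_right_distrib) auto
      also have "\<dots> \<le> \<delta> ^ k / fact k * ((2 * pi) ^ k * sqrt (energy g))"
      proof (rule mult_left_mono)
        have "L2_set (\<lambda>n. cmod (ft (G k) (of_int n))) N \<le> sqrt (((2 * pi) ^ k)\<^sup>2 * energy g)"
          unfolding L2_set_def using bessel_inequality[OF G(1) N, of k] G(2)[of k] by (intro real_sqrt_le_mono) linarith
        then show "L2_set (\<lambda>n. cmod (ft (G k) (of_int n))) N \<le> (2 * pi) ^ k * sqrt (energy g)"
          by (simp add: real_sqrt_mult)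
      qed (use \<delta> in simp)
      finally show ?thesis by (simp add: power_mult_distrib mult_ac)
    qed
    have tri: "L2_set (\<lambda>n. cmod (\<Sum>k\<in>S. f k n)) N \<le> (\<Sum>k\<in>S. L2_set (\<lambda>n. cmod (f k n)) N)" if "finite S" for f :: "nat \<Rightarrow> int \<Rightarrow> complex" and S
      using that
    proof (induction S rule: finite_induct)
      case (insert k S)
      have "L2_set (\<lambda>n. cmod (f k n + (\<Sum>k\<in>S. f k n))) N \<le> L2_set (\<lambda>n. cmod (f k n) + cmod (\<Sum>k\<in>S. f k n)) N"
        by (intro L2_set_mono norm_triangle_ineq) auto
      also have "\<dots> \<le> L2_set (\<lambda>n. cmod (f k n)) N + L2_set (\<lambda>n. cmod (\<Sum>k\<in>S. f k n)) N"
        by (rule L2_set_triangle_ineq)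
      finally show ?case using insert by simp
    qed (simp add: L2_set_def)
    have split: "(\<Sum>k<K. f k) = f 0 + (\<Sum>k\<in>{1..<K}. f k)" for f :: "nat \<Rightarrow> 'b :: comm_monoid_add"
      using that by (simp add: lessThan_atLeast0 sum.atLeast_Suc_lessThan)
    \<comment> \<open>The term \<open>k = 0\<close> is the unperturbed coefficient; removing it
      turns the bound \<open>exp\<close> into \<open>exp - 1\<close>.\<close>
    have G0: "G 0 = g" by (simp add: G_def)
    have "L2_set (\<lambda>n. cmod (T K n - ft g (of_int n))) N = L2_set (\<lambda>n. cmod (\<Sum>k\<in>{1..<K}. of_real (\<epsilon> n ^ k / fact k) * ft (G k) (of_int n))) N"
      unfolding T_def split by (simp add: G0)
    also have "\<dots> \<le> (\<Sum>k\<in>{1..<K}. (2 * pi * \<delta>) ^ k / fact k * sqrt (energy g))"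
      by (rule order_trans[OF tri sum_mono[OF piece]]) simp
    also have "\<dots> = ((\<Sum>k<K. (2 * pi * \<delta>) ^ k / fact k) - 1) * sqrt (energy g)"
      unfolding split by (simp add: sum_distrib_right)
    also have "\<dots> \<le> (exp (2 * pi * \<delta>) - 1) * sqrt (energy g)"
      using exp_taylor_le[of "2 * pi * \<delta>" K] \<delta> by (intro mult_right_mono) auto
    finally show ?thesis .
  qed
  have "(\<lambda>K. L2_set (\<lambda>n. cmod (T K n - ft g (of_int n))) N) \<longlonglongrightarrow> L2_set (\<lambda>n. cmod (ft g (of_int n + \<epsilon> n) - ft g (of_int n))) N"
    unfolding L2_set_def by (intro tendsto_intros lim)
  then show ?thesis
    by (rule LIMSEQ_le_const2) (use bound in auto)
qed

text \<open>The perturbation moves the coefficient sequence by at most half the norm of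
  \<open>g\<close>, hence \<open>sqrt (energy g) \<le> sqrt S + sqrt (energy g) / 2\<close>; the
  factor 4 is the square of the resulting 2.\<close>

lemma perturbed_sampling:
  assumes g: "l2_on {0..<1} g" and \<epsilon>: "\<And>n. \<bar>\<epsilon> n\<bar> \<le> 1/20"
    and S: "\<And>N. finite N \<Longrightarrow> (\<Sum>n\<in>N. (cmod (ft g (of_int n + \<epsilon> n)))\<^sup>2) \<le> S"
  shows "energy g \<le> 4 * S"
proof -
  have S0: "S \<ge> 0" using S[of "{}"] by simp
  \<comment> \<open>\<open>2 * pi / 20 < 0.32\<close> and \<open>exp x \<le> 1 + x + x^2\<close>
    give a value below 0.43.\<close>
  have rho: "exp (2 * pi * (1/20)) - 1 \<le> 1/2"
  proof -
    let ?x = "2 * pi * (1/20)"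
    have x: "0 \<le> ?x" "?x \<le> 0.32" using pi_approx by simp_all
    have "?x * ?x \<le> 0.32 * 0.32" using x by (intro mult_mono) auto
    with x exp_bound[of ?x] show ?thesis by (simp add: power2_eq_square)
  qed
  have "L2_set (\<lambda>n. cmod (ft g (of_int n))) N \<le> sqrt S + 1/2 * sqrt (energy g)" if N: "finite N" for N
  proof -
    have "L2_set (\<lambda>n. cmod (ft g (of_int n))) N \<le>
        L2_set (\<lambda>n. cmod (ft g (of_int n + \<epsilon> n)) + cmod (ft g (of_int n + \<epsilon> n) - ft g (of_int n))) N"
      by (intro L2_set_mono) (auto intro: norm_triangle_sub[THEN order_trans] simp: norm_minus_commute)
    also have "\<dots> \<le> L2_set (\<lambda>n. cmod (ft g (of_int n + \<epsilon> n))) N + L2_set (\<lambda>n. cmod (ft g (of_int n + \<epsilon> n) - ft g (of_int n))) N"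
      by (rule L2_set_triangle_ineq)
    also have "L2_set (\<lambda>n. cmod (ft g (of_int n + \<epsilon> n))) N \<le> sqrt S"
      unfolding L2_set_def by (intro real_sqrt_le_mono S N)
    also have "L2_set (\<lambda>n. cmod (ft g (of_int n + \<epsilon> n) - ft g (of_int n))) N \<le> (exp (2 * pi * (1/20)) - 1) * sqrt (energy g)"
      by (rule perturbed_ft_bound[OF g \<epsilon> N])
    also have "\<dots> \<le> 1/2 * sqrt (energy g)"
      using rho by (intro mult_right_mono) auto
    finally show ?thesis by simp
  qed
  then have fin: "(\<Sum>n\<in>N. (cmod (ft g (of_int n)))\<^sup>2) \<le> (sqrt S + 1/2 * sqrt (energy g))\<^sup>2" if "finite N" for N
    using that S0 unfolding L2_set_def by (intro sqrt_le_D) auto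
  have "energy g \<le> (sqrt S + 1/2 * sqrt (energy g))\<^sup>2"
  proof (rule field_le_epsilon)
    fix e :: real assume "e > 0"
    obtain N where "finite N" "energy g \<le> (\<Sum>n\<in>N. (cmod (ft g (of_int n)))\<^sup>2) + e"
      using parseval_approx[OF g \<open>e > 0\<close>] .
    then show "energy g \<le> (sqrt S + 1/2 * sqrt (energy g))\<^sup>2 + e" using fin[of N] by linarith
  qed
  then have "sqrt (energy g) \<le> sqrt ((sqrt S + 1/2 * sqrt (energy g))\<^sup>2)" by (rule real_sqrt_le_mono)
  also have "\<dots> = sqrt S + 1/2 * sqrt (energy g)" using S0 by simp
  finally have "sqrt (energy g) \<le> 2 * sqrt S" by simp
  then have "(sqrt (energy g))\<^sup>2 \<le> (2 * sqrt S)\<^sup>2" by (intro power_mono) auto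
  then show ?thesis using S0 by (simp add: power_mult_distrib)
qed

section \<open>Arcs of length at most 1/10\<close>

definition arc :: "real \<Rightarrow> real \<Rightarrow> real set" where
  "arc a \<alpha> = {x \<in> {0..<1}. a \<le> x \<and> x < a + \<alpha> \<or> x + 1 < a + \<alpha>}"

lemma integral_rotate:
  fixes F :: "real \<Rightarrow> 'a :: {banach, second_countable_topology}"
  assumes F: "integrable lborel F" and supp: "\<And>x. x \<notin> {0..<1} \<Longrightarrow> F x = 0" and a: "0 \<le> a" "a \<le> 1"
  shows "integrable lborel (\<lambda>x. indicator {a..<1} x *\<^sub>R F x + indicator {0..<a} (x - 1) *\<^sub>R F (x - 1))"
    and "(\<integral>x. indicator {a..<1} x *\<^sub>R F x + indicator {0..<a} (x - 1) *\<^sub>R F (x - 1) \<partial>lborel) = integral\<^sup>L lborel F"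
proof -
  let ?H = "\<lambda>x. indicator {0..<a} x *\<^sub>R F x" and ?K = "\<lambda>x. indicator {a..<1} x *\<^sub>R F x"
  have H: "integrable lborel ?H" and K: "integrable lborel ?K"
    by (intro integrable_mult_indicator F; simp)+
  have H': "integrable lborel (\<lambda>x. ?H (x - 1))"
    using lborel_integrable_real_affine[OF H, of 1 "-1"] by simp
  show "integrable lborel (\<lambda>x. ?K x + ?H (x - 1))" using K H' by (rule Bochner_Integration.integrable_add)
  have "(\<integral>x. ?K x + ?H (x - 1) \<partial>lborel) = integral\<^sup>L lborel ?K + (\<integral>x. ?H (x - 1) \<partial>lborel)"
    using K H' by (rule Bochner_Integration.integral_add)
  also have "(\<integral>x. ?H (x - 1) \<partial>lborel) = integral\<^sup>L lborel ?H"
    using lborel_integral_real_affine[of 1 ?H "-1"] by simp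
  also have "integral\<^sup>L lborel ?K + integral\<^sup>L lborel ?H = (\<integral>x. ?K x + ?H x \<partial>lborel)"
    using K H by (rule Bochner_Integration.integral_add[symmetric])
  also have "(\<lambda>x. ?K x + ?H x) = F"
    using supp a by (auto simp: fun_eq_iff indicator_def)
  finally show "(\<integral>x. ?K x + ?H (x - 1) \<partial>lborel) = integral\<^sup>L lborel F" .
qed

text \<open>The part of the signal on \<open>[0, a)\<close> is moved one period to the right, so
  that an arc starting at \<open>a\<close> becomes the interval \<open>[a, a + \<alpha>)\<close>
  even if it passes 1; integer frequencies do not notice.\<close>

lemma rotate_signal:
  assumes g: "l2_on {0..<1} g" and a: "0 \<le> a" "a \<le> 1"
  defines "g' \<equiv> \<lambda>x. indicator {a..<1} x * g x + indicator {0..<a} (x - 1) * g (x - 1)"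
  shows "l2_on {a..<a + 1} g'" "energy g' = energy g" "ft g' (of_int n) = ft g (of_int n)"
proof -
  note [measurable] = l2_on_measurable[OF g]
  have supp: "g x = 0" if "x \<notin> {0..<1}" for x using g that by (auto simp: l2_on_def)
  have sq: "(cmod (g' x))\<^sup>2 = indicator {a..<1} x *\<^sub>R (cmod (g x))\<^sup>2 + indicator {0..<a} (x - 1) *\<^sub>R (cmod (g (x - 1)))\<^sup>2" for x
    unfolding g'_def using a by (auto simp: indicator_def)
  note r = integral_rotate[OF l2_on_integrable_square[OF g] _ a, folded sq]
  have "integrable lborel (\<lambda>x. (cmod (g' x))\<^sup>2)" using supp by (intro r(1)) auto
  moreover have "g' \<in> borel_measurable borel" unfolding g'_def by measurable
  ultimately show "l2_on {a..<a + 1} g'" using a by (auto simp: l2_on_def g'_def indicator_def)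
  show "energy g' = energy g" unfolding energy_def using supp by (intro r(2)) auto
  have "ee (of_int n * (x - 1)) = ee (of_int n * x)" for x
    using ee_add[of "of_int n * x" "of_int (- n)"] by (simp add: right_diff_distrib del: of_int_minus) (simp add: algebra_simps)
  then have "g' x * ee (of_int n * x) = indicator {a..<1} x *\<^sub>R (g x * ee (of_int n * x)) + indicator {0..<a} (x - 1) *\<^sub>R (g (x - 1) * ee (of_int n * (x - 1)))" for x
    unfolding g'_def by (auto simp: indicator_def)
  then show "ft g' (of_int n) = ft g (of_int n)"
    unfolding ft_def using integral_rotate(2)[OF l2_on_ft_integrable[OF g] _ a] supp by simp
qed

lemma measure_arc:
  assumes "0 \<le> a" "a < 1" "0 \<le> \<alpha>" "\<alpha> < 1"
  shows "measure lborel (arc a \<alpha>) = \<alpha>"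
proof (cases "a + \<alpha> \<le> 1")
  case True
  then have "arc a \<alpha> = {a..<a + \<alpha>}" using assms by (auto simp: arc_def)
  then show ?thesis using assms by simp
next
  case False
  then have "arc a \<alpha> = {a..<1} \<union> {0..<a + \<alpha> - 1}" using assms by (auto simp: arc_def)
  moreover have "measure lborel ({a..<1} \<union> {0..<a + \<alpha> - 1}) = measure lborel {a..<1} + measure lborel {0..<a + \<alpha> - 1}"
    using assms False by (intro measure_Union) auto
  ultimately show ?thesis using assms False by simp
qed

text \<open>Stretching the arc onto the unit interval turns the frequency \<open>m\<close> into
  \<open>\<alpha> * m\<close>, and for \<open>m = round (n / \<alpha>)\<close> this misses
  \<open>n\<close> by at most \<open>\<alpha> / 2 \<le> 1/20\<close>, the tolerance of
  \<open>perturbed_sampling\<close>.\<close>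

lemma critical_arc:
  assumes a: "0 \<le> a" "a < 1" and \<alpha>: "0 < \<alpha>" "\<alpha> \<le> 1/10"
  shows "critical (arc a \<alpha>) (range (\<lambda>n::int. round (n / \<alpha>)))"
  unfolding critical_def
proof
  let ?l = "\<lambda>n::int. round (n / \<alpha>)"
  have l: "\<bar>of_int (?l n) - n / \<alpha>\<bar> \<le> 1/2" for n using of_int_round_abs_le .
  have inj: "inj ?l"
  proof (rule injI)
    fix n m assume eq: "?l n = ?l m"
    then have "\<bar>n / \<alpha> - m / \<alpha>\<bar> \<le> 1" using l[of n] l[of m] unfolding eq by linarith
    then have "\<bar>(n - m) / \<alpha>\<bar> \<le> 1" by (simp add: diff_divide_distrib)
    then have "\<bar>real_of_int (n - m)\<bar> \<le> \<alpha>" using \<alpha> by (simp add: abs_divide field_simps)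
    then have "\<bar>real_of_int (n - m)\<bar> < 1" using \<alpha> by linarith
    then show "n = m" by linarith
  qed
  have "energy g \<le> 4 / \<alpha> * sample_energy (range ?l) g" if g: "l2_on (arc a \<alpha>) g" for g
  proof -
    have gU: "l2_on {0..<1} g" by (rule l2_on_mono[OF g]) (auto simp: arc_def)
    define g' where "g' = (\<lambda>x. indicator {a..<1} x * g x + indicator {0..<a} (x - 1) * g (x - 1))"
    define G where "G = (\<lambda>x. g' (a + \<alpha> * x))"
    define \<epsilon> where "\<epsilon> = (\<lambda>n. \<alpha> * (of_int (?l n) - n / \<alpha>))"
    have a': "0 \<le> a" "a \<le> 1" using a by auto
    note rot = rotate_signal[OF gU a', folded g'_def]
    have supp: "g' x = 0" if "x \<notin> {a..<a + \<alpha>}" for x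
    proof -
      have "g x = 0" if "x \<notin> arc a \<alpha>" for x using g that by (simp add: l2_on_def)
      then show ?thesis using that a \<alpha> unfolding g'_def by (auto simp: indicator_def arc_def)
    qed
    have "energy g' = \<alpha> * energy G"
      unfolding energy_def G_def
      using lborel_integral_real_affine[of \<alpha> "\<lambda>x. (cmod (g' x))\<^sup>2" a] \<alpha> by simp
    then have energyG: "energy g = \<alpha> * energy G" by (simp add: rot(2))
    have G: "l2_on {0..<1} G"
      unfolding l2_on_def
    proof (intro conjI allI impI)
      show "G \<in> borel_measurable borel" unfolding G_def using l2_on_measurable[OF rot(1)] by measurable
      show "integrable lborel (\<lambda>x. (cmod (G x))\<^sup>2)"
        unfolding G_def using lborel_integrable_real_affine[OF l2_on_integrable_square[OF rot(1)]] \<alpha> by simp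
      fix x :: real assume "x \<notin> {0..<1}"
      then have "a + \<alpha> * x \<notin> {a..<a + \<alpha>}"
        using \<alpha> by (auto simp: zero_le_mult_iff) 
      then show "G x = 0" unfolding G_def by (rule supp)
    qed
    have ftG: "cmod (ft G (of_int n + \<epsilon> n)) = cmod (ft g (of_int (?l n))) / \<alpha>" for n
    proof -
      have "of_int n + \<epsilon> n = \<alpha> * of_int (?l n)" unfolding \<epsilon>_def using \<alpha> by (simp add: field_simps)
      moreover have "ee (\<alpha> * of_int (?l n) * x) = ee (- of_int (?l n) * a) * ee (of_int (?l n) * (a + \<alpha> * x))" for x
        unfolding ee_add[symmetric] by (simp add: algebra_simps)
      ultimately have "ft G (of_int n + \<epsilon> n) = (\<integral>x. ee (- of_int (?l n) * a) * (g' (a + \<alpha> * x) * ee (of_int (?l n) * (a + \<alpha> * x))) \<partial>lborel)"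
        unfolding ft_def G_def
        by (intro Bochner_Integration.integral_cong refl) (simp only: mult_ac)
      also have "\<dots> = ee (- of_int (?l n) * a) * (\<integral>x. g' (a + \<alpha> * x) * ee (of_int (?l n) * (a + \<alpha> * x)) \<partial>lborel)"
        by simp
      also have "(\<integral>x. g' (a + \<alpha> * x) * ee (of_int (?l n) * (a + \<alpha> * x)) \<partial>lborel) = ft g' (of_int (?l n)) / \<alpha>"
        unfolding ft_def
        using lborel_integral_real_affine[of \<alpha> "\<lambda>x. g' x * ee (of_int (?l n) * x)" a] \<alpha> by (simp add: scaleR_conv_of_real)
      finally show ?thesis using \<alpha> by (simp add: norm_mult norm_divide rot(3))
    qed
    have "energy G \<le> 4 * (sample_energy (range ?l) g / \<alpha>\<^sup>2)"
    proof (rule perturbed_sampling[OF G])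
      show "\<bar>\<epsilon> n\<bar> \<le> 1/20" for n
      proof -
        have "\<bar>\<epsilon> n\<bar> = \<alpha> * \<bar>of_int (?l n) - n / \<alpha>\<bar>" unfolding \<epsilon>_def using \<alpha> by (simp add: abs_mult)
        also have "\<dots> \<le> 1/10 * (1/2)" using \<alpha> l by (intro mult_mono) auto
        finally show ?thesis by simp
      qed
      fix N :: "int set" assume N: "finite N"
      have "(\<Sum>n\<in>N. (cmod (ft G (of_int n + \<epsilon> n)))\<^sup>2) = (\<Sum>m\<in>?l ` N. (cmod (ft g (of_int m)))\<^sup>2) / \<alpha>\<^sup>2"
        unfolding ftG using inj by (subst sum.reindex) (auto simp: power_divide sum_divide_distrib inj_on_def)
      also have "\<dots> \<le> sample_energy (range ?l) g / \<alpha>\<^sup>2"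
        using N by (intro divide_right_mono sum_le_sample_energy gU) auto
      finally show "(\<Sum>n\<in>N. (cmod (ft G (of_int n + \<epsilon> n)))\<^sup>2) \<le> sample_energy (range ?l) g / \<alpha>\<^sup>2" .
    qed
    then have "\<alpha> * energy G \<le> \<alpha> * (4 * (sample_energy (range ?l) g / \<alpha>\<^sup>2))" using \<alpha> by (intro mult_left_mono) auto
    then show ?thesis unfolding energyG using \<alpha> by (simp add: power2_eq_square)
  qed
  then show "sampling (arc a \<alpha>) (range ?l)"
    unfolding sampling_def using \<alpha> by (intro exI[of _ "4 / \<alpha>"]) auto
  have "\<bar>real (card (range ?l \<inter> {- int n..int n})) - 2 * \<alpha> * real n\<bar> \<le> 5" for n :: nat
  proof -
    let ?T = "{k. \<bar>?l k\<bar> \<le> int n}"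
    have "range ?l \<inter> {- int n..int n} = ?l ` ?T" by auto
    moreover have "inj_on ?l ?T" using inj by (auto simp: inj_on_def)
    ultimately have card: "card (range ?l \<inter> {- int n..int n}) = card ?T" by (simp add: card_image)
    \<comment> \<open>Indices with \<open>\<bar>k / \<alpha>\<bar> \<le> n - 1/2\<close> surely
      round into the window, those beyond \<open>n + 1/2\<close> surely do not. For
      \<open>n = 0\<close> the number \<open>q\<close> is negative and the inner range is
      empty.\<close>
    define p where "p = \<lfloor>\<alpha> * (real n + 1/2)\<rfloor>"
    define q where "q = \<lfloor>\<alpha> * (real n - 1/2)\<rfloor>"
    have div: "\<bar>real_of_int k\<bar> / \<alpha> = \<bar>k / \<alpha>\<bar>" for k :: int using \<alpha> by (simp add: abs_divide)
    have sub1: "?T \<subseteq> {-p..p}"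
    proof
      fix k assume "k \<in> ?T"
      then have "\<bar>real_of_int (?l k)\<bar> \<le> real n" by (simp add: of_int_abs[symmetric] del: of_int_abs)
      then have "\<bar>k / \<alpha>\<bar> \<le> real n + 1/2" using l[of k] by linarith
      then have "\<bar>real_of_int k\<bar> \<le> \<alpha> * (real n + 1/2)" unfolding div[symmetric] using \<alpha> by (simp add: pos_divide_le_eq mult.commute)
      then have "\<bar>k\<bar> \<le> p" unfolding p_def le_floor_iff by simp
      then show "k \<in> {-p..p}" by auto
    qed
    have sub2: "{-q..q} \<subseteq> ?T"
    proof
      fix k assume "k \<in> {-q..q}"
      then have "\<bar>k\<bar> \<le> q" by auto
      then have "\<bar>real_of_int k\<bar> \<le> \<alpha> * (real n - 1/2)" unfolding q_def le_floor_iff by simp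
      then have "\<bar>k / \<alpha>\<bar> \<le> real n - 1/2" unfolding div[symmetric] using \<alpha> by (simp add: pos_divide_le_eq mult.commute)
      then have "\<bar>real_of_int (?l k)\<bar> \<le> real n" using l[of k] by linarith
      then show "k \<in> ?T" by simp
    qed
    have "real_of_int p \<le> \<alpha> * (real n + 1/2)" unfolding p_def by (rule of_int_floor_le)
    then have p: "real_of_int p \<le> \<alpha> * real n + 1" using \<alpha> by (simp add: distrib_left)
    have p0: "p \<ge> 0" unfolding p_def using \<alpha> by simp
    have "\<alpha> * (real n - 1/2) < real_of_int q + 1" unfolding q_def by (rule real_of_int_floor_add_one_gt)
    then have q: "real_of_int q \<ge> \<alpha> * real n - 2" using \<alpha> by (simp add: right_diff_distrib)
    have "card ?T \<le> card {-p..p}" using sub1 by (intro card_mono) auto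
    then have up: "real (card ?T) \<le> 2 * real_of_int p + 1" using p0 by simp
    have "card {-q..q} \<le> card ?T" using sub1 sub2 by (intro card_mono finite_subset[OF sub1]) auto
    then have "real (card ?T) \<ge> 2 * real_of_int q + 1" by simp
    then show ?thesis unfolding card using up p q by linarith
  qed
  then show "bounded_discrepancy (range ?l) (measure lborel (arc a \<alpha>))"
    using a \<alpha> unfolding bounded_discrepancy_def by (subst measure_arc) auto
qed

section \<open>Step functions on the circle\<close>

text \<open>Only the left side is examined, since \<open>tame\<close> functions are constant just to
  the right of every point. Limits are expressed by eventual equality, so that values without a
  topology, such as sets, can form step functions too.\<close>

definition jump_at :: "(real \<Rightarrow> 'b) \<Rightarrow> real \<Rightarrow> bool" where
  "jump_at f z \<longleftrightarrow> \<not> (\<forall>\<^sub>F t in at_left z. f t = f z)"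

definition tame :: "(real \<Rightarrow> 'b) \<Rightarrow> bool" where
  "tame f \<longleftrightarrow> (\<forall>z. (\<forall>\<^sub>F t in at_right z. f t = f z) \<and> (\<exists>v. \<forall>\<^sub>F t in at_left z. f t = v))"

definition jumps :: "(real \<Rightarrow> 'b) \<Rightarrow> real set" where
  "jumps f = {z \<in> {0..<1}. jump_at f z}"

definition periodic :: "(real \<Rightarrow> 'b) \<Rightarrow> bool" where
  "periodic f \<longleftrightarrow> (\<forall>x. f (x + 1) = f x)"

lemma tame_right: "tame f \<Longrightarrow> \<forall>\<^sub>F t in at_right z. f t = f z"
  by (simp add: tame_def)

lemma tame_left:
  assumes "tame f"
  obtains v where "\<forall>\<^sub>F t in at_left z. f t = v"
  using assms unfolding tame_def by blast

lemma periodic_int: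
  assumes "periodic f"
  shows "f (x + of_int k) = f x"
proof -
  have nat: "f (x + real n) = f x" for n x
  proof (induction n)
    case (Suc n)
    have "f (x + real (Suc n)) = f ((x + real n) + 1)" by (simp add: add_ac)
    then show ?case using Suc assms by (simp add: periodic_def)
  qed simp
  show ?thesis
  proof (cases "k \<ge> 0")
    case True then show ?thesis using nat[of x "nat k"] by simp
  next
    case False then show ?thesis using nat[of "x + of_int k" "nat (- k)"] by simp
  qed
qed

lemma tame_comp:
  assumes "tame f"
  shows "tame (\<lambda>t. \<phi> (f t))"
  unfolding tame_def
proof (intro allI conjI)
  fix z
  show "\<forall>\<^sub>F t in at_right z. \<phi> (f t) = \<phi> (f z)"
    using tame_right[OF assms] by eventually_elim simp
  obtain v where v: "\<forall>\<^sub>F t in at_left z. f t = v" using tame_left[OF assms] .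
  show "\<exists>v. \<forall>\<^sub>F t in at_left z. \<phi> (f t) = v"
    by (rule exI[of _ "\<phi> v"], rule eventually_mono[OF v]) simp
qed

lemma jump_at_comp: "jump_at (\<lambda>t. \<phi> (f t)) z \<Longrightarrow> jump_at f z"
  unfolding jump_at_def by (erule contrapos_nn, erule eventually_mono) simp

lemma periodic_comp: "periodic f \<Longrightarrow> periodic (\<lambda>t. \<phi> (f t))"
  by (simp add: periodic_def)

lemma eventually_at_left_affine:
  assumes "M > 0" "\<forall>\<^sub>F s in at_left ((z + c) / M). P s"
  shows "\<forall>\<^sub>F t in at_left z. P ((t + c) / M :: real)"
proof -
  obtain b where b: "b < (z + c) / M" "\<And>y. b < y \<Longrightarrow> y < (z + c) / M \<Longrightarrow> P y"
    using assms(2) unfolding eventually_at_left_field by auto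
  show ?thesis unfolding eventually_at_left_field
    by (rule exI[of _ "M * b - c"]) (use assms(1) b in \<open>auto simp: field_simps\<close>)
qed

lemma eventually_at_right_affine:
  assumes "M > 0" "\<forall>\<^sub>F s in at_right ((z + c) / M). P s"
  shows "\<forall>\<^sub>F t in at_right z. P ((t + c) / M :: real)"
proof -
  obtain b where b: "b > (z + c) / M" "\<And>y. (z + c) / M < y \<Longrightarrow> y < b \<Longrightarrow> P y"
    using assms(2) unfolding eventually_at_right_field by auto
  show ?thesis unfolding eventually_at_right_field
    by (rule exI[of _ "M * b - c"]) (use assms(1) b in \<open>auto simp: field_simps\<close>)
qed

lemma jump_at_affine:
  assumes "M > 0" "jump_at (\<lambda>t. f ((t + c) / M)) z"
  shows "jump_at f ((z + c) / M)"
proof (rule ccontr)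
  assume "\<not> jump_at f ((z + c) / M)"
  then have "\<forall>\<^sub>F s in at_left ((z + c) / M). f s = f ((z + c) / M)" by (simp add: jump_at_def)
  from eventually_at_left_affine[OF assms(1) this] show False
    using assms(2) by (simp add: jump_at_def)
qed

lemma tame_affine:
  assumes "M > 0" "tame f"
  shows "tame (\<lambda>t. f ((t + c) / M))"
  unfolding tame_def
proof (intro allI conjI)
  fix z
  show "\<forall>\<^sub>F t in at_right z. f ((t + c) / M) = f ((z + c) / M)"
    by (rule eventually_at_right_affine[OF assms(1) tame_right[OF assms(2)]])
  obtain v where "\<forall>\<^sub>F t in at_left ((z + c) / M). f t = v" using tame_left[OF assms(2)] .
  from eventually_at_left_affine[OF assms(1) this]
  show "\<exists>v. \<forall>\<^sub>F t in at_left z. f ((t + c) / M) = v" by blast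
qed

lemma jump_at_shift:
  assumes "periodic f" "jump_at f z"
  shows "jump_at f (z + of_int k)"
proof -
  have "(\<lambda>t. f ((t + of_int k) / 1)) = f" using periodic_int[OF assms(1)] by auto
  then show ?thesis using jump_at_affine[of 1 f "of_int k" z] assms(2) by simp
qed

lemma jump_at_frac:
  assumes "periodic f"
  shows "jump_at f z \<longleftrightarrow> frac z \<in> jumps f"
proof -
  have "jump_at f z \<longleftrightarrow> jump_at f (frac z)"
    using jump_at_shift[OF assms, of z "- \<lfloor>z\<rfloor>"] jump_at_shift[OF assms, of "frac z" "\<lfloor>z\<rfloor>"]
    by (auto simp: frac_def)
  then show ?thesis by (simp add: jumps_def frac_lt_1)
qed

text \<open>Recording which predicates hold as a set-valued step function reduces every expression
  in finitely many of them, such as a count or a rank condition, to \<open>tame_comp\<close> and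
  \<open>jump_at_comp\<close>.\<close>

lemma tame_family:
  assumes "finite I" "\<And>i. i \<in> I \<Longrightarrow> tame (p i)"
  shows "tame (\<lambda>t. {i \<in> I. p i t})"
    and "jump_at (\<lambda>t. {i \<in> I. p i t}) z \<Longrightarrow> \<exists>i\<in>I. jump_at (p i) z"
proof -
  show "tame (\<lambda>t. {i \<in> I. p i t})"
    unfolding tame_def
  proof (intro allI conjI)
    fix z
    have "\<forall>\<^sub>F t in at_right z. \<forall>i\<in>I. p i t = p i z"
      using assms by (intro eventually_ball_finite) (auto intro: tame_right)
    then show "\<forall>\<^sub>F t in at_right z. {i \<in> I. p i t} = {i \<in> I. p i z}"
      by eventually_elim auto
    have "\<forall>i. \<exists>v. i \<in> I \<longrightarrow> (\<forall>\<^sub>F t in at_left z. p i t = v)"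
      using assms(2) unfolding tame_def by blast
    then obtain v where "\<And>i. i \<in> I \<Longrightarrow> \<forall>\<^sub>F t in at_left z. p i t = v i" by metis
    then have "\<forall>\<^sub>F t in at_left z. \<forall>i\<in>I. p i t = v i"
      using assms(1) by (intro eventually_ball_finite) auto
    then have "\<forall>\<^sub>F t in at_left z. {i \<in> I. p i t} = {i \<in> I. v i}"
      by eventually_elim auto
    then show "\<exists>v. \<forall>\<^sub>F t in at_left z. {i \<in> I. p i t} = v" by blast
  qed
  show "\<exists>i\<in>I. jump_at (p i) z" if "jump_at (\<lambda>t. {i \<in> I. p i t}) z"
  proof (rule ccontr)
    assume "\<not> (\<exists>i\<in>I. jump_at (p i) z)"
    then have "\<forall>\<^sub>F t in at_left z. \<forall>i\<in>I. p i t = p i z"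
      using assms(1) by (intro eventually_ball_finite) (auto simp: jump_at_def)
    then have "\<forall>\<^sub>F t in at_left z. {i \<in> I. p i t} = {i \<in> I. p i z}"
      by eventually_elim auto
    then show False using that by (simp add: jump_at_def)
  qed
qed

lemma eventually_floor_right: "\<forall>\<^sub>F t in at_right z. \<lfloor>t - e\<rfloor> = \<lfloor>z - e :: real\<rfloor>"
  unfolding eventually_at_right_field
proof (intro exI[of _ "of_int (\<lfloor>z - e\<rfloor> + 1) + e"] conjI allI impI)
  show "z < of_int (\<lfloor>z - e\<rfloor> + 1) + e" by linarith
  fix y assume "z < y" "y < of_int (\<lfloor>z - e\<rfloor> + 1) + e"
  then show "\<lfloor>y - e\<rfloor> = \<lfloor>z - e\<rfloor>" by (intro floor_unique) linarith+
qed

lemma eventually_floor_left: "\<forall>\<^sub>F t in at_left z. \<lfloor>t - e\<rfloor> = (if z - e \<in> \<int> then \<lfloor>z - e :: real\<rfloor> - 1 else \<lfloor>z - e\<rfloor>)"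
proof (cases "z - e \<in> \<int>")
  case True
  then obtain k where k: "z - e = of_int k" by (auto elim: Ints_cases)
  have "\<forall>\<^sub>F t in at_left z. \<lfloor>t - e\<rfloor> = k - 1"
    unfolding eventually_at_left_field
    by (intro exI[of _ "z - 1"] conjI allI impI floor_unique) (use k in linarith)+
  then show ?thesis using k True by simp
next
  case False
  have "of_int \<lfloor>z - e\<rfloor> < z - e"
    using False of_int_floor_le[of "z - e"] by (metis Ints_of_int less_eq_real_def)
  then have "\<forall>\<^sub>F t in at_left z. \<lfloor>t - e\<rfloor> = \<lfloor>z - e\<rfloor>"
    unfolding eventually_at_left_field
    by (intro exI[of _ "e + of_int \<lfloor>z - e\<rfloor>"] conjI allI impI floor_unique) linarith+
  then show ?thesis using False by simp
qed

section \<open>Step functions as combinations of floors\<close>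

definition left_value :: "(real \<Rightarrow> 'b) \<Rightarrow> real \<Rightarrow> 'b" where
  "left_value f z = (SOME v. \<forall>\<^sub>F t in at_left z. f t = v)"

lemma eventually_left_value:
  assumes "tame f"
  shows "\<forall>\<^sub>F t in at_left z. f t = left_value f z"
  unfolding left_value_def by (rule someI_ex) (use assms in \<open>simp add: tame_def\<close>)

lemma left_value_unique:
  assumes "\<forall>\<^sub>F t in at_left z. f t = v" "\<forall>\<^sub>F t in at_left (z :: real). f t = w"
  shows "v = w"
proof -
  have "\<forall>\<^sub>F t in at_left z. v = w" using assms by eventually_elim simp
  then show ?thesis by (simp add: eventually_const)
qed

lemma left_value_shift:
  assumes "tame f" "periodic f"
  shows "left_value f (z + of_int k) = left_value f z"
proof -
  have "\<forall>\<^sub>F t in at_left ((z + of_int k) / 1). f t = left_value f (z + of_int k)"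
    using eventually_left_value[OF assms(1)] by simp
  from eventually_at_left_affine[OF _ this]
  have "\<forall>\<^sub>F t in at_left z. f t = left_value f (z + of_int k)"
    using periodic_int[OF assms(2)] by simp
  from left_value_unique[OF this eventually_left_value[OF assms(1)]] show ?thesis .
qed

text \<open>Subtracting floors with the same jumps leaves a function \<open>d\<close> that is
  locally constant on the connected line, hence constant. Between 0 and 1 every floor grows by 1
  while \<open>c\<close> returns to its value, so the heights cancel.\<close>

lemma step_function_representation:
  fixes c :: "real \<Rightarrow> real"
  assumes c: "tame c" "periodic c" "finite (jumps c)"
  defines "s \<equiv> \<lambda>e. c e - left_value c e"
  shows "\<exists>K. \<forall>t. c t = K + (\<Sum>e\<in>jumps c. s e * of_int \<lfloor>t - e\<rfloor>)" and "(\<Sum>e\<in>jumps c. s e) = 0"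
proof -
  define d where "d = (\<lambda>t. c t - (\<Sum>e\<in>jumps c. s e * of_int \<lfloor>t - e\<rfloor>))"
  have right: "\<forall>\<^sub>F t in at_right z. d t = d z" for z
  proof -
    have "\<forall>\<^sub>F t in at_right z. \<forall>e\<in>jumps c. \<lfloor>t - e\<rfloor> = \<lfloor>z - e\<rfloor>"
      using c(3) by (intro eventually_ball_finite) (auto intro: eventually_floor_right)
    then show ?thesis using tame_right[OF c(1), of z]
      by eventually_elim (simp add: d_def)
  qed
  have left: "\<forall>\<^sub>F t in at_left z. d t = d z" for z
  proof -
    have int: "z - e \<in> \<int> \<longleftrightarrow> e = frac z" if "e \<in> jumps c" for e
    proof
      assume "z - e \<in> \<int>"
      then obtain k where "z - e = of_int k" by (auto elim: Ints_cases)
      then have "frac z = frac e" by (metis add_diff_cancel_left' diff_add_cancel frac_add_of_int_right)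
      then show "e = frac z" using that by (simp add: jumps_def frac_eq)
    qed (simp add: frac_def)
    have "\<forall>\<^sub>F t in at_left z. \<forall>e\<in>jumps c. \<lfloor>t - e\<rfloor> = (if e = frac z then \<lfloor>z - e\<rfloor> - 1 else \<lfloor>z - e\<rfloor>)"
    proof (intro eventually_ball_finite ballI c(3))
      fix e assume "e \<in> jumps c"
      from int[OF this] show "\<forall>\<^sub>F t in at_left z. \<lfloor>t - e\<rfloor> = (if e = frac z then \<lfloor>z - e\<rfloor> - 1 else \<lfloor>z - e\<rfloor>)"
        using eventually_floor_left[of e z] by simp
    qed
    then show ?thesis using eventually_left_value[OF c(1), of z]
    proof eventually_elim
      case (elim t)
      have "(\<Sum>e\<in>jumps c. s e * of_int \<lfloor>t - e\<rfloor>) = (\<Sum>e\<in>jumps c. s e * of_int \<lfloor>z - e\<rfloor> - (if e = frac z then s (frac z) else 0))"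
        using elim(1) by (intro sum.cong refl) (auto simp: algebra_simps)
      also have "\<dots> = (\<Sum>e\<in>jumps c. s e * of_int \<lfloor>z - e\<rfloor>) - (if frac z \<in> jumps c then s (frac z) else 0)"
        using c(3) by (simp add: sum_subtractf)
      also have "(if frac z \<in> jumps c then s (frac z) else 0) = c z - left_value c z"
      proof (cases "jump_at c z")
        case True
        have "c (frac z) = c z" "left_value c (frac z) = left_value c z"
          using periodic_int[OF c(2), of z "- \<lfloor>z\<rfloor>"] left_value_shift[OF c(1,2), of z "- \<lfloor>z\<rfloor>"] by (auto simp: frac_def)
        then show ?thesis using True jump_at_frac[OF c(2)] by (simp add: s_def)
      next
        case False
        then have "left_value c z = c z"
          using left_value_unique[OF eventually_left_value[OF c(1)]] by (simp add: jump_at_def)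
        then show ?thesis using False jump_at_frac[OF c(2)] by simp
      qed
      finally show ?case using elim(2) by (simp add: d_def)
    qed
  qed
  have const: "d x = d y" for x y
  proof (rule connected_local_const[of UNIV _ _ d]; (intro ballI)?)
    fix z
    have "\<forall>\<^sub>F t in at z. d t = d z" using left right by (simp add: eventually_at_split)
    then show "\<forall>\<^sub>F t in at z. d z = d t" by eventually_elim simp
  qed auto
  have "c t = d 0 + (\<Sum>e\<in>jumps c. s e * of_int \<lfloor>t - e\<rfloor>)" for t
    using const[of t 0] by (simp add: d_def)
  then show "\<exists>K. \<forall>t. c t = K + (\<Sum>e\<in>jumps c. s e * of_int \<lfloor>t - e\<rfloor>)" by blast
  have "d 1 = d 0" by (rule const)
  moreover have "c 1 = c 0" using c(2) unfolding periodic_def by (metis add_0)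
  moreover have "\<lfloor>1 - e\<rfloor> = \<lfloor>0 - e\<rfloor> + 1" for e :: real by linarith
  ultimately show "(\<Sum>e\<in>jumps c. s e) = 0"
    by (simp add: d_def distrib_left sum.distrib)
qed

section \<open>Mean squares of exponential sums\<close>

lemma geometric_sum_from_1: "(1 - z) * (\<Sum>M=1..T. z ^ M) = z - z ^ Suc T" for z :: complex
proof (induction T)
  case (Suc T)
  have "(1 - z) * (\<Sum>M=1..Suc T. z ^ M) = (1 - z) * (\<Sum>M=1..T. z ^ M) + (1 - z) * z ^ Suc T"
    by (simp add: distrib_left)
  also have "\<dots> = z - z ^ Suc (Suc T)" unfolding Suc by (simp add: algebra_simps)
  finally show ?case .
qed simp

text \<open>After expanding the square, the diagonal contributes \<open>card P\<close> for each
  \<open>M\<close>, while every off-diagonal pair gives a geometric sum with ratio different from 1,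
  bounded uniformly in \<open>T\<close>.\<close>

lemma mean_square_lower_bound:
  fixes x s :: "'a \<Rightarrow> real"
  assumes P: "finite P" and s: "\<And>e. e \<in> P \<Longrightarrow> \<bar>s e\<bar> = 1"
    and x: "\<And>e e'. e \<in> P \<Longrightarrow> e' \<in> P \<Longrightarrow> e \<noteq> e' \<Longrightarrow> x e - x e' \<notin> \<int>"
  shows "\<exists>C. \<forall>T::nat. real (card P) * T - C \<le> (\<Sum>M=1..T. (cmod (\<Sum>e\<in>P. of_real (s e) * ee (real M * x e)))\<^sup>2)"
proof -
  let ?C = "\<Sum>e\<in>P. \<Sum>e'\<in>P - {e}. 2 / cmod (1 - ee (x e - x e'))"
  have "real (card P) * T - ?C \<le> (\<Sum>M=1..T. (cmod (\<Sum>e\<in>P. of_real (s e) * ee (real M * x e)))\<^sup>2)" for T :: nat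
  proof -
    let ?E = "\<lambda>e e'. \<Sum>M=1..T. ee (real M * (x e - x e'))"
    have geo: "cmod (?E e e') \<le> 2 / cmod (1 - ee (x e - x e'))" if "e \<in> P" "e' \<in> P - {e}" for e e'
    proof -
      let ?z = "ee (x e - x e')"
      have z: "?z \<noteq> 1" using x[of e e'] that by (auto simp: ee_eq_1_iff)
      have "?E e e' = (\<Sum>M=1..T. ?z ^ M)" by (simp only: ee_of_nat_mult)
      also have "(1 - ?z) * (\<Sum>M=1..T. ?z ^ M) = ?z - ?z ^ Suc T"
        by (rule geometric_sum_from_1)
      then have "(\<Sum>M=1..T. ?z ^ M) = (?z - ?z ^ Suc T) / (1 - ?z)" using z by (simp add: field_simps)
      finally have "cmod (?E e e') = cmod (?z - ?z ^ Suc T) / cmod (1 - ?z)" by (simp add: norm_divide)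
      also have "cmod (?z - ?z ^ Suc T) \<le> cmod ?z + cmod (?z ^ Suc T)" by (rule norm_triangle_ineq4)
      also have "\<dots> = 2" by (simp add: norm_mult norm_power)
      finally show ?thesis by (simp add: divide_right_mono)
    qed
    have "complex_of_real (\<Sum>M=1..T. (cmod (\<Sum>e\<in>P. of_real (s e) * ee (real M * x e)))\<^sup>2) =
        (\<Sum>M=1..T. \<Sum>e\<in>P. \<Sum>e'\<in>P. of_real (s e * s e') * ee (real M * (x e - x e')))"
    proof -
      have "of_real (s e) * ee (real M * x e) * cnj (of_real (s e') * ee (real M * x e')) = of_real (s e * s e') * ee (real M * (x e - x e'))" for M e e'
      proof -
        have "ee (real M * (x e - x e')) = ee (real M * x e) * cnj (ee (real M * x e'))"
          unfolding cnj_ee ee_add[symmetric] by (simp add: algebra_simps)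
        then show ?thesis by simp
      qed
      then show ?thesis by (simp only: of_real_sum complex_norm_square cnj_sum sum_product)
    qed
    also have "\<dots> = (\<Sum>e\<in>P. \<Sum>e'\<in>P. of_real (s e * s e') * ?E e e')"
      by (subst sum.swap, rule sum.cong[OF refl], subst sum.swap) (simp add: sum_distrib_left)
    also have "\<dots> = (\<Sum>e\<in>P. of_real (s e * s e) * ?E e e + (\<Sum>e'\<in>P - {e}. of_real (s e * s e') * ?E e e'))"
      using P by (intro sum.cong refl sum.remove) auto
    also have "\<dots> = of_nat (card P * T) + (\<Sum>e\<in>P. \<Sum>e'\<in>P - {e}. of_real (s e * s e') * ?E e e')"
    proof -
      have "s e * s e = 1" if "e \<in> P" for e using s[OF that] by (metis abs_mult_self_eq mult_1)
      then show ?thesis by (simp add: sum.distrib)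
    qed
    finally have eq: "complex_of_real ((\<Sum>M=1..T. (cmod (\<Sum>e\<in>P. of_real (s e) * ee (real M * x e)))\<^sup>2) - real (card P) * T) =
        (\<Sum>e\<in>P. \<Sum>e'\<in>P - {e}. of_real (s e * s e') * ?E e e')" by simp
    have "\<bar>(\<Sum>M=1..T. (cmod (\<Sum>e\<in>P. of_real (s e) * ee (real M * x e)))\<^sup>2) - real (card P) * T\<bar> \<le> ?C"
      unfolding norm_of_real[symmetric, where 'a=complex] eq
    proof (intro sum_norm_le)
      fix e e' assume "e \<in> P" "e' \<in> P - {e}"
      then show "norm (of_real (s e * s e') * ?E e e') \<le> 2 / cmod (1 - ee (x e - x e'))"
        using geo[of e e'] s by (simp add: norm_mult)
    qed
    then show ?thesis by linarith
  qed
  then show ?thesis by blast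
qed

section \<open>Hermite's identity\<close>

lemma sum_Suc_shift: "(\<Sum>j<M. h (Suc j)) = (\<Sum>j<M. h j) + h M - (h 0 :: 'a :: ab_group_add)"
  by (induction M) auto

text \<open>Raising \<open>n\<close> by one shifts the index by one; after telescoping, the end
  terms differ by \<open>(n + M) div M - n div M = 1\<close>.\<close>

lemma sum_div_shift: "M > 0 \<Longrightarrow> (\<Sum>j<M. (n + int j) div int M) = n"
proof (induction n rule: int_induct[where k=0])
  case base
  then show ?case by (intro sum.neutral) auto
next
  case (step1 i)
  have "(\<Sum>j<M. (i + 1 + int j) div int M) = (\<Sum>j<M. (i + int (Suc j)) div int M)" by (simp add: add_ac)
  also have "\<dots> = (\<Sum>j<M. (i + int j) div int M) + (i + int M) div int M - i div int M"
    by (subst sum_Suc_shift) simp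
  finally show ?case using step1 by simp
next
  case (step2 i)
  have "(\<Sum>j<M. (i + int j) div int M) = (\<Sum>j<M. (i - 1 + int (Suc j)) div int M)" by (simp add: add_ac)
  also have "\<dots> = (\<Sum>j<M. (i - 1 + int j) div int M) + (i - 1 + int M) div int M - (i - 1) div int M"
    by (subst sum_Suc_shift) simp
  finally show ?case using step2 by simp
qed

lemma hermite_identity:
  assumes "M > 0"
  shows "(\<Sum>j<M. \<lfloor>x + real j / real M\<rfloor>) = \<lfloor>real M * x\<rfloor>"
proof -
  have "\<lfloor>x + real j / real M\<rfloor> = (\<lfloor>real M * x\<rfloor> + int j) div int M" for j
  proof -
    have "x + real j / real M = (real M * x + of_int (int j)) / of_int (int M)"
      using assms by (simp add: field_simps)
    then show ?thesis by (simp only: floor_divide_real_eq_div of_nat_0_le_iff floor_add_int[symmetric])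
  qed
  then show ?thesis by (simp only: sum_div_shift[OF assms])
qed

section \<open>Superlevel sets of the folded indicator\<close>

definition fold_count :: "nat \<Rightarrow> (real \<Rightarrow> bool) \<Rightarrow> real \<Rightarrow> nat" where
  "fold_count M f t = card {j. j < M \<and> f ((t + real j) / real M)}"

lemma fold_count_eq_sum: "fold_count M f t = (\<Sum>j<M. of_bool (f ((t + real j) / real M)))"
proof -
  have "{..<M} \<inter> {j. f ((t + real j) / real M)} = {j. j < M \<and> f ((t + real j) / real M)}" by auto
  then show ?thesis by (simp add: fold_count_def of_bool_def sum.If_cases)
qed

lemma tame_fold_count:
  assumes "M > 0" "tame f"
  shows "tame (fold_count M f)"
    and "jump_at (fold_count M f) z \<Longrightarrow> \<exists>j<M. jump_at f ((z + real j) / real M)"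
proof -
  have eq: "fold_count M f = (\<lambda>t. card {j \<in> {..<M}. f ((t + real j) / real M)})"
    by (simp add: fold_count_def fun_eq_iff)
  have M: "real M > 0" using assms by simp
  have t: "tame (\<lambda>t. f ((t + real j) / real M))" for j by (rule tame_affine[OF M assms(2)])
  note fam = tame_family[of "{..<M}" "\<lambda>j t. f ((t + real j) / real M)", OF _ t]
  show "tame (fold_count M f)" unfolding eq by (rule tame_comp[OF fam(1)]) simp
  assume "jump_at (fold_count M f) z"
  then have "jump_at (\<lambda>t. {j \<in> {..<M}. f ((t + real j) / real M)}) z" unfolding eq by (rule jump_at_comp)
  then obtain j where "j < M" "jump_at (\<lambda>t. f ((t + real j) / real M)) z" using fam(2) by auto
  then show "\<exists>j<M. jump_at f ((z + real j) / real M)" using jump_at_affine[OF M] by blast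
qed

text \<open>Raising \<open>t\<close> by 1 shifts the preimages by one index, and index
  \<open>M\<close> agrees with index 0 up to a period of \<open>f\<close>.\<close>

lemma periodic_fold_count:
  assumes "M > 0" "periodic f"
  shows "periodic (fold_count M f)"
  unfolding periodic_def
proof
  fix t
  define h where "h = (\<lambda>j. of_bool (f ((t + real j) / real M)) :: int)"
  have "h M = h 0"
  proof -
    have "(t + real M) / real M = (t + real 0) / real M + 1" using assms(1) by (simp add: field_simps)
    then show ?thesis using assms(2) unfolding h_def periodic_def by simp
  qed
  have "int (fold_count M f (t + 1)) = (\<Sum>j<M. h (Suc j))"
    unfolding fold_count_eq_sum h_def by (simp add: add_ac)
  also have "\<dots> = (\<Sum>j<M. h j)" unfolding sum_Suc_shift \<open>h M = h 0\<close> by simp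
  also have "\<dots> = int (fold_count M f t)" unfolding fold_count_eq_sum h_def by simp
  finally show "fold_count M f (t + 1) = fold_count M f t" by simp
qed

text \<open>A jump of the count at \<open>z\<close> comes from a jump of \<open>f\<close> at some
  preimage \<open>(z + j) / M\<close>, and multiplication by \<open>M\<close> leads back to
  \<open>z\<close> modulo 1. Hence folding cannot increase the number of jumps, which makes
  induction on it possible.\<close>

lemma jumps_fold_count:
  assumes "M > 0" "tame f" "periodic f"
  shows "jumps (fold_count M f) \<subseteq> (\<lambda>e. frac (real M * e)) ` jumps f"
proof
  fix z assume "z \<in> jumps (fold_count M f)"
  then have z: "z \<in> {0..<1}" "jump_at (fold_count M f) z" by (auto simp: jumps_def)
  obtain j where j: "j < M" "jump_at f ((z + real j) / real M)" using tame_fold_count(2)[OF assms(1,2) z(2)] by auto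
  let ?e = "frac ((z + real j) / real M)"
  have "real M * ?e = z + of_int (int j - int M * \<lfloor>(z + real j) / real M\<rfloor>)"
    using assms(1) by (simp add: frac_def field_simps)
  then have "frac (real M * ?e) = frac z" by (simp only: frac_add_of_int_right)
  also have "\<dots> = z" using z(1) by (simp add: frac_eq)
  finally show "z \<in> (\<lambda>e. frac (real M * e)) ` jumps f"
    using j(2) jump_at_frac[OF assms(3)] by (metis image_eqI)
qed

lemma level_set_fold:
  "fold_level M {x \<in> {0..<1}. f x} r = {x \<in> {0..<1}. r < fold_count M f x}"
proof -
  have "(s + real j) / real M \<in> {0..<1}" if "s \<in> {0..<1}" "j < M" for s j
  proof -
    have "real j + 1 \<le> real M" using that by linarith
    then show ?thesis using that by (auto simp: divide_less_eq)
  qed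
  then have "{j. j < M \<and> (s + real j) / real M \<in> {x \<in> {0..<1}. f x}} = {j. j < M \<and> f ((s + real j) / real M)}"
    if "s \<in> {0..<1}" for s using that by blast
  then show ?thesis unfolding fold_level_def fold_count_def by auto
qed

section \<open>Fourier coefficients of sets with finitely many boundary points\<close>

lemma tame_level_borel:
  assumes "tame f" "periodic f" "finite (jumps f)"
  shows "{x \<in> {0..<1}. f x} \<in> sets borel"
proof -
  let ?c = "\<lambda>t. of_bool (f t) :: real"
  have "finite (jumps ?c)"
    by (rule finite_subset[OF _ assms(3)]) (auto simp: jumps_def intro: jump_at_comp)
  then obtain K where K: "\<And>t. ?c t = K + (\<Sum>e\<in>jumps ?c. (?c e - left_value ?c e) * of_int \<lfloor>t - e\<rfloor>)"
    using step_function_representation(1)[OF tame_comp[OF assms(1)] periodic_comp[OF assms(2)], of "\<lambda>b. of_bool b :: real"] by blast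
  then have eq: "?c = (\<lambda>t. K + (\<Sum>e\<in>jumps ?c. (?c e - left_value ?c e) * of_int \<lfloor>t - e\<rfloor>))" by (intro ext)
  have "(\<lambda>t. K + (\<Sum>e\<in>P. s e * of_int \<lfloor>t - e\<rfloor>)) \<in> borel_measurable borel" for P and s :: "real \<Rightarrow> real"
    by measurable
  from this[where P="jumps ?c" and s="\<lambda>e. ?c e - left_value ?c e"]
  have [measurable]: "?c \<in> borel_measurable borel" by (rule subst[OF eq[symmetric]])
  have "{x \<in> {0..<1}. f x} = {x \<in> space borel. 0 \<le> x \<and> x < 1 \<and> ?c x = 1}" by auto
  also have "\<dots> \<in> sets borel" by measurable
  finally show ?thesis .
qed

text \<open>On \<open>[0, 1)\<close> the floor \<open>\<lfloor>t - e\<rfloor>\<close> is minus the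
  indicator of \<open>[0, e)\<close>, whence the negative sign. For \<open>n \<noteq> 0\<close> the
  constant \<open>K\<close> is invisible, and the contributions of the common endpoint 0 cancel
  because the heights sum to 0. The floor representation is exported because it later identifies
  sets with two boundary points as arcs.\<close>

lemma ft_level_set:
  assumes f: "tame f" "periodic f" "finite (jumps f)"
  obtains s where "\<And>e. e \<in> jumps f \<Longrightarrow> s e = 1 \<or> s e = - 1" "(\<Sum>e\<in>jumps f. s e) = 0"
    "\<exists>K. \<forall>t. (of_bool (f t) :: real) = K + (\<Sum>e\<in>jumps f. s e * of_int \<lfloor>t - e\<rfloor>)"
    "\<And>n::int. n \<noteq> 0 \<Longrightarrow> ft (indicator {x \<in> {0..<1}. f x}) (of_int n) =
       - (\<Sum>e\<in>jumps f. of_real (s e) * ee (of_int n * e)) / (2 * pi * \<i> * of_int n)"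
proof -
  define c where "c = (\<lambda>t. of_bool (f t) :: real)"
  define s where "s = (\<lambda>e. c e - left_value c e)"
  have jumps: "jumps c = jumps f"
  proof -
    have "(\<lambda>t. c t = 1) = f" by (auto simp: c_def fun_eq_iff)
    then have "jump_at f z \<Longrightarrow> jump_at c z" for z using jump_at_comp[of "\<lambda>v. v = 1" c z] by simp
    moreover have "jump_at c z \<Longrightarrow> jump_at f z" for z unfolding c_def by (rule jump_at_comp)
    ultimately show ?thesis by (auto simp: jumps_def)
  qed
  have c: "tame c" "periodic c" "finite (jumps c)"
    using tame_comp[OF f(1)] periodic_comp[OF f(2)] f(3) unfolding jumps by (auto simp: c_def)
  obtain K where K: "\<And>t. c t = K + (\<Sum>e\<in>jumps f. s e * of_int \<lfloor>t - e\<rfloor>)"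
    using step_function_representation(1)[OF c] unfolding jumps s_def by blast
  have s0: "(\<Sum>e\<in>jumps f. s e) = 0"
    using step_function_representation(2)[OF c] unfolding jumps s_def .
  have s1: "s e = 1 \<or> s e = - 1" if "e \<in> jumps f" for e
  proof -
    have "\<exists>t. c t = left_value c e"
      using eventually_happens'[OF _ eventually_left_value[OF c(1), of e]] by auto
    then have "left_value c e = 0 \<or> left_value c e = 1" by (metis c_def of_bool_def)
    moreover have "left_value c e \<noteq> c e"
    proof
      assume "left_value c e = c e"
      then have "\<not> jump_at c e" using eventually_left_value[OF c(1), of e] by (simp add: jump_at_def)
      then show False using that unfolding jumps[symmetric] by (simp add: jumps_def)
    qed
    ultimately show ?thesis by (auto simp: s_def c_def)
  qed
  have ftn: "ft (indicator {x \<in> {0..<1}. f x}) (of_int n) =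
       - (\<Sum>e\<in>jumps f. of_real (s e) * ee (of_int n * e)) / (2 * pi * \<i> * of_int n)" if n: "n \<noteq> 0" for n :: int
  proof -
    have floor: "real_of_int \<lfloor>t - e\<rfloor> = - indicator {0..<e} t" if "t \<in> {0..<1}" "e \<in> {0..<1}" for t e :: real
    proof -
      have "\<lfloor>t - e\<rfloor> = (if t < e then - 1 else 0)"
        using that by (auto intro!: floor_unique)
      then show ?thesis using that by (simp add: indicator_def)
    qed
    have ind: "indicator {x \<in> {0..<1}. f x} t = (of_real K * (indicator {0..<1} t *\<^sub>R 1) + (\<Sum>e\<in>jumps f. of_real (- s e) * (indicator {0..<e} t *\<^sub>R 1)) :: complex)" for t
    proof (cases "t \<in> {0..<1}")
      case True
      have "indicator {x \<in> {0..<1}. f x} t = complex_of_real (c t)" using True by (simp add: c_def indicator_def)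
      also have "c t = K + (\<Sum>e\<in>jumps f. - s e * indicator {0..<e} t)"
        unfolding K using floor[OF True] by (intro arg_cong2[of _ _ _ _ "(+)"] refl sum.cong) (auto simp: jumps_def)
      finally show ?thesis using True by (simp add: scaleR_conv_of_real of_real_indicator)
    next
      case False
      then have "indicator {0..<e} t = (0 :: real)" if "e \<in> jumps f" for e using that by (auto simp: jumps_def indicator_def)
      moreover have "indicator {x \<in> {0..<1}. f x} t = (0 :: complex)" using False by (auto simp: indicator_def)
      ultimately show ?thesis using False by simp
    qed
    have int: "integrable lborel (\<lambda>t. indicator {0..<e} t *\<^sub>R ee (of_int n * t))" for e :: real
    proof (rule Bochner_Integration.integrable_bound)
      show "integrable lborel (indicator {0..<e} :: real \<Rightarrow> real)"
        by (intro integrable_real_indicator emeasure_bounded_finite) auto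
    qed (auto simp: indicator_def)
    have "ft (indicator {x \<in> {0..<1}. f x}) (of_int n) = (\<integral>t. of_real K * (indicator {0..<1} t *\<^sub>R ee (of_int n * t)) + (\<Sum>e\<in>jumps f. of_real (- s e) * (indicator {0..<e} t *\<^sub>R ee (of_int n * t))) \<partial>lborel)"
      unfolding ft_def ind by (intro Bochner_Integration.integral_cong refl) (simp add: distrib_right sum_distrib_right mult.assoc)
    also have "\<dots> = of_real K * (\<integral>t. indicator {0..<1} t *\<^sub>R ee (of_int n * t) \<partial>lborel) + (\<Sum>e\<in>jumps f. of_real (- s e) * (\<integral>t. indicator {0..<e} t *\<^sub>R ee (of_int n * t) \<partial>lborel))"
      by (subst Bochner_Integration.integral_add, (intro integrable_mult_right Bochner_Integration.integrable_sum int)+,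
          subst Bochner_Integration.integral_sum, (intro integrable_mult_right int)+, simp only: integral_mult_right_zero)
    also have "\<dots> = (\<Sum>e\<in>jumps f. of_real (- s e) * ((ee (of_int n * e) - 1) / (2 * pi * \<i> * of_int n)))"
    proof -
      have "(\<integral>t. indicator {0..<e} t *\<^sub>R ee (of_int n * t) \<partial>lborel) = (ee (of_int n * e) - 1) / (2 * pi * \<i> * of_int n)" if "e \<in> jumps f" for e
        using integral_ee[of 0 e "of_int n"] that n by (simp add: jumps_def)
      then show ?thesis using n by (simp add: integral_ee_unit)
    qed
    also have "\<dots> = (\<Sum>e\<in>jumps f. - (of_real (s e) * ee (of_int n * e)) + of_real (s e)) / (2 * pi * \<i> * of_int n)"
      unfolding sum_divide_distrib by (intro sum.cong refl) (simp add: algebra_simps)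
    also have "(\<Sum>e\<in>jumps f. - (of_real (s e) * ee (of_int n * e)) + of_real (s e)) = - (\<Sum>e\<in>jumps f. of_real (s e) * ee (of_int n * e)) + complex_of_real (\<Sum>e\<in>jumps f. s e)"
      by (simp add: sum.distrib sum_negf sum_subtractf)
    finally show ?thesis by (simp add: s0)
  qed
  show ?thesis
    by (rule that[of s]) (use s1 s0 K ftn in \<open>auto simp: c_def\<close>)
qed

text \<open>Row 0 of the folded indicator is the count divided by \<open>M\<close>. Centred at
  \<open>(r + 1/2) / M\<close> it has modulus \<open>1 / (2 * M)\<close> on the whole unit interval,
  while its coefficient at \<open>n \<noteq> 0\<close> is that of the set at \<open>n * M\<close>.
  Bessel's inequality over \<open>n = -2, -1, 1, 2\<close> compares the two.\<close>

lemma two_level_bound: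
  assumes f: "tame f" "periodic f" "finite (jumps f)" and M: "M > 0"
    and two: "\<And>t. fold_count M f t = r \<or> fold_count M f t = Suc r"
    and S: "\<And>n::int. n \<noteq> 0 \<Longrightarrow> ft (indicator {x \<in> {0..<1}. f x}) (of_int n) = - S n / (2 * pi * \<i> * of_int n)"
    and Sneg: "\<And>n. cmod (S (- n)) = cmod (S n)"
  shows "(cmod (S (int M)))\<^sup>2 + (cmod (S (2 * int M)))\<^sup>2 / 4 \<le> pi\<^sup>2 / 2"
proof -
  let ?A = "{x \<in> {0..<1}. f x}"
  let ?h = "fold_row M (indicator ?A) 0"
  have A: "?A \<in> sets borel" by (rule tame_level_borel[OF f])
  have g: "l2_on {0..<1} (indicator ?A :: real \<Rightarrow> complex)"
    by (rule l2_onI_dominated[where w="indicator {0..<1}"]) (use A in \<open>auto simp: indicator_def\<close>)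
  have row: "?h s = indicator {0..<1} s * of_real (real (fold_count M f s) / M)" for s
  proof (cases "s \<in> {0..<1}")
    case True
    have "(s + real j) / real M \<in> {0..<1}" if "j < M" for j
    proof -
      have "real j + 1 \<le> real M" using that by linarith
      then show ?thesis using True by (auto simp: divide_less_eq)
    qed
    then have "?h s = (\<Sum>j<M. of_real (1 / real M) * of_bool (f ((s + real j) / real M)))"
      unfolding fold_row_def using True by (intro sum.cong refl) (auto simp: indicator_def)
    also have "\<dots> = of_real (1 / real M) * (\<Sum>j<M. of_bool (f ((s + real j) / real M)))"
      by (rule sum_distrib_left[symmetric])
    also have "(\<Sum>j<M. of_bool (f ((s + real j) / real M)) :: complex) = of_real (real (fold_count M f s))"
      unfolding fold_count_eq_sum of_nat_sum of_real_sum by (intro sum.cong refl) simp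
    finally show ?thesis using True by simp
  qed (simp add: fold_row_def)
  \<comment> \<open>The midpoint of the two values: subtracting it equalizes the modulus and touches
    only the coefficient at frequency 0.\<close>
  define q where "q = trig_poly {0} (\<lambda>_. of_real ((real r + 1/2) / M))"
  have q: "q s = indicator {0..<1} s * of_real ((real r + 1/2) / M)" for s by (simp add: q_def trig_poly_def)
  let ?d = "\<lambda>s. ?h s + (-1) * q s"
  have lq: "l2_on {0..<1} q" unfolding q_def by (rule l2_on_trig_poly)
  have lh: "l2_on {0..<1} ?h" by (rule l2_on_fold_row[OF g M])
  have ld: "l2_on {0..<1} ?d" by (intro l2_on_add l2_on_cmult lh lq)
  have d_eq: "?d = (\<lambda>s. indicator {0..<1} s * ?d s)" using row q by (auto simp: fun_eq_iff indicator_def)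
  have en: "energy ?d \<le> (1 / (2 * real M))\<^sup>2"
  proof (subst d_eq, rule l2_on_unit(2))
    show "?d \<in> borel_measurable borel" using ld by (rule l2_on_measurable)
    fix x :: real assume "x \<in> {0..<1}"
    then have "?d x = of_real ((real (fold_count M f x) - real r - 1/2) / M)"
      unfolding row q by (simp add: diff_divide_distrib add_divide_distrib)
    moreover have "\<bar>real (fold_count M f x) - real r - 1/2\<bar> = 1/2" using two[of x] by auto
    ultimately have "cmod (?d x) = 1/2 / real M" by (simp only: norm_of_real abs_divide)
    then show "cmod (?d x) \<le> 1 / (2 * real M)" by simp
  qed
  define e where "e = (\<lambda>n::int. (cmod (ft ?d (of_int n)))\<^sup>2)"
  have sum_e: "(\<Sum>n\<in>{-2,-1,1,2}. e n) \<le> (1 / (2 * real M))\<^sup>2"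
    unfolding e_def
    by (rule order_trans[OF bessel_inequality[OF ld] en]) simp
  have E: "e n = (cmod (S (n * int M)))\<^sup>2 / (4 * pi\<^sup>2 * (real M)\<^sup>2 * (of_int n)\<^sup>2)" if "n \<noteq> 0" for n
  proof -
    have "ft ?d (of_int n) = ft ?h (of_int n) + (-1) * ft q (of_int n)"
      unfolding ft_cmult[symmetric] by (intro ft_add lh l2_on_cmult lq)
    also have "ft q (of_int n) = 0" unfolding q_def using that by (simp add: ft_trig_poly)
    also have "ft ?h (of_int n) = ft (indicator ?A) (of_int (n * int M))"
      using ft_fold_row[OF g M, of 0 n] by (simp add: mult.commute)
    also have "\<dots> = - S (n * int M) / (2 * pi * \<i> * of_int (n * int M))"
      using that M by (intro S) auto
    finally show ?thesis unfolding e_def by (simp add: norm_divide norm_mult power_divide power_mult_distrib mult_ac)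
  qed
  have "cmod (S (- (n * int M))) = cmod (S (n * int M))" for n by (rule Sneg)
  from this[of 1] this[of 2] have "cmod (S (- int M)) = cmod (S (int M))" "cmod (S (- (2 * int M))) = cmod (S (2 * int M))" by auto
  with sum_e have "2 * ((cmod (S (int M)))\<^sup>2 / (4 * pi\<^sup>2 * (real M)\<^sup>2)) + 2 * ((cmod (S (2 * int M)))\<^sup>2 / (4 * pi\<^sup>2 * (real M)\<^sup>2 * 4)) \<le> 1 / (4 * (real M)\<^sup>2)"
    by (simp add: E power_divide power_mult_distrib)
  then have "(real M)\<^sup>2 * (16 * (cmod (S (int M)))\<^sup>2 + 4 * (cmod (S (2 * int M)))\<^sup>2) \<le> (real M)\<^sup>2 * (8 * pi\<^sup>2)"
    using M by (simp add: field_simps)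
  then show ?thesis using M by (subst (asm) mult_le_cancel_left_pos) auto
qed

section \<open>Critical sets for arcs of any length\<close>

lemma critical_empty: "critical {} {}"
proof -
  have "energy g = 0" if "l2_on {} g" for g using that by (simp add: l2_on_def energy_def)
  then show ?thesis
    by (auto simp: critical_def sampling_def bounded_discrepancy_empty intro!: exI[of _ 0])
qed

lemma critical_unit: "critical {0..<1} UNIV"
proof -
  have "energy g \<le> 1 * sample_energy UNIV g" if g: "l2_on {0..<1} g" for g
  proof (rule field_le_epsilon)
    fix e :: real assume "e > 0"
    obtain N where N: "finite N" "energy g \<le> (\<Sum>n\<in>N. (cmod (ft g (of_int n)))\<^sup>2) + e"
      using parseval_approx[OF g \<open>e > 0\<close>] .
    then show "energy g \<le> 1 * sample_energy UNIV g + e"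
      using sum_le_sample_energy[OF g N(1), of UNIV] by simp
  qed
  then have "sampling {0..<1} UNIV" unfolding sampling_def by (intro exI[of _ 1]) auto
  moreover have "bounded_discrepancy UNIV 1"
    unfolding bounded_discrepancy_def by (intro exI[of _ 1]) auto
  ultimately show ?thesis by (simp add: critical_def)
qed

lemma small_multiple: "\<exists>M::nat. M > 0 \<and> frac (real M * \<alpha>) \<le> 1/10"
proof (cases "\<alpha> \<in> \<rat>")
  case True
  then obtain p q :: int where "q > 0" "\<alpha> = of_int p / of_int q" by (rule Rats_cases')
  then have "real (nat q) * \<alpha> = of_int p" by simp
  then show ?thesis using \<open>q > 0\<close> by (intro exI[of _ "nat q"]) simp
next
  case False
  \<comment> \<open>Target 1/20 with tolerance 1/20 puts the fractional part strictly between 0 and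
    1/10.\<close>
  obtain k :: nat where "k > 0" "\<bar>frac (real k * \<alpha>) - 1/20\<bar> < 1/20"
    using Kronecker_approx_1_explicit[OF False, of "1/20" "1/20"] by auto
  then show ?thesis by (intro exI[of _ k]) linarith
qed

text \<open>Writing the indicator of an arc as a difference of floors is what lets
  \<open>hermite_identity\<close> fold it.\<close>

lemma arc_floor:
  assumes "t \<in> {0..<1}" "0 \<le> a" "a < 1" "0 \<le> \<alpha>" "\<alpha> < 1"
  shows "\<lfloor>t - a\<rfloor> - \<lfloor>t - a - \<alpha>\<rfloor> = of_bool (t \<in> arc a \<alpha>)"
proof -
  have "\<lfloor>t - a\<rfloor> = (if t < a then - 1 else 0)" using assms by (auto intro!: floor_unique)
  moreover have "\<lfloor>t - a - \<alpha>\<rfloor> = (if t + 1 < a + \<alpha> then - 2 else if t < a + \<alpha> then - 1 else 0)"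
    using assms by (auto intro!: floor_unique)
  ultimately show ?thesis using assms by (auto simp: arc_def)
qed

lemma arc_borel: "arc a \<alpha> \<in> sets borel"
proof -
  have "arc a \<alpha> = {x \<in> space borel. 0 \<le> x \<and> x < 1 \<and> (a \<le> x \<and> x < a + \<alpha> \<or> x + 1 < a + \<alpha>)}"
    by (auto simp: arc_def)
  also have "\<dots> \<in> sets borel" by measurable
  finally show ?thesis .
qed

text \<open>By \<open>hermite_identity\<close> the fold count of an arc is the constant
  \<open>\<lfloor>M * \<alpha>\<rfloor>\<close> plus the indicator of an arc of length
  \<open>frac (M * \<alpha>)\<close>. Every superlevel set is thus the whole circle or empty, except
  one, which is that short arc.\<close>

lemma critical_arc_exists:
  assumes a: "0 \<le> a" "a < 1" and \<alpha>: "0 \<le> \<alpha>" "\<alpha> < 1"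
  shows "\<exists>\<Lambda>. critical (arc a \<alpha>) \<Lambda>"
proof -
  obtain M :: nat where M: "M > 0" "frac (real M * \<alpha>) \<le> 1/10" using small_multiple by blast
  define f where "f = (\<lambda>t. \<lfloor>t - a\<rfloor> - \<lfloor>t - a - \<alpha>\<rfloor> = 1)"
  have f01: "of_bool (f t) = \<lfloor>t - a\<rfloor> - \<lfloor>t - a - \<alpha>\<rfloor>" for t
  proof -
    have "\<lfloor>t - a\<rfloor> - \<lfloor>t - a - \<alpha>\<rfloor> = 0 \<or> \<lfloor>t - a\<rfloor> - \<lfloor>t - a - \<alpha>\<rfloor> = 1" using \<alpha> by linarith
    then show ?thesis by (auto simp: f_def)
  qed
  have arc: "arc a \<alpha> = {x \<in> {0..<1}. f x}"
    using arc_floor[OF _ a \<alpha>] by (auto simp: f_def arc_def)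
  define a' where "a' = frac (real M * a)"
  define \<beta> where "\<beta> = frac (real M * \<alpha>)"
  define k where "k = \<lfloor>real M * \<alpha>\<rfloor>"
  have a': "0 \<le> a'" "a' < 1" and \<beta>: "0 \<le> \<beta>" "\<beta> \<le> 1/10" and k: "k \<ge> 0"
    using M \<alpha> by (auto simp: a'_def \<beta>_def k_def frac_lt_1)
  have count: "int (fold_count M f t) = k + of_bool (t \<in> arc a' \<beta>)" if t: "t \<in> {0..<1}" for t
  proof -
    have "int (fold_count M f t) = (\<Sum>j<M. \<lfloor>(t + real j) / M - a\<rfloor> - \<lfloor>(t + real j) / M - a - \<alpha>\<rfloor>)"
      unfolding fold_count_eq_sum of_nat_sum f01[symmetric] by (intro sum.cong refl) simp
    also have "\<dots> = (\<Sum>j<M. \<lfloor>(t / M - a) + real j / real M\<rfloor>) - (\<Sum>j<M. \<lfloor>(t / M - a - \<alpha>) + real j / real M\<rfloor>)"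
      unfolding sum_subtractf by (simp add: add_divide_distrib algebra_simps)
    also have "\<dots> = \<lfloor>real M * (t / M - a)\<rfloor> - \<lfloor>real M * (t / M - a - \<alpha>)\<rfloor>"
      unfolding hermite_identity[OF M(1)] ..
    also have "real M * (t / M - a) = (t - a') + of_int (- \<lfloor>real M * a\<rfloor>)"
      using M(1) by (simp add: a'_def frac_def algebra_simps)
    also have "real M * (t / M - a - \<alpha>) = (t - a' - \<beta>) + of_int (- \<lfloor>real M * a\<rfloor> - k)"
      using M(1) by (simp add: a'_def \<beta>_def k_def frac_def algebra_simps)
    also have "\<lfloor>(t - a') + of_int (- \<lfloor>real M * a\<rfloor>)\<rfloor> - \<lfloor>(t - a' - \<beta>) + of_int (- \<lfloor>real M * a\<rfloor> - k)\<rfloor> =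
        k + (\<lfloor>t - a'\<rfloor> - \<lfloor>t - a' - \<beta>\<rfloor>)"
      by (simp only: floor_add_int[symmetric])
    also have "\<lfloor>t - a'\<rfloor> - \<lfloor>t - a' - \<beta>\<rfloor> = of_bool (t \<in> arc a' \<beta>)"
      using a' \<beta> t by (intro arc_floor) auto
    finally show ?thesis .
  qed
  have level: "\<exists>\<Lambda>. critical (fold_level M (arc a \<alpha>) r) \<Lambda>" for r
  proof -
    have eq: "fold_level M (arc a \<alpha>) r = {x \<in> {0..<1}. int r < k + of_bool (x \<in> arc a' \<beta>)}"
    proof -
      have "r < fold_count M f x \<longleftrightarrow> int r < k + of_bool (x \<in> arc a' \<beta>)" if "x \<in> {0..<1}" for x
        unfolding count[OF that, symmetric] by simp
      then show ?thesis unfolding arc level_set_fold by auto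
    qed
    consider "int r < k" | "int r = k" | "int r > k" by linarith
    then show ?thesis
    proof cases
      case 1
      then have "fold_level M (arc a \<alpha>) r = {0..<1}" unfolding eq by (auto simp: of_bool_def)
      then show ?thesis using critical_unit by auto
    next
      case 2
      then have *: "fold_level M (arc a \<alpha>) r = arc a' \<beta>" unfolding eq by (auto simp: arc_def)
      show ?thesis
      proof (cases "\<beta> = 0")
        case True
        then have "arc a' \<beta> = {}" using a' by (auto simp: arc_def)
        then show ?thesis using * critical_empty by auto
      next
        case False
        then show ?thesis using * critical_arc[OF a', of \<beta>] \<beta> by auto
      qed
    next
      case 3
      then have "fold_level M (arc a \<alpha>) r = {}" unfolding eq by auto
      then show ?thesis using critical_empty by auto
    qed
  qed
  then obtain \<Lambda> where "\<And>r. critical (fold_level M (arc a \<alpha>) r) (\<Lambda> r)" by metis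
  then have "critical (arc a \<alpha>) (\<Union>r<M. (\<lambda>l. int M * l + int r) ` \<Lambda> r)"
    by (intro critical_fold arc_borel M(1)) (auto simp: arc_def)
  then show ?thesis by blast
qed

text \<open>The hypothesis collapses the chain of cardinalities from the jumps of the superlevel set
  through those of the count and the image of \<open>jumps f\<close> back to
  \<open>card (jumps f)\<close>. So multiplication by \<open>M\<close> is injective on the jumps,
  only one preimage switches at a time, and every switch crosses level \<open>r\<close>: the count
  can only alternate between \<open>r\<close> and \<open>r + 1\<close>.\<close>

lemma unreduced_fold_two_levels:
  assumes f: "tame f" "periodic f" "finite (jumps f)" "jumps f \<noteq> {}" and M: "M > 0"
    and r: "card (jumps f) \<le> card (jumps (\<lambda>t. r < fold_count M f t))"
  shows "inj_on (\<lambda>e. frac (real M * e)) (jumps f)"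
    and "fold_count M f t = r \<or> fold_count M f t = Suc r"
proof -
  let ?c = "fold_count M f" and ?m = "\<lambda>e. frac (real M * e)"
  let ?b = "\<lambda>t. r < ?c t"
  have sub: "jumps ?b \<subseteq> jumps ?c" by (auto simp: jumps_def intro: jump_at_comp)
  have sub': "jumps ?c \<subseteq> ?m ` jumps f" by (rule jumps_fold_count[OF M f(1,2)])
  have fin: "finite (?m ` jumps f)" using f(3) by simp
  have "card (jumps ?b) \<le> card (?m ` jumps f)" using sub sub' fin by (intro card_mono) auto
  moreover have "card (?m ` jumps f) \<le> card (jumps f)" using f(3) by (rule card_image_le)
  ultimately have card: "card (?m ` jumps f) = card (jumps f)" "card (jumps ?b) = card (?m ` jumps f)" using r by auto
  then have eq: "jumps ?b = ?m ` jumps f" using sub sub' fin by (intro card_subset_eq) auto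
  show inj: "inj_on ?m (jumps f)" using card(1) f(3) by (intro eq_card_imp_inj_on) auto
  have tc: "tame ?c" by (rule tame_fold_count(1)[OF M f(1)])
  have pc: "periodic ?c" by (rule periodic_fold_count[OF M f(2)])
  have pb: "periodic ?b" by (rule periodic_comp[OF pc])
  \<comment> \<open>Two jumping preimages of \<open>z\<close> reduce to boundary points with the
    same image under multiplication by \<open>M\<close>; by injectivity these coincide, so the
    preimages differ by an integer.\<close>
  have unique: "j = j'" if "j < M" "j' < M" "jump_at f ((z + real j) / real M)" "jump_at f ((z + real j') / real M)" for z j j'
  proof -
    have fr: "?m (frac ((z + real i) / real M)) = frac z" for i
    proof -
      have "real M * frac ((z + real i) / real M) = z + of_int (int i - int M * \<lfloor>(z + real i) / real M\<rfloor>)"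
        using M by (simp add: frac_def field_simps)
      then show ?thesis by (simp only: frac_add_of_int_right)
    qed
    have "frac ((z + real j) / real M) \<in> jumps f" "frac ((z + real j') / real M) \<in> jumps f"
      using that(3,4) unfolding jump_at_frac[OF f(2)] .
    then have "frac ((z + real j) / real M) = frac ((z + real j') / real M)"
      by (rule inj_onD[OF inj, rotated]) (simp only: fr)
    moreover define I where "I = \<lfloor>(z + real j) / real M\<rfloor> - \<lfloor>(z + real j') / real M\<rfloor>"
    ultimately have "(z + real j) / real M - (z + real j') / real M = of_int I"
      by (simp add: frac_def)
    then have "(real j - real j') / real M = of_int I"
      by (simp add: add_divide_distrib diff_divide_distrib)
    then have "real_of_int (int j - int j') = real_of_int (I * int M)"
      using M by (simp add: nonzero_divide_eq_eq)
    then have "int j - int j' = I * int M" by (simp only: of_int_eq_iff)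
    then have "int j mod int M = int j' mod int M" by (simp add: mod_eq_dvd_iff)
    then show ?thesis using that by simp
  qed
  have jump: "(?c z = r \<and> left_value ?c z = Suc r) \<or> (?c z = Suc r \<and> left_value ?c z = r)" if jz: "jump_at ?c z" for z
  proof -
    have "jump_at ?b z"
      using that jump_at_frac[OF pc, of z] jump_at_frac[OF pb, of z] sub' eq by auto
    have ev: "\<forall>\<^sub>F t in at_left z. ?c t = left_value ?c z" by (rule eventually_left_value[OF tc])
    have ne: "(r < left_value ?c z) \<noteq> (r < ?c z)"
    proof
      assume "(r < left_value ?c z) = (r < ?c z)"
      with ev have "\<forall>\<^sub>F t in at_left z. ?b t = ?b z" by (auto elim: eventually_mono)
      then show False using \<open>jump_at ?b z\<close> by (simp add: jump_at_def)
    qed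
    obtain j0 where j0: "j0 < M" "jump_at f ((z + real j0) / real M)"
      using tame_fold_count(2)[OF M f(1) jz] by blast
    have "\<forall>\<^sub>F t in at_left z. \<forall>j\<in>{..<M} - {j0}. f ((t + real j) / real M) = f ((z + real j) / real M)"
    proof (intro eventually_ball_finite ballI)
      fix j assume "j \<in> {..<M} - {j0}"
      then have "\<not> jump_at f ((z + real j) / real M)" using unique[OF j0(1) _ j0(2)] by auto
      then show "\<forall>\<^sub>F t in at_left z. f ((t + real j) / real M) = f ((z + real j) / real M)"
        using jump_at_affine[of "real M" f "real j" z] M by (auto simp: jump_at_def)
    qed auto
    with ev have "\<forall>\<^sub>F t in at_left z. ?c t = left_value ?c z \<and> (\<forall>j\<in>{..<M} - {j0}. f ((t + real j) / real M) = f ((z + real j) / real M))"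
      by (rule eventually_conj)
    then obtain t where t: "?c t = left_value ?c z" "\<And>j. j \<in> {..<M} - {j0} \<Longrightarrow> f ((t + real j) / real M) = f ((z + real j) / real M)"
      using eventually_happens'[of "at_left z"] by force
    have split: "?c x = of_bool (f ((x + real j0) / real M)) + (\<Sum>j\<in>{..<M} - {j0}. of_bool (f ((x + real j) / real M)))" for x
      unfolding fold_count_eq_sum using j0(1) by (intro sum.remove) auto
    have "(\<Sum>j\<in>{..<M} - {j0}. of_bool (f ((t + real j) / real M)) :: nat) = (\<Sum>j\<in>{..<M} - {j0}. of_bool (f ((z + real j) / real M)))"
      using t(2) by (intro sum.cong refl) simp
    then have "left_value ?c z \<le> ?c z + 1" "?c z \<le> left_value ?c z + 1"
      unfolding t(1)[symmetric] split[of t] split[of z] by auto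
    then show ?thesis using ne by linarith
  qed
  \<comment> \<open>Being one of the two values is locally constant, even across jumps, so
    connectedness spreads it from a single jump to the whole line.\<close>
  let ?Q = "\<lambda>t. ?c t = r \<or> ?c t = Suc r"
  have loc: "\<forall>\<^sub>F t in at z. ?Q z = ?Q t" for z
  proof -
    have "\<forall>\<^sub>F t in at_right z. ?Q z = ?Q t"
      using tame_right[OF tc, of z] by eventually_elim simp
    moreover have "\<forall>\<^sub>F t in at_left z. ?Q z = ?Q t"
      using eventually_left_value[OF tc, of z]
    proof eventually_elim
      case (elim t)
      show ?case
      proof (cases "jump_at ?c z")
        case True then show ?thesis using jump[OF True] elim by auto
      next
        case False
        then have "left_value ?c z = ?c z"
          using left_value_unique[OF eventually_left_value[OF tc]] by (simp add: jump_at_def)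
        then show ?thesis using elim by simp
      qed
    qed
    ultimately show ?thesis by (simp add: eventually_at_split)
  qed
  have "jumps ?c \<noteq> {}" using f(4) eq sub by auto
  then obtain z where "jump_at ?c z" by (auto simp: jumps_def)
  then have "?Q z" using jump by auto
  moreover have "?Q z = ?Q t"
    by (rule connected_local_const[of UNIV _ _ ?Q]) (use loc in auto)
  ultimately show "?Q t" by simp
qed

lemma unreducible_card_jumps:
  assumes f: "tame f" "periodic f" "finite (jumps f)"
    and bad: "\<And>M. M > 0 \<Longrightarrow> \<exists>r. card (jumps f) \<le> card (jumps (\<lambda>t. r < fold_count M f t))"
  shows "card (jumps f) < 4"
proof (cases "jumps f = {}")
  case False
  let ?P = "jumps f"
  obtain s where s: "\<And>e. e \<in> jumps f \<Longrightarrow> s e = 1 \<or> s e = - 1" "(\<Sum>e\<in>jumps f. s e) = 0"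
    "\<exists>K. \<forall>t. (of_bool (f t) :: real) = K + (\<Sum>e\<in>jumps f. s e * of_int \<lfloor>t - e\<rfloor>)"
    "\<And>n::int. n \<noteq> 0 \<Longrightarrow> ft (indicator {x \<in> {0..<1}. f x}) (of_int n) =
       - (\<Sum>e\<in>jumps f. of_real (s e) * ee (of_int n * e)) / (2 * pi * \<i> * of_int n)"
    by (rule ft_level_set[OF f]) (rule that; assumption)
  define S where "S = (\<lambda>n::int. \<Sum>e\<in>?P. of_real (s e) * ee (of_int n * e))"
  have inj: "inj_on (\<lambda>e. frac (real M * e)) ?P" if "M > 0" for M
    using bad[OF that] unreduced_fold_two_levels(1)[OF f False that] by blast
  have Sneg: "cmod (S (- n)) = cmod (S n)" for n
  proof -
    have "S (- n) = cnj (S n)" unfolding S_def by (simp add: cnj_ee)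
    then show ?thesis by simp
  qed
  have bound: "(cmod (S (int M)))\<^sup>2 + (cmod (S (2 * int M)))\<^sup>2 / 4 \<le> pi\<^sup>2 / 2" if M: "M > 0" for M
  proof -
    obtain r where r: "card ?P \<le> card (jumps (\<lambda>t. r < fold_count M f t))" using bad[OF M] by blast
    show ?thesis
      by (rule two_level_bound[OF f M unreduced_fold_two_levels(2)[OF f False M r]])
        (use s(4) Sneg in \<open>auto simp: S_def\<close>)
  qed
  have nonint: "real k * e - real k * e' \<notin> \<int>" if "k > 0" "e \<in> ?P" "e' \<in> ?P" "e \<noteq> e'" for k e e'
  proof
    assume "real k * e - real k * e' \<in> \<int>"
    then obtain i where "real k * e = real k * e' + of_int i" by (auto elim!: Ints_cases simp: algebra_simps)
    then have "frac (real k * e) = frac (real k * e')" by (simp only: frac_add_of_int_right)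
    then show False using inj_onD[OF inj[OF that(1)]] that by blast
  qed
  have abs: "\<bar>s e\<bar> = 1" if "e \<in> ?P" for e using s(1)[OF that] by auto
  obtain C1 where C1: "\<And>T::nat. real (card ?P) * T - C1 \<le> (\<Sum>M=1..T. (cmod (\<Sum>e\<in>?P. of_real (s e) * ee (real M * (real 1 * e))))\<^sup>2)"
    using mean_square_lower_bound[OF f(3), where s=s and x="\<lambda>e. real 1 * e"] abs nonint[of 1] by auto
  \<comment> \<open>The frequencies \<open>2 * M\<close> are read as \<open>M\<close> acting on the
    points \<open>2 * e\<close>, which stay distinct modulo 1 because multiplication by 2 is
    injective on the boundary points as well.\<close>
  obtain C2 where C2: "\<And>T::nat. real (card ?P) * T - C2 \<le> (\<Sum>M=1..T. (cmod (\<Sum>e\<in>?P. of_real (s e) * ee (real M * (real 2 * e))))\<^sup>2)"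
    using mean_square_lower_bound[OF f(3), where s=s and x="\<lambda>e. real 2 * e"] abs nonint[of 2] by auto
  \<comment> \<open>Any constant strictly between \<open>pi^2 / 2\<close> and 5 would do: what
    counts is \<open>4.95 < (5/4) * 4\<close>.\<close>
  have key: "(5/4) * real (card ?P) * T - (C1 + C2 / 4) \<le> 4.95 * T" for T :: nat
  proof -
    have "real (card ?P) * T - C1 \<le> (\<Sum>M=1..T. (cmod (S (int M)))\<^sup>2)"
      using C1[of T] by (simp add: S_def)
    moreover have "real (card ?P) * T - C2 \<le> (\<Sum>M=1..T. (cmod (S (2 * int M)))\<^sup>2)"
      using C2[of T] by (simp add: S_def mult_ac)
    ultimately have "real (card ?P) * T - C1 + (real (card ?P) * T - C2) / 4 \<le>
        (\<Sum>M=1..T. (cmod (S (int M)))\<^sup>2) + (\<Sum>M=1..T. (cmod (S (2 * int M)))\<^sup>2) / 4"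
      by (intro add_mono divide_right_mono) auto
    also have "\<dots> = (\<Sum>M=1..T. (cmod (S (int M)))\<^sup>2 + (cmod (S (2 * int M)))\<^sup>2 / 4)"
      by (simp add: sum.distrib sum_divide_distrib)
    also have "\<dots> \<le> (\<Sum>M=1..T. pi\<^sup>2 / 2)" by (intro sum_mono bound) auto
    also have "\<dots> \<le> (\<Sum>M=1..T. 4.95)"
    proof (intro sum_mono)
      have "pi * pi \<le> 3.1416 * 3.1416" using pi_approx by (intro mult_mono) auto
      then show "pi\<^sup>2 / 2 \<le> 4.95" by (simp add: power2_eq_square)
    qed
    finally have "real (card ?P) * T - C1 + (real (card ?P) * T - C2) / 4 \<le> 4.95 * T" by simp
    moreover have "real (card ?P) * T - C1 + (real (card ?P) * T - C2) / 4 = (5/4) * real (card ?P) * T - (C1 + C2 / 4)"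
      by (simp add: field_simps)
    ultimately show ?thesis by simp
  qed
  show ?thesis
  proof (rule ccontr)
    assume "\<not> card ?P < 4"
    then have "real (card ?P) \<ge> 4" by simp
    \<comment> \<open>With at least four jumps, \<open>key\<close> would give
      \<open>0.05 * T \<le> C1 + C2 / 4\<close>.\<close>
    obtain T :: nat where T: "real T > 20 * (C1 + C2 / 4)" using reals_Archimedean2 by blast
    have "(5/4) * 4 * real T \<le> (5/4) * real (card ?P) * T"
      using \<open>real (card ?P) \<ge> 4\<close> by (intro mult_right_mono) auto
    then show False using key[of T] T by simp
  qed
qed simp

theorem tame_critical:
  assumes "tame f" "periodic f" "finite (jumps f)"
  shows "\<exists>\<Lambda>. critical {x \<in> {0..<1}. f x} \<Lambda>"
  using assms
proof (induction "card (jumps f)" arbitrary: f rule: less_induct)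
  case less
  note f = less.prems
  show ?case
  proof (cases "\<exists>M>0. \<forall>r. card (jumps (\<lambda>t. r < fold_count M f t)) < card (jumps f)")
    case True
    then obtain M where M: "M > 0" "\<And>r. card (jumps (\<lambda>t. r < fold_count M f t)) < card (jumps f)" by blast
    have "\<exists>\<Lambda>. critical {x \<in> {0..<1}. r < fold_count M f x} \<Lambda>" for r
    proof (rule less.hyps[OF M(2)])
      show "tame (\<lambda>t. r < fold_count M f t)" by (rule tame_comp[OF tame_fold_count(1)[OF M(1) f(1)]])
      show "periodic (\<lambda>t. r < fold_count M f t)" by (rule periodic_comp[OF periodic_fold_count[OF M(1) f(2)]])
      have "jumps (\<lambda>t. r < fold_count M f t) \<subseteq> jumps (fold_count M f)" by (auto simp: jumps_def intro: jump_at_comp)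
      also note jumps_fold_count[OF M(1) f(1,2)]
      finally show "finite (jumps (\<lambda>t. r < fold_count M f t))" by (rule finite_subset) (use f(3) in simp)
    qed
    then obtain \<Lambda> where "\<And>r. critical {x \<in> {0..<1}. r < fold_count M f x} (\<Lambda> r)" by metis
    then have "critical {x \<in> {0..<1}. f x} (\<Union>r<M. (\<lambda>l. int M * l + int r) ` \<Lambda> r)"
      by (intro critical_fold tame_level_borel f M(1)) (auto simp only: level_set_fold)
    then show ?thesis by blast
  next
    case False
    then have m4: "card (jumps f) < 4"
      by (intro unreducible_card_jumps f) (meson not_less)
    obtain s where s: "\<And>e. e \<in> jumps f \<Longrightarrow> s e = 1 \<or> s e = - 1" "(\<Sum>e\<in>jumps f. s e) = 0"
      and "\<exists>K. \<forall>t. (of_bool (f t) :: real) = K + (\<Sum>e\<in>jumps f. s e * of_int \<lfloor>t - e\<rfloor>)"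
      by (rule ft_level_set[OF f]) (rule that; assumption)
    then obtain K where K: "\<And>t. (of_bool (f t) :: real) = K + (\<Sum>e\<in>jumps f. s e * of_int \<lfloor>t - e\<rfloor>)"
      by blast
    show ?thesis
    proof (cases "jumps f = {}")
      case True
      then have "of_bool (f t) = (of_bool (f 0) :: real)" for t using K by simp
      then have "f t = f 0" for t by (metis of_bool_eq_iff)
      then have "{x \<in> {0..<1}. f x} = {0..<1} \<or> {x \<in> {0..<1}. f x} = {}" by auto
      then show ?thesis using critical_unit critical_empty by metis
    next
      case False
      let ?p = "{e \<in> jumps f. s e = 1}" and ?n = "{e \<in> jumps f. s e = - 1}"
      have un: "jumps f = ?p \<union> ?n" "?p \<inter> ?n = {}" using s(1) by auto
      have fin: "finite ?p" "finite ?n" using f(3) by auto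
      have "(\<Sum>e\<in>jumps f. s e) = (\<Sum>e\<in>?p. s e) + (\<Sum>e\<in>?n. s e)"
        by (subst un(1), rule sum.union_disjoint) (use fin un in auto)
      \<comment> \<open>The heights sum to 0, so upward and downward jumps are equally many; fewer
        than four in total leaves one of each.\<close>
      then have "card ?p = card ?n" using s(2) by simp
      moreover have "card (jumps f) = card ?p + card ?n" by (subst un(1), rule card_Un_disjoint) (use fin un in auto)
      moreover have "card (jumps f) > 0" using False f(3) by (simp add: card_gt_0_iff)
      ultimately have "card ?p = 1" "card ?n = 1" using m4 by linarith+
      then obtain a b where ab: "?p = {a}" "?n = {b}" by (meson card_1_singletonE)
      then have J: "jumps f = {a, b}" "a \<noteq> b" "s a = 1" "s b = - 1" using un by auto
      then have a: "0 \<le> a" "a < 1" and b: "0 \<le> b" "b < 1" by (auto simp: jumps_def)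
      \<comment> \<open>\<open>a\<close> is the upward and \<open>b\<close> the downward jump. If
        \<open>b\<close> comes first, the arc runs through 1 and one turn is added to its length,
        for which \<open>K'\<close> compensates.\<close>
      define \<alpha> where "\<alpha> = (if a < b then b - a else b - a + 1)"
      have \<alpha>: "0 < \<alpha>" "\<alpha> < 1" using a b J(2) by (auto simp: \<alpha>_def)
      define K' where "K' = K + (if a < b then 0 else - 1)"
      have rep: "of_bool (f t) = K' + of_int (\<lfloor>t - a\<rfloor> - \<lfloor>t - a - \<alpha>\<rfloor>)" for t
      proof -
        have "\<lfloor>t - b\<rfloor> = \<lfloor>t - a - \<alpha>\<rfloor> + (if a < b then 0 else 1)"
        proof (cases "a < b")
          case False
          then have "t - b = (t - a - \<alpha>) + of_int 1" by (simp add: \<alpha>_def)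
          then show ?thesis using False by (simp only: floor_add_int[symmetric]) simp
        qed (simp add: \<alpha>_def)
        then show ?thesis using K[of t] J by (simp add: K'_def)
      qed
      \<comment> \<open>Evaluation at the start of the arc and just past it: \<open>K' + 1\<close>
        and \<open>K'\<close> are both 0 or 1, which forces \<open>K' = 0\<close>.\<close>
      have "\<lfloor>a - a - \<alpha>\<rfloor> = - 1" "\<lfloor>a + \<alpha> - a\<rfloor> = 0" using \<alpha> by (auto intro!: floor_unique)
      then have "of_bool (f a) = K' + 1" "of_bool (f (a + \<alpha>)) = K'"
        using rep[of a] rep[of "a + \<alpha>"] by simp_all
      then have "K' = 0" by (cases "f a"; cases "f (a + \<alpha>)") auto
      then have "f t \<longleftrightarrow> t \<in> arc a \<alpha>" if "t \<in> {0..<1}" for t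
        using rep[of t] arc_floor[OF that a, of \<alpha>] \<alpha> by (auto simp: of_bool_def split: if_splits)
      then have "{x \<in> {0..<1}. f x} = arc a \<alpha>" by (auto simp: arc_def)
      then show ?thesis using critical_arc_exists[OF a, of \<alpha>] \<alpha> by auto
    qed
  qed
qed

section \<open>Reduction of the graph problem to scalar sampling\<close>

definition pivots :: "(nat \<Rightarrow> 'a :: euclidean_space) \<Rightarrow> nat \<Rightarrow> nat set" where
  "pivots x N = {n. n < N \<and> x n \<notin> span (x ` {..<n})}"

lemma card_pivots: "card (pivots x N) = dim (x ` {..<N})"
proof (induction N)
  case (Suc N)
  have fin: "finite (pivots x N)" by (simp add: pivots_def)
  have "x ` {..<Suc N} = insert (x N) (x ` {..<N})" by (simp add: lessThan_Suc)
  moreover have "pivots x (Suc N) = (if x N \<in> span (x ` {..<N}) then pivots x N else insert N (pivots x N))"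
    by (auto simp: pivots_def less_Suc_eq)
  moreover have "N \<notin> pivots x N" by (simp add: pivots_def)
  ultimately show ?case using Suc fin by (simp add: dim_insert)
qed (simp add: pivots_def)

lemma span_image_lessThan:
  fixes x :: "nat \<Rightarrow> 'a :: real_vector"
  assumes "y \<in> span (x ` {..<n})"
  shows "\<exists>c. y = (\<Sum>q<n. c q *\<^sub>R x q)"
  using assms
proof (induction n arbitrary: y)
  case (Suc n)
  have "x ` {..<Suc n} = insert (x n) (x ` {..<n})" by (simp add: lessThan_Suc)
  then obtain k where "y - k *\<^sub>R x n \<in> span (x ` {..<n})"
    using Suc.prems by (auto simp: span_breakdown_eq)
  then obtain c where "y - k *\<^sub>R x n = (\<Sum>q<n. c q *\<^sub>R x q)" using Suc.IH by blast
  then have "y = (\<Sum>q<n. c q *\<^sub>R x q) + k *\<^sub>R x n" by (simp add: algebra_simps)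
  then have "y = (\<Sum>q<Suc n. (c(n := k)) q *\<^sub>R x q)" by simp
  then show ?case by blast
qed simp

text \<open>Components outside \<open>J\<close> are set to 0 rather than removed, so that the rows
  for different \<open>J\<close> live in one space and can be compared.\<close>

definition restricted_row :: "('i::finite \<Rightarrow> 'v \<Rightarrow> real) \<Rightarrow> 'i set \<Rightarrow> 'v \<Rightarrow> real ^ 'i" where
  "restricted_row u J v = (\<chi> i. if i \<in> J then u i v else 0)"

text \<open>Since the eigenvectors are orthonormal over the vertices, weighting the rows by
  \<open>u i\<close> recovers the unit vector of \<open>i\<close> for each \<open>i\<close> in
  \<open>J\<close>; hence the rows span exactly the coordinates in \<open>J\<close>.\<close>

lemma dim_restricted_rows:
  fixes u :: "'i::finite \<Rightarrow> 'v::finite \<Rightarrow> real"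
  assumes orth: "\<And>i k. (\<Sum>v\<in>UNIV. u i v * u k v) = (if i = k then 1 else 0)"
  shows "dim (range (restricted_row u J)) = card J"
proof -
  let ?B = "(\<lambda>i. axis i (1::real)) ` J"
  have "restricted_row u J v \<in> span ?B" for v
  proof -
    have "restricted_row u J v = (\<Sum>i\<in>J. u i v *\<^sub>R axis i 1)"
      by (simp add: vec_eq_iff restricted_row_def axis_def if_distrib cong: if_cong)
    then show ?thesis by (auto intro!: span_sum span_scale intro: span_base)
  qed
  moreover have "axis i 1 \<in> span (range (restricted_row u J))" if "i \<in> J" for i
  proof -
    have "axis i 1 = (\<Sum>v\<in>UNIV. u i v *\<^sub>R restricted_row u J v)"
      unfolding vec_eq_iff
    proof
      fix k
      show "axis i 1 $ k = (\<Sum>v\<in>UNIV. u i v *\<^sub>R restricted_row u J v) $ k"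
      proof (cases "k \<in> J")
        case True
        then show ?thesis using orth[of i k] by (simp add: restricted_row_def axis_def)
      next
        case False
        then show ?thesis using that by (auto simp: restricted_row_def axis_def)
      qed
    qed
    then show ?thesis by (auto intro!: span_sum span_scale intro: span_base)
  qed
  ultimately have "span (range (restricted_row u J)) = span ?B"
    by (intro span_eq[THEN iffD2]) auto
  then have "dim (range (restricted_row u J)) = dim ?B" by (metis dim_span)
  also have "\<dots> = card ?B"
    by (intro dim_eq_card_independent independent_mono[OF independent_Basis]) (auto simp: axis_in_Basis_iff)
  also have "\<dots> = card J" by (intro card_image) (auto simp: inj_on_def axis_eq_axis)
  finally show ?thesis .
qed

section \<open>Spectra as step functions\<close>

lemma tame_floor: "tame (\<lambda>t. \<lfloor>t - e\<rfloor>)"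
  unfolding tame_def using eventually_floor_right eventually_floor_left by blast

lemma jump_at_floor: "jump_at (\<lambda>t. \<lfloor>t - e\<rfloor>) z \<Longrightarrow> z - e \<in> \<int>"
  using eventually_floor_left[of e z] unfolding jump_at_def by (auto split: if_splits)

lemma tame_Pair:
  assumes "tame f" "tame g"
  shows "tame (\<lambda>t. (f t, g t))" and "jump_at (\<lambda>t. (f t, g t)) z \<Longrightarrow> jump_at f z \<or> jump_at g z"
proof -
  show "tame (\<lambda>t. (f t, g t))"
    unfolding tame_def
  proof (intro allI conjI)
    fix z
    show "\<forall>\<^sub>F t in at_right z. (f t, g t) = (f z, g z)"
      using tame_right[OF assms(1), of z] tame_right[OF assms(2), of z] by eventually_elim simp
    show "\<exists>v. \<forall>\<^sub>F t in at_left z. (f t, g t) = v"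
    proof
      show "\<forall>\<^sub>F t in at_left z. (f t, g t) = (left_value f z, left_value g z)"
        using eventually_left_value[OF assms(1), of z] eventually_left_value[OF assms(2), of z] by eventually_elim simp
    qed
  qed
  show "jump_at f z \<or> jump_at g z" if j: "jump_at (\<lambda>t. (f t, g t)) z"
  proof (rule ccontr)
    assume "\<not> (jump_at f z \<or> jump_at g z)"
    then have "\<forall>\<^sub>F t in at_left z. f t = f z" "\<forall>\<^sub>F t in at_left z. g t = g z" by (auto simp: jump_at_def)
    then have "\<forall>\<^sub>F t in at_left z. (f t, g t) = (f z, g z)" by eventually_elim simp
    then show False using j by (simp add: jump_at_def)
  qed
qed

text \<open>Whether \<open>frac t\<close> lies in \<open>[a, b)\<close> can be read off the floors
  of \<open>t\<close>, \<open>t - a\<close> and \<open>t - b\<close>, so jumps can occur only at 0,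
  \<open>a\<close> and \<open>b\<close> modulo 1.\<close>

lemma tame_frac_interval:
  assumes "0 \<le> a" "a \<le> 1" "0 \<le> b" "b \<le> 1"
  shows "tame (\<lambda>t. a \<le> frac t \<and> frac t < b)" "finite (jumps (\<lambda>t. a \<le> frac t \<and> frac t < b))"
proof -
  let ?f = "\<lambda>t. (\<lfloor>t - 0\<rfloor>, \<lfloor>t - a\<rfloor>, \<lfloor>t - b\<rfloor>)" and ?\<phi> = "\<lambda>(k::int, l::int, m). l = k \<and> m < k"
  have tab: "tame (\<lambda>t. (\<lfloor>t - a\<rfloor>, \<lfloor>t - b\<rfloor>))" by (rule tame_Pair(1)[OF tame_floor tame_floor])
  have eq: "(\<lambda>t. a \<le> frac t \<and> frac t < b) = (\<lambda>t. ?\<phi> (?f t))"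
  proof
    fix t
    have "a \<le> frac t \<longleftrightarrow> \<lfloor>t - a\<rfloor> = \<lfloor>t\<rfloor>" using assms unfolding frac_def by linarith
    moreover have "frac t < b \<longleftrightarrow> \<lfloor>t - b\<rfloor> < \<lfloor>t\<rfloor>" using assms unfolding frac_def by linarith
    ultimately show "(a \<le> frac t \<and> frac t < b) = ?\<phi> (?f t)" by simp
  qed
  show "tame (\<lambda>t. a \<le> frac t \<and> frac t < b)"
    unfolding eq by (rule tame_comp[OF tame_Pair(1)[OF tame_floor tab]])
  have "jumps (\<lambda>t. ?\<phi> (?f t)) \<subseteq> {frac 0, frac a, frac b}"
  proof
    fix z assume "z \<in> jumps (\<lambda>t. ?\<phi> (?f t))"
    then have z: "0 \<le> z" "z < 1" "jump_at (\<lambda>t. ?\<phi> (?f t)) z" by (auto simp: jumps_def)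
    have "jump_at ?f z" by (rule jump_at_comp[where \<phi>="?\<phi>" and f="?f", OF z(3)])
    from tame_Pair(2)[OF tame_floor tab this]
    have "z - 0 \<in> \<int> \<or> z - a \<in> \<int> \<or> z - b \<in> \<int>"
    proof
      assume "jump_at (\<lambda>t. (\<lfloor>t - a\<rfloor>, \<lfloor>t - b\<rfloor>)) z"
      from tame_Pair(2)[OF tame_floor tame_floor this] show ?thesis
        using jump_at_floor[of a z] jump_at_floor[of b z] by auto
    qed (use jump_at_floor[of 0 z] in auto)
    moreover have "z = frac e" if ze: "z - e \<in> \<int>" for e
    proof -
      obtain k where "z - e = of_int k" using ze by (auto elim: Ints_cases)
      then have "z = e + of_int k" by simp
      then have "frac z = frac e" by (simp only: frac_add_of_int_right)
      then show ?thesis using z by (simp add: frac_eq)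
    qed
    ultimately show "z \<in> {frac 0, frac a, frac b}" by blast
  qed
  then show "finite (jumps (\<lambda>t. a \<le> frac t \<and> frac t < b))"
    unfolding eq by (rule finite_subset) simp
qed

lemma interval_half_open_approx:
  fixes I :: "real set"
  assumes "is_interval I" "bounded I" "I \<noteq> {}"
  shows "I - {Inf I..<Sup I} \<subseteq> {Inf I, Sup I}" "{Inf I..<Sup I} - I \<subseteq> {Inf I, Sup I}"
proof -
  have bdd: "bdd_below I" "bdd_above I" using assms(2) bounded_imp_bdd_below bounded_imp_bdd_above by auto
  show "I - {Inf I..<Sup I} \<subseteq> {Inf I, Sup I}"
    using cInf_lower[OF _ bdd(1)] cSup_upper[OF _ bdd(2)] by force
  have "x \<in> I" if lo: "Inf I < x" and hi: "x < Sup I" for x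
  proof -
    obtain y where "y \<in> I" "y < x" using cInf_lessD[OF assms(3) lo] by blast
    moreover obtain z where "z \<in> I" "x < z" using less_cSupD[OF assms(3) hi] by blast
    ultimately show ?thesis using assms(1) by (meson mem_is_interval_1_I less_imp_le)
  qed
  then show "{Inf I..<Sup I} - I \<subseteq> {Inf I, Sup I}" by force
qed

text \<open>Step functions that are constant to the right call for half-open pieces. Passing to them
  moves only finitely many points, hence neither samples nor measures change, and an empty spectrum
  stays empty, as the count of active components demands.\<close>

lemma finite_union_intervals_half_open:
  assumes "finite_union_intervals F"
  shows "\<exists>D. finite D \<and> (\<forall>(a, b)\<in>D. - 1/2 \<le> a \<and> a \<le> 1/2 \<and> - 1/2 \<le> b \<and> b \<le> 1/2) \<and>
    finite (F - (\<Union>(a, b)\<in>D. {a..<b})) \<and> finite ((\<Union>(a, b)\<in>D. {a..<b}) - F) \<and> (F = {} \<longrightarrow> D = {})"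
proof -
  obtain \<I> where \<I>: "finite \<I>" "\<And>I. I \<in> \<I> \<Longrightarrow> is_interval I \<and> bounded I" "F = \<Union>\<I>" and F: "F \<subseteq> {-1/2..<1/2}"
    using assms unfolding finite_union_intervals_def by blast
  \<comment> \<open>Empty members are discarded because their \<open>Inf\<close> and
    \<open>Sup\<close> carry no meaning and could produce spurious pairs.\<close>
  define \<J> where "\<J> = {I \<in> \<I>. I \<noteq> {}}"
  define D where "D = (\<lambda>I. (Inf I, Sup I)) ` \<J>"
  have J: "finite \<J>" "\<And>I. I \<in> \<J> \<Longrightarrow> is_interval I \<and> bounded I \<and> I \<noteq> {} \<and> I \<subseteq> {-1/2..1/2}" "F = \<Union>\<J>"
    using \<I> F by (auto simp: \<J>_def) (fastforce+)?
  have D: "(\<Union>(a, b)\<in>D. {a..<b}) = (\<Union>I\<in>\<J>. {Inf I..<Sup I})" by (auto simp: D_def)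
  have fin: "finite (\<Union>I\<in>\<J>. {Inf I, Sup I})" using J(1) by auto
  show ?thesis
  proof (intro exI[of _ D] conjI impI)
    show "finite D" using J(1) by (simp add: D_def)
    show "\<forall>(a, b)\<in>D. - 1/2 \<le> a \<and> a \<le> 1/2 \<and> - 1/2 \<le> b \<and> b \<le> 1/2"
    proof -
      have "- 1/2 \<le> Inf I \<and> Inf I \<le> 1/2 \<and> - 1/2 \<le> Sup I \<and> Sup I \<le> 1/2" if "I \<in> \<J>" for I
      proof -
        note JI = J(2)[OF that]
        obtain x where x: "x \<in> I" using JI by blast
        have bdd: "bdd_below I" "bdd_above I" using JI bounded_imp_bdd_below bounded_imp_bdd_above by auto
        have "- 1/2 \<le> Inf I" using JI by (intro cInf_greatest) auto
        moreover have "Sup I \<le> 1/2" using JI by (intro cSup_least) auto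
        moreover have "Inf I \<le> x" "x \<le> Sup I" using x bdd by (auto intro: cInf_lower cSup_upper)
        moreover have "- 1/2 \<le> x" "x \<le> 1/2" using x JI by auto
        ultimately show ?thesis by linarith
      qed
      then show ?thesis by (auto simp: D_def)
    qed
    show "finite (F - (\<Union>(a, b)\<in>D. {a..<b}))"
      unfolding D J(3) using interval_half_open_approx(1) J(2) by (intro finite_subset[OF _ fin]) blast
    show "finite ((\<Union>(a, b)\<in>D. {a..<b}) - F)"
      unfolding D J(3) using interval_half_open_approx(2) J(2) by (intro finite_subset[OF _ fin]) blast
    show "D = {}" if "F = {}" using that J(2,3) by (auto simp: D_def)
  qed
qed

text \<open>A square matrix with orthonormal rows has orthonormal columns. The bijection
  \<open>\<phi>\<close> relabels components by vertices, so that the matrix is square in its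
  type.\<close>

lemma gft_inversion:
  fixes u :: "'i::finite \<Rightarrow> 'v::finite \<Rightarrow> real"
  assumes card: "CARD('i) = CARD('v)"
    and orth: "\<And>i k. (\<Sum>v\<in>UNIV. u i v * u k v) = (if i = k then 1 else 0)"
  shows "X v n = (\<Sum>i\<in>UNIV. complex_of_real (u i v) * gft_component u X i n)"
proof -
  obtain \<phi> :: "'v \<Rightarrow> 'i" where \<phi>: "bij \<phi>"
    using finite_same_card_bij[of "UNIV :: 'v set" "UNIV :: 'i set"] card by auto
  define A :: "real ^ 'v ^ 'v" where "A = (\<chi> w v. u (\<phi> w) v)"
  have "A ** transpose A = mat 1"
    using orth \<phi> by (auto simp: A_def matrix_matrix_mult_def transpose_def mat_def vec_eq_iff bij_def inj_eq)
  then have "transpose A ** A = mat 1" using matrix_left_right_inverse by blast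
  then have "(\<Sum>k\<in>UNIV. u (\<phi> k) v * u (\<phi> k) w) = (if v = w then 1 else 0)" for v w
    by (simp add: A_def matrix_matrix_mult_def transpose_def mat_def vec_eq_iff)
  moreover have "(\<Sum>k\<in>UNIV. u (\<phi> k) v * u (\<phi> k) w) = (\<Sum>i\<in>UNIV. u i v * u i w)" for v w
    using sum.reindex_bij_betw[OF \<phi>, of "\<lambda>i. u i v * u i w"] .
  ultimately have dual: "(\<Sum>i\<in>UNIV. u i v * u i w) = (if v = w then 1 else 0)" for v w by simp
  have "(\<Sum>i\<in>UNIV. complex_of_real (u i v) * gft_component u X i n) =
      (\<Sum>w\<in>UNIV. \<Sum>i\<in>UNIV. complex_of_real (u i v * u i w) * X w n)"
    unfolding gft_component_def sum_distrib_left by (subst sum.swap) (simp add: mult_ac)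
  also have "\<dots> = (\<Sum>w\<in>UNIV. complex_of_real (\<Sum>i\<in>UNIV. u i v * u i w) * X w n)"
    by (simp add: sum_distrib_right)
  also have "\<dots> = (\<Sum>w\<in>UNIV. if w = v then X v n else 0)"
    unfolding dual by (intro sum.cong) auto
  finally show ?thesis by simp
qed

text \<open>The period \<open>[-1/2, 1/2)\<close> is translated to \<open>[0, 1)\<close>; this multiplies the \<open>n\<close>-th sample by \<open>(-1)\<^sup>n\<close>.\<close>

lemma dtft_supported_in_signal:
  assumes y: "dtft_supported_in F y" and F': "F' \<in> sets borel" "F' \<subseteq> {-1/2..<1/2}"
    and diff: "finite (F - F')" "finite (F' - F)"
  shows "\<exists>G. l2_on {0..<1} G \<and> (\<forall>x. x - 1/2 \<notin> F' \<longrightarrow> G x = 0) \<and> (\<forall>n. ft G (of_int n) = ee (of_int n / 2) * y n)"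
proof -
  obtain g :: "real \<Rightarrow> complex" where g: "g \<in> borel_measurable lborel" "set_integrable lborel F (\<lambda>f. (cmod (g f))\<^sup>2)"
    and y: "\<And>n. y n = (LINT f:F|lborel. g f * exp (\<i> * complex_of_real (2 * pi * f * real_of_int n)))"
    using y unfolding dtft_supported_in_def by blast
  have [measurable]: "g \<in> borel_measurable borel" using g(1) by simp
  note F'(1)[measurable]
  have F: "F \<in> sets borel"
  proof -
    have "F = (F' - (F' - F)) \<union> (F - F')" by blast
    also have "\<dots> \<in> sets borel" by (intro sets.Un sets.Diff F'(1) borel_closed finite_imp_closed diff)
    finally show ?thesis .
  qed
  note F[measurable]
  have ae: "AE f in lborel. indicator F f = (indicator F' f :: real)"
  proof (rule AE_I'[where N="(F - F') \<union> (F' - F)"])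
    show "(F - F') \<union> (F' - F) \<in> null_sets lborel"
      using diff by (intro null_sets.Un finite_imp_null_set_lborel)
  qed (auto simp: indicator_def)
  \<comment> \<open>Cutting with \<open>F'\<close> instead of \<open>F\<close> alters the integrand
    at finitely many points only, so the samples survive, and the result vanishes at every point off
    \<open>F'\<close>.\<close>
  define H where "H = (\<lambda>f. indicator F' f * g f)"
  have [measurable]: "H \<in> borel_measurable borel" unfolding H_def by measurable
  have "integrable lborel (\<lambda>f. indicator F f *\<^sub>R (cmod (g f))\<^sup>2)" using g(2) by (simp add: set_integrable_def)
  also have "?this \<longleftrightarrow> integrable lborel (\<lambda>f. (cmod (H f))\<^sup>2)"
  proof (rule integrable_cong_AE)
    show "AE f in lborel. indicator F f *\<^sub>R (cmod (g f))\<^sup>2 = (cmod (H f))\<^sup>2"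
      using ae by eventually_elim (auto simp: H_def norm_mult power_mult_distrib)
  qed measurable
  finally have intH: "integrable lborel (\<lambda>f. (cmod (H f))\<^sup>2)" .
  have yH: "y n = (\<integral>f. H f * ee (of_int n * f) \<partial>lborel)" for n
    unfolding y set_lebesgue_integral_def
  proof (rule integral_cong_AE)
    show "AE f in lborel. indicator F f *\<^sub>R (g f * exp (\<i> * complex_of_real (2 * pi * f * real_of_int n))) = H f * ee (of_int n * f)"
      using ae by eventually_elim (auto simp: H_def ee_eq_exp scaleR_conv_of_real of_real_indicator mult_ac)
  qed measurable
  show ?thesis
  proof (intro exI[of _ "\<lambda>x. H (x - 1/2)"] conjI allI impI)
    show "l2_on {0..<1} (\<lambda>x. H (x - 1/2))"
      unfolding l2_on_def
    proof (intro conjI allI impI)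
      show "integrable lborel (\<lambda>x. (cmod (H (x - 1/2)))\<^sup>2)"
        using lborel_integrable_real_affine[OF intH, of 1 "-1/2"] by simp
      fix x :: real assume "x \<notin> {0..<1}"
      then have "x - 1/2 \<notin> F'" using F'(2) by force
      then show "H (x - 1/2) = 0" by (simp add: H_def)
    qed measurable
    show "H (x - 1/2) = 0" if "x - 1/2 \<notin> F'" for x using that by (simp add: H_def)
    fix n
    have "ft (\<lambda>x. H (x - 1/2)) (of_int n) = (\<integral>f. H (1/2 + 1 * f - 1/2) * ee (of_int n * (1/2 + 1 * f)) \<partial>lborel)"
      unfolding ft_def using lborel_integral_real_affine[of 1 "\<lambda>x. H (x - 1/2) * ee (of_int n * x)" "1/2"] by simp
    also have "\<dots> = (\<integral>f. ee (of_int n / 2) * (H f * ee (of_int n * f)) \<partial>lborel)"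
      by (intro Bochner_Integration.integral_cong refl) (simp add: distrib_left ee_add mult_ac)
    also have "\<dots> = ee (of_int n / 2) * y n" by (simp add: yH)
    finally show "ft (\<lambda>x. H (x - 1/2)) (of_int n) = ee (of_int n / 2) * y n" .
  qed
qed

section \<open>Sampling along several vertices\<close>

lemma infsum_slices:
  fixes f :: "'v::finite \<times> 'n \<Rightarrow> real"
  assumes "\<And>v. (\<lambda>n. f (v, n)) summable_on UNIV"
  shows "(\<Sum>\<^sub>\<infinity>p\<in>S. f p) = (\<Sum>v\<in>UNIV. \<Sum>\<^sub>\<infinity>n\<in>{n. (v, n) \<in> S}. f (v, n))"
proof -
  let ?s = "\<lambda>v. Pair v ` {n. (v, n) \<in> S}"
  have slice: "f summable_on ?s v" "(\<Sum>\<^sub>\<infinity>p\<in>?s v. f p) = (\<Sum>\<^sub>\<infinity>n\<in>{n. (v, n) \<in> S}. f (v, n))" for v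
  proof -
    have inj: "inj_on (Pair v) {n. (v, n) \<in> S}" by (auto simp: inj_on_def)
    have "(\<lambda>n. f (v, n)) summable_on {n. (v, n) \<in> S}"
      by (rule summable_on_subset_banach[OF assms]) auto
    then show "f summable_on ?s v" by (subst summable_on_reindex[OF inj]) (simp add: o_def)
    show "(\<Sum>\<^sub>\<infinity>p\<in>?s v. f p) = (\<Sum>\<^sub>\<infinity>n\<in>{n. (v, n) \<in> S}. f (v, n))"
      by (subst infsum_reindex[OF inj]) (simp add: o_def)
  qed
  have "(\<Sum>\<^sub>\<infinity>p\<in>(\<Union>v\<in>V. ?s v). f p) = (\<Sum>v\<in>V. \<Sum>\<^sub>\<infinity>p\<in>?s v. f p) \<and> f summable_on (\<Union>v\<in>V. ?s v)" if "finite V" for V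
    using that
  proof (induction V rule: finite_induct)
    case (insert v V)
    then have "?s v \<inter> (\<Union>v\<in>V. ?s v) = {}" by auto
    then show ?case
      using insert slice(1) by (simp add: infsum_Un_disjoint summable_on_Un_disjoint)
  qed simp
  from this[of UNIV] have "(\<Sum>\<^sub>\<infinity>p\<in>(\<Union>v. ?s v). f p) = (\<Sum>v\<in>UNIV. \<Sum>\<^sub>\<infinity>p\<in>?s v. f p)" by simp
  moreover have "(\<Union>v. ?s v) = S" by auto
  ultimately show ?thesis by (simp add: slice(2))
qed

text \<open>Linear dependences among the rows restricted to \<open>J x\<close> carry over to the
  vertex signals at \<open>x\<close>, because the inactive components vanish there. The coefficients
  depend on the set \<open>J x\<close> alone, one of finitely many, so one \<open>K\<close> serves
  all \<open>x\<close> and \<open>triangular_sampling\<close> applies with vertices as rows.\<close>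

lemma greedy_sampling_bound:
  fixes u :: "'i::finite \<Rightarrow> 'v::finite \<Rightarrow> real" and \<nu> :: "nat \<Rightarrow> 'v" and J :: "real \<Rightarrow> 'i set"
  assumes \<Lambda>: "\<And>n. n < N \<Longrightarrow> {x \<in> {0..<1}. n \<in> pivots (\<lambda>n. restricted_row u (J x) (\<nu> n)) N} \<in> sets borel \<and>
      sampling {x \<in> {0..<1}. n \<in> pivots (\<lambda>n. restricted_row u (J x) (\<nu> n)) N} (\<Lambda> n)"
  shows "\<exists>C\<ge>0. \<forall>G. (\<forall>i. l2_on {0..<1} (G i) \<and> (\<forall>x. i \<notin> J x \<longrightarrow> G i x = 0)) \<longrightarrow>
    (\<Sum>n<N. energy (\<lambda>x. \<Sum>i\<in>UNIV. complex_of_real (u i (\<nu> n)) * G i x)) \<le>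
    C * (\<Sum>n<N. sample_energy (\<Lambda> n) (\<lambda>x. \<Sum>i\<in>UNIV. complex_of_real (u i (\<nu> n)) * G i x))"
proof -
  let ?row = "\<lambda>J n. restricted_row u J (\<nu> n)"
  let ?A = "\<lambda>n. {x \<in> {0..<1}. n \<in> pivots (?row (J x)) N}"
  have "\<forall>J n. \<exists>c. n < N \<and> n \<notin> pivots (?row J) N \<longrightarrow> ?row J n = (\<Sum>q<n. c q *\<^sub>R ?row J q)"
    using span_image_lessThan[where x="?row _"] by (auto simp: pivots_def)
  then obtain c where c: "\<And>J n. n < N \<Longrightarrow> n \<notin> pivots (?row J) N \<Longrightarrow> ?row J n = (\<Sum>q<n. c J n q *\<^sub>R ?row J q)"
    by metis
  define K where "K = (\<Sum>J\<in>UNIV. \<Sum>n<N. \<Sum>q<N. \<bar>c J n q\<bar>)"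
  have K: "K \<ge> 0" unfolding K_def by (intro sum_nonneg) auto
  have cK: "\<bar>c J n q\<bar> \<le> K" if "n < N" "q < N" for J n q
  proof -
    have "\<bar>c J n q\<bar> \<le> (\<Sum>q<N. \<bar>c J n q\<bar>)"
      using that by (intro member_le_sum[where f="\<lambda>q. \<bar>c J n q\<bar>"]) auto
    also have "\<dots> \<le> (\<Sum>n<N. \<Sum>q<N. \<bar>c J n q\<bar>)"
      using that by (intro member_le_sum[where f="\<lambda>n. \<Sum>q<N. \<bar>c J n q\<bar>"]) (auto intro: sum_nonneg)
    also have "\<dots> \<le> K"
      unfolding K_def by (intro member_le_sum[where f="\<lambda>J. \<Sum>n<N. \<Sum>q<N. \<bar>c J n q\<bar>"]) (auto intro!: sum_nonneg)
    finally show ?thesis .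
  qed
  have level: "?A n \<in> sets borel \<and> ?A n \<subseteq> {0..<1} \<and> sampling (?A n) (\<Lambda> n)" if "n < N" for n
    using \<Lambda>[OF that] by auto
  let ?Q = "\<lambda>C. C \<ge> 0 \<and> (\<forall>h. (\<forall>r<N. l2_on {0..<1} (h r) \<and> (\<forall>x\<in>{0..<1} - ?A r. cmod (h r x) \<le> K * (\<Sum>q<r. cmod (h q x)))) \<longrightarrow>
    (\<Sum>r<N. energy (h r)) \<le> C * (\<Sum>r<N. sample_energy (\<Lambda> r) (h r)))"
  obtain C where C: "?Q C"
    by (rule exE[where P="?Q"], rule triangular_sampling, rule level, assumption, rule K, rule that, assumption)
  show ?thesis
  proof (intro exI[of _ C] conjI allI impI)
    show "C \<ge> 0" using C by blast
    fix G assume G: "\<forall>i. l2_on {0..<1} (G i) \<and> (\<forall>x. i \<notin> J x \<longrightarrow> G i x = 0)"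
    let ?h = "\<lambda>n x. \<Sum>i\<in>UNIV. complex_of_real (u i (\<nu> n)) * G i x"
    show "(\<Sum>n<N. energy (?h n)) \<le> C * (\<Sum>n<N. sample_energy (\<Lambda> n) (?h n))"
    proof (rule conjunct2[OF C, rule_format], intro conjI ballI)
      fix n assume n: "n < N"
      show "l2_on {0..<1} (?h n)" using G by (intro l2_on_sum l2_on_cmult) auto
      fix x assume "x \<in> {0..<1} - ?A n"
      then have np: "n \<notin> pivots (?row (J x)) N" by auto
      have coeff: "u i (\<nu> n) = (\<Sum>q<n. c (J x) n q * u i (\<nu> q))" if "i \<in> J x" for i
        using arg_cong[OF c[OF n np], of "\<lambda>y. y $ i"] that by (simp add: restricted_row_def)
      have "?h n x = (\<Sum>i\<in>UNIV. \<Sum>q<n. complex_of_real (c (J x) n q) * (complex_of_real (u i (\<nu> q)) * G i x))"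
      proof (intro sum.cong refl)
        fix i
        show "complex_of_real (u i (\<nu> n)) * G i x = (\<Sum>q<n. complex_of_real (c (J x) n q) * (complex_of_real (u i (\<nu> q)) * G i x))"
        proof (cases "i \<in> J x")
          case True
          show ?thesis unfolding coeff[OF True] by (simp add: sum_distrib_right mult.assoc)
        qed (use G in auto)
      qed
      also have "\<dots> = (\<Sum>q<n. complex_of_real (c (J x) n q) * ?h q x)"
        by (subst sum.swap) (simp add: sum_distrib_left)
      finally have "cmod (?h n x) \<le> (\<Sum>q<n. \<bar>c (J x) n q\<bar> * cmod (?h q x))"
        by (simp only:) (rule order_trans[OF norm_sum], simp add: norm_mult)
      also have "\<dots> \<le> (\<Sum>q<n. K * cmod (?h q x))"
        using n by (intro sum_mono mult_right_mono cK) auto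
      finally show "cmod (?h n x) \<le> K * (\<Sum>q<n. cmod (?h q x))" by (simp add: sum_distrib_left)
    qed
  qed
qed

lemma sample_energy_mono:
  assumes "l2_on {0..<1} g" "\<Lambda> \<subseteq> \<Lambda>'"
  shows "sample_energy \<Lambda> g \<le> sample_energy \<Lambda>' g"
  unfolding sample_energy_def using assms
  by (intro infsum_mono_neutral sample_energy_summable) auto

text \<open>Bounded discrepancy turns the ratio of each slice into a true limit; limits add over the
  slices, and the \<open>liminf\<close> equals the limit.\<close>

lemma sampling_ratio_slices:
  fixes \<nu> :: "nat \<Rightarrow> 'v::finite"
  assumes \<nu>: "inj_on \<nu> {..<N}" and \<Lambda>: "\<And>k. k < N \<Longrightarrow> bounded_discrepancy (\<Lambda> k) (d k)"
  shows "sampling_ratio {(\<nu> k, n) | k n. k < N \<and> n \<in> \<Lambda> k} = ereal ((\<Sum>k<N. d k) / real CARD('v))"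
proof -
  let ?S = "{(\<nu> k, n) | k n. k < N \<and> n \<in> \<Lambda> k}"
  have card: "card (?S \<inter> (UNIV \<times> {-int n..int n})) = (\<Sum>k<N. card (\<Lambda> k \<inter> {-int n..int n}))" for n :: nat
  proof -
    have "?S \<inter> (UNIV \<times> {-int n..int n}) = (\<lambda>(k, m). (\<nu> k, m)) ` (SIGMA k:{..<N}. \<Lambda> k \<inter> {-int n..int n})"
      by auto
    moreover have "inj_on (\<lambda>(k, m). (\<nu> k, m)) (SIGMA k:{..<N}. \<Lambda> k \<inter> {-int n..int n})"
      using \<nu> by (auto simp: inj_on_def)
    ultimately show ?thesis by (simp add: card_image)
  qed
  have lim: "(\<lambda>n. real (card (\<Lambda> k \<inter> {-int n..int n})) / (2 * real n)) \<longlonglongrightarrow> d k" if kN: "k < N" for k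
  proof -
    obtain C where C: "\<And>n::nat. \<bar>real (card (\<Lambda> k \<inter> {- int n..int n})) - 2 * d k * real n\<bar> \<le> C"
      using \<Lambda>[OF kN] unfolding bounded_discrepancy_def by blast
    have "(\<lambda>n. real (card (\<Lambda> k \<inter> {-int n..int n})) / (2 * real n) - d k) \<longlonglongrightarrow> 0"
    proof (rule Lim_null_comparison)
      show "\<forall>\<^sub>F n in sequentially. norm (real (card (\<Lambda> k \<inter> {-int n..int n})) / (2 * real n) - d k) \<le> (C / 2) * (1 / real n)"
        using eventually_gt_at_top[of 0]
      proof eventually_elim
        case (elim n)
        have "real (card (\<Lambda> k \<inter> {-int n..int n})) / (2 * real n) - d k = (real (card (\<Lambda> k \<inter> {-int n..int n})) - 2 * d k * real n) / (2 * real n)"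
          using elim by (simp add: field_simps)
        then have "norm (real (card (\<Lambda> k \<inter> {-int n..int n})) / (2 * real n) - d k) = \<bar>real (card (\<Lambda> k \<inter> {-int n..int n})) - 2 * d k * real n\<bar> / (2 * real n)"
          using elim by (simp add: abs_divide)
        also have "\<dots> \<le> C / (2 * real n)" using C elim by (intro divide_right_mono) auto
        finally show ?case by simp
      qed
      show "(\<lambda>n. (C / 2) * (1 / real n)) \<longlonglongrightarrow> 0"
        by (intro tendsto_mult_right_zero lim_1_over_n)
    qed
    then show ?thesis by (simp add: LIM_zero_iff)
  qed
  have "(\<lambda>n. (\<Sum>k<N. real (card (\<Lambda> k \<inter> {-int n..int n})) / (2 * real n)) / real CARD('v)) \<longlonglongrightarrow> (\<Sum>k<N. d k) / real CARD('v)"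
    by (intro tendsto_divide tendsto_sum lim tendsto_const) auto
  moreover have "(\<Sum>k<N. real (card (\<Lambda> k \<inter> {-int n..int n})) / (2 * real n)) / real CARD('v) =
      real (card (?S \<inter> (UNIV \<times> {-int n..int n}))) / (2 * real n * real CARD('v))" for n
    unfolding card by (simp add: sum_divide_distrib)
  ultimately have "(\<lambda>n. ereal (real (card (?S \<inter> (UNIV \<times> {-int n..int n}))) / (2 * real n * real CARD('v)))) \<longlonglongrightarrow> ereal ((\<Sum>k<N. d k) / real CARD('v))"
    by (simp add: tendsto_ereal)
  then show ?thesis unfolding sampling_ratio_def by (rule lim_imp_Liminf[OF sequentially_bot])
qed

section \<open>Assembly of the sampling set\<close>

theorem theorem4:
  fixes W :: "'v::finite \<Rightarrow> 'v \<Rightarrow> real"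
    and u :: "'i::finite \<Rightarrow> 'v \<Rightarrow> real"
    and F :: "'i \<Rightarrow> real set"
  assumes "undirected_graph W"
    and "laplacian_eigenbasis W u"
    and "\<forall>i. finite_union_intervals (F i)"
  shows "\<exists>S :: ('v \<times> int) set.
           stable_sampling_set S (BL_D u F) \<and>
           sampling_ratio S = ereal ((\<Sum>i\<in>UNIV. measure lborel (F i)) / real CARD('v)) \<and>
           card (fst ` S) \<le> card {i. F i \<noteq> {}}"
proof -
  have card_eq: "CARD('i) = CARD('v)" and orth: "\<And>i k. (\<Sum>v\<in>UNIV. u i v * u k v) = (if i = k then 1 else 0)"
    using assms(2) by (auto simp: laplacian_eigenbasis_def)
  define N where "N = CARD('v)"
  obtain \<nu> :: "nat \<Rightarrow> 'v" where "bij_betw \<nu> {0..<N} UNIV"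
    using ex_bij_betw_nat_finite[of "UNIV :: 'v set"] unfolding N_def by auto
  then have \<nu>: "bij_betw \<nu> {..<N} UNIV" by (simp add: lessThan_atLeast0)
  have inj: "inj_on \<nu> {..<N}" and surj: "\<nu> ` {..<N} = UNIV" using \<nu> by (auto simp: bij_betw_def)
  have "\<forall>i. \<exists>D. finite D \<and> (\<forall>(a, b)\<in>D. - 1/2 \<le> a \<and> a \<le> 1/2 \<and> - 1/2 \<le> b \<and> b \<le> (1/2::real)) \<and>
    finite (F i - (\<Union>(a, b)\<in>D. {a..<b})) \<and> finite ((\<Union>(a, b)\<in>D. {a..<b}) - F i) \<and> (F i = {} \<longrightarrow> D = {})"
    using assms(3) finite_union_intervals_half_open by blast
  then obtain D where D: "\<And>i. finite (D i)" "\<And>i a b. (a, b) \<in> D i \<Longrightarrow> - 1/2 \<le> a \<and> a \<le> 1/2 \<and> - 1/2 \<le> b \<and> b \<le> (1/2::real)"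
    "\<And>i. finite (F i - (\<Union>(a, b)\<in>D i. {a..<b}))" "\<And>i. finite ((\<Union>(a, b)\<in>D i. {a..<b}) - F i)" "\<And>i. F i = {} \<Longrightarrow> D i = {}"
    by (metis (no_types, lifting) case_prodD)
  define F' where "F' = (\<lambda>i. \<Union>(a, b)\<in>D i. {a..<b})"
  have diff: "finite (F i - F' i)" "finite (F' i - F i)" for i
    using D(3,4) by (simp_all only: F'_def)
  have F'_borel [measurable]: "F' i \<in> sets borel" for i
    unfolding F'_def using D(1) by (intro sets.finite_UN) auto
  have F'_sub: "F' i \<subseteq> {-1/2..<1/2}" for i
    unfolding F'_def using D(2) by fastforce
  \<comment> \<open>A point \<open>x\<close> of \<open>[0, 1)\<close> stands for the frequency
    \<open>x - 1/2\<close> of the original period; \<open>frac\<close> makes the active set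
    periodic.\<close>
  define J where "J = (\<lambda>x. {i. frac x - 1/2 \<in> F' i})"
  have tameD: "tame (\<lambda>t. frac t - 1/2 \<in> F' i)" "finite (jumps (\<lambda>t. frac t - 1/2 \<in> F' i))" for i
  proof -
    let ?q = "\<lambda>d t. fst d + 1/2 \<le> frac t \<and> frac t < snd d + 1/2"
    have q: "tame (?q d)" "finite (jumps (?q d))" if "d \<in> D i" for d
      using tame_frac_interval[of "fst d + 1/2" "snd d + 1/2"] D(2)[of "fst d" "snd d" i] that by auto
    have eq: "(\<lambda>t. frac t - 1/2 \<in> F' i) = (\<lambda>t. (\<lambda>E. E \<noteq> {}) {d \<in> D i. ?q d t})"
    proof
      fix t
      have "frac t - 1/2 \<in> F' i \<longleftrightarrow> (\<exists>d\<in>D i. fst d \<le> frac t - 1/2 \<and> frac t - 1/2 < snd d)"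
        by (simp add: F'_def case_prod_beta)
      also have "\<dots> \<longleftrightarrow> (\<exists>d\<in>D i. ?q d t)"
        by (intro bex_cong refl) linarith
      finally show "(frac t - 1/2 \<in> F' i) = (\<lambda>E. E \<noteq> {}) {d \<in> D i. ?q d t}" by blast
    qed
    note fam = tame_family[of "D i" ?q, OF D(1) q(1)]
    show "tame (\<lambda>t. frac t - 1/2 \<in> F' i)" unfolding eq by (rule tame_comp[OF fam(1)])
    have "jumps (\<lambda>t. frac t - 1/2 \<in> F' i) \<subseteq> (\<Union>d\<in>D i. jumps (?q d))"
    proof
      fix z assume "z \<in> jumps (\<lambda>t. frac t - 1/2 \<in> F' i)"
      then have z: "z \<in> {0..<1}" "jump_at (\<lambda>t. (\<lambda>E. E \<noteq> {}) {d \<in> D i. ?q d t}) z" unfolding eq by (auto simp: jumps_def)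
      from fam(2)[OF _ jump_at_comp[where \<phi>="\<lambda>E. E \<noteq> {}", OF z(2)]] z(1)
      show "z \<in> (\<Union>d\<in>D i. jumps (?q d))" by (auto simp: jumps_def)
    qed
    then show "finite (jumps (\<lambda>t. frac t - 1/2 \<in> F' i))" by (rule finite_subset) (use D(1) q(2) in auto)
  qed
  have J_eq: "J = (\<lambda>t. {i \<in> UNIV. frac t - 1/2 \<in> F' i})" by (simp add: J_def)
  note famJ = tame_family[of "UNIV :: 'i set" "\<lambda>i t. frac t - 1/2 \<in> F' i", OF _ tameD(1), folded J_eq]
  let ?R = "\<lambda>J. pivots (\<lambda>n. restricted_row u J (\<nu> n)) N"
  let ?A = "\<lambda>n. {x \<in> {0..<1}. n \<in> ?R (J x)}"
  have tameA: "tame (\<lambda>x. n \<in> ?R (J x))" "periodic (\<lambda>x. n \<in> ?R (J x))" "finite (jumps (\<lambda>x. n \<in> ?R (J x)))" for n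
  proof -
    show "tame (\<lambda>x. n \<in> ?R (J x))" by (rule tame_comp[OF famJ(1)]) simp
    show "periodic (\<lambda>x. n \<in> ?R (J x))" by (simp add: periodic_def J_def frac_1_eq)
    have "jumps (\<lambda>x. n \<in> ?R (J x)) \<subseteq> (\<Union>i. jumps (\<lambda>t. frac t - 1/2 \<in> F' i))"
    proof
      fix z assume "z \<in> jumps (\<lambda>x. n \<in> ?R (J x))"
      then have z: "z \<in> {0..<1}" "jump_at (\<lambda>x. n \<in> ?R (J x)) z" by (auto simp: jumps_def)
      from famJ(2)[OF _ jump_at_comp[where \<phi>="\<lambda>J. n \<in> ?R J", OF z(2)]] z(1)
      show "z \<in> (\<Union>i. jumps (\<lambda>t. frac t - 1/2 \<in> F' i))" by (auto simp: jumps_def)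
    qed
    then show "finite (jumps (\<lambda>x. n \<in> ?R (J x)))" by (rule finite_subset) (use tameD(2) in auto)
  qed
  \<comment> \<open>For an empty set any finite set of frequencies is critical too; insisting on
    none keeps vertices that are never chosen out of the projection.\<close>
  have ex: "\<exists>\<Lambda>. critical (?A n) \<Lambda> \<and> (?A n = {} \<longrightarrow> \<Lambda> = {})" for n
  proof (cases "?A n = {}")
    case True
    then show ?thesis using critical_empty by metis
  next
    case False
    then show ?thesis using tame_critical[OF tameA] by blast
  qed
  define \<Lambda> where "\<Lambda> = (\<lambda>n. SOME L. critical (?A n) L \<and> (?A n = {} \<longrightarrow> L = {}))"
  have \<Lambda>': "critical (?A n) (\<Lambda> n) \<and> (?A n = {} \<longrightarrow> \<Lambda> n = {})" for n
    unfolding \<Lambda>_def by (rule someI_ex[OF ex])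
  have \<Lambda>: "critical (?A n) (\<Lambda> n)" "?A n = {} \<Longrightarrow> \<Lambda> n = {}" for n
    by (rule conjunct1[OF \<Lambda>']) (rule conjunct2[OF \<Lambda>', rule_format])
  have A_borel: "?A n \<in> sets borel" for n by (rule tame_level_borel[OF tameA])
  define S where "S = {(\<nu> k, n) | k n. k < N \<and> n \<in> \<Lambda> k}"
  have card_R: "card (?R J) = card J" for J
  proof -
    have "(\<lambda>n. restricted_row u J (\<nu> n)) ` {..<N} = range (restricted_row u J)"
      using surj by (metis image_image)
    then show ?thesis using dim_restricted_rows[OF orth, of J] by (simp add: card_pivots)
  qed
  have R_sub: "?R J \<subseteq> {..<N}" for J by (auto simp: pivots_def)
  \<comment> \<open>Forgetting coordinates preserves linear dependence, so a row that is independent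
    of its predecessors on \<open>J\<close> remains so on a larger set. This confines the sampled
    vertices to those kept for the set of all nonempty components.\<close>
  have R_mono: "?R J \<subseteq> ?R I" if "J \<subseteq> I" for J I
  proof
    fix n assume n: "n \<in> ?R J"
    show "n \<in> ?R I"
    proof (rule ccontr)
      assume "n \<notin> ?R I"
      then have "restricted_row u I (\<nu> n) \<in> span ((\<lambda>n. restricted_row u I (\<nu> n)) ` {..<n})" using n by (auto simp: pivots_def)
      then obtain c where c: "restricted_row u I (\<nu> n) = (\<Sum>q<n. c q *\<^sub>R restricted_row u I (\<nu> q))"
        using span_image_lessThan by blast
      have "restricted_row u J (\<nu> n) = (\<Sum>q<n. c q *\<^sub>R restricted_row u J (\<nu> q))"
        unfolding vec_eq_iff
      proof
        fix i
        show "restricted_row u J (\<nu> n) $ i = (\<Sum>q<n. c q *\<^sub>R restricted_row u J (\<nu> q)) $ i"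
          using arg_cong[OF c, of "\<lambda>y. y $ i"] that by (auto simp: restricted_row_def split: if_splits)
      qed
      then have "restricted_row u J (\<nu> n) \<in> span ((\<lambda>n. restricted_row u J (\<nu> n)) ` {..<n})"
        by (auto intro!: span_sum span_scale intro: span_base)
      then show False using n by (simp add: pivots_def)
    qed
  qed
  have "card (fst ` S) \<le> card {i. F i \<noteq> {}}"
  proof -
    have "fst ` S \<subseteq> \<nu> ` ?R {i. F i \<noteq> {}}"
    proof
      fix v assume "v \<in> fst ` S"
      then obtain k n where k: "v = \<nu> k" "k < N" "n \<in> \<Lambda> k" by (auto simp: S_def)
      then have "?A k \<noteq> {}" using \<Lambda>(2) by blast
      then obtain x where "k \<in> ?R (J x)" by blast
      moreover have "J x \<subseteq> {i. F i \<noteq> {}}" using D(5) by (auto simp: J_def F'_def)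
      ultimately show "v \<in> \<nu> ` ?R {i. F i \<noteq> {}}" using R_mono k(1) by blast
    qed
    then have "card (fst ` S) \<le> card (\<nu> ` ?R {i. F i \<noteq> {}})"
      by (intro card_mono) auto
    also have "\<dots> \<le> card (?R {i. F i \<noteq> {}})"
      by (intro card_image_le) (auto simp: pivots_def)
    finally show ?thesis by (simp add: card_R)
  qed
  moreover have "sampling_ratio S = ereal ((\<Sum>i\<in>UNIV. measure lborel (F i)) / real CARD('v))"
  proof -
    have "sampling_ratio S = ereal ((\<Sum>k<N. measure lborel (?A k)) / real CARD('v))"
      unfolding S_def using \<Lambda>(1) by (intro sampling_ratio_slices inj) (auto simp: critical_def)
    moreover have "(\<Sum>k<N. measure lborel (?A k)) = (\<Sum>i\<in>UNIV. measure lborel (F i))"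
    proof -
      have iA: "integrable lborel (indicator (?A k) :: real \<Rightarrow> real)" for k
      proof (intro integrable_real_indicator emeasure_bounded_finite)
        show "bounded (?A k)" by (rule bounded_subset[of "{0..1}"]) auto
      qed (use A_borel in auto)
      have iF: "integrable lborel (indicator (F' i) :: real \<Rightarrow> real)" for i
      proof (intro integrable_real_indicator emeasure_bounded_finite)
        show "bounded (F' i)" by (rule bounded_subset[OF _ F'_sub]) auto
      qed simp
      have iF2: "integrable lborel (\<lambda>x. indicator (F' i) (x - 1/2) :: real)" for i
        using lborel_integrable_real_affine[OF iF, where c=1 and t="-1/2"] by simp
      \<comment> \<open>At every frequency exactly as many vertices are kept as components are
        active; integration turns this into the joint bandwidth.\<close>
      have pointwise: "(\<Sum>k<N. indicator (?A k) x) = (\<Sum>i\<in>UNIV. indicator (F' i) (x - 1/2) :: real)" for x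
      proof (cases "x \<in> {0..<1}")
        case True
        then have J: "J x = {i. x - 1/2 \<in> F' i}" by (simp add: J_def frac_eq)
        have "(\<Sum>k<N. indicator (?A k) x) = (\<Sum>k<N. if k \<in> ?R (J x) then 1 else 0 :: real)"
          using True by (intro sum.cong refl) (auto simp: indicator_def)
        also have "\<dots> = real (card (?R (J x)))"
          using R_sub[of "J x"] by (simp add: sum.If_cases Int_absorb1)
        also have "\<dots> = (\<Sum>i\<in>UNIV. if i \<in> J x then 1 else 0)"
          by (simp add: card_R sum.If_cases)
        also have "\<dots> = (\<Sum>i\<in>UNIV. indicator (F' i) (x - 1/2))"
          unfolding J by (intro sum.cong refl) (auto simp: indicator_def)
        finally show ?thesis .
      next
        case False
        then have "x - 1/2 \<notin> F' i" for i using F'_sub[of i] by force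
        then have "indicator (F' i) (x - 1/2) = (0 :: real)" for i by simp
        moreover have "indicator (?A k) x = (0 :: real)" for k using False by (auto simp: indicator_def)
        ultimately show ?thesis by (simp only: sum.neutral_const)
      qed
      have "(\<Sum>k<N. measure lborel (?A k)) = (\<Sum>k<N. \<integral>x. indicator (?A k) x \<partial>lborel)" by simp
      also have "\<dots> = (\<integral>x. (\<Sum>k<N. indicator (?A k) x) \<partial>lborel)"
        by (rule Bochner_Integration.integral_sum[symmetric, OF iA])
      also have "\<dots> = (\<integral>x. (\<Sum>i\<in>UNIV. indicator (F' i) (x - 1/2)) \<partial>lborel)"
        by (intro Bochner_Integration.integral_cong refl pointwise)
      also have "\<dots> = (\<Sum>i\<in>UNIV. \<integral>x. indicator (F' i) (x - 1/2) \<partial>lborel)"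
        by (rule Bochner_Integration.integral_sum[OF iF2])
      also have "\<dots> = (\<Sum>i\<in>UNIV. measure lborel (F' i))"
        using lborel_integral_real_affine[where c=1 and t="-1/2" and f="indicator (F' _) :: real \<Rightarrow> real"] by simp
      also have "\<dots> = (\<Sum>i\<in>UNIV. measure lborel (F i))"
      proof (intro sum.cong refl)
        fix i
        have fin: "F i - F' i \<in> null_sets lborel" "F' i - F i \<in> null_sets lborel"
          using diff by (auto intro: finite_imp_null_set_lborel)
        have "F i = (F' i - (F' i - F i)) \<union> (F i - F' i)" by blast
        then have "measure lborel (F i) = measure lborel ((F' i - (F' i - F i)) \<union> (F i - F' i))" by simp
        also have "\<dots> = measure lborel (F' i - (F' i - F i))"
          using fin by (intro measure_Un_null_set) (auto dest: null_setsD2)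
        also have "\<dots> = measure lborel (F' i)"
          using fin by (intro measure_Diff_null_set) auto
        finally show "measure lborel (F' i) = measure lborel (F i)" ..
      qed
      finally show ?thesis .
    qed
    ultimately show ?thesis by simp
  qed
  moreover have "stable_sampling_set S (BL_D u F)"
  proof -
    have pre: "?A n \<in> sets borel \<and> sampling (?A n) (\<Lambda> n)" if "n < N" for n
      using \<Lambda>(1)[of n] A_borel[of n] by (simp only: critical_def simp_thms)
    let ?Q = "\<lambda>C. C \<ge> 0 \<and> (\<forall>G. (\<forall>i. l2_on {0..<1} (G i) \<and> (\<forall>x. i \<notin> J x \<longrightarrow> G i x = 0)) \<longrightarrow>
      (\<Sum>n<N. energy (\<lambda>x. \<Sum>i\<in>UNIV. complex_of_real (u i (\<nu> n)) * G i x)) \<le>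
      C * (\<Sum>n<N. sample_energy (\<Lambda> n) (\<lambda>x. \<Sum>i\<in>UNIV. complex_of_real (u i (\<nu> n)) * G i x)))"
    obtain C where C: "?Q C"
      by (rule exE[where P="?Q"], rule greedy_sampling_bound, rule pre, assumption, rule that, assumption)
    have main: "sig_norm2 X \<le> C * (\<Sum>\<^sub>\<infinity>p\<in>S. (cmod (X (fst p) (snd p)))\<^sup>2) \<and>
        (\<Sum>\<^sub>\<infinity>p\<in>S. (cmod (X (fst p) (snd p)))\<^sup>2) \<le> sig_norm2 X" if X: "X \<in> BL_D u F" for X
    proof -
      have "\<forall>i. \<exists>G. l2_on {0..<1} G \<and> (\<forall>x. x - 1/2 \<notin> F' i \<longrightarrow> G x = 0) \<and> (\<forall>n. ft G (of_int n) = ee (of_int n / 2) * gft_component u X i n)"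
        using X dtft_supported_in_signal[OF _ F'_borel F'_sub diff] by (auto simp: BL_D_def)
      then obtain G where G: "\<And>i. l2_on {0..<1} (G i)" "\<And>i x. x - 1/2 \<notin> F' i \<Longrightarrow> G i x = 0"
        "\<And>i n. ft (G i) (of_int n) = ee (of_int n / 2) * gft_component u X i n" by metis
      define h where "h = (\<lambda>k x. \<Sum>i\<in>UNIV. complex_of_real (u i (\<nu> k)) * G i x)"
      have h: "l2_on {0..<1} (h k)" for k unfolding h_def by (intro l2_on_sum l2_on_cmult G)
      have fth: "cmod (ft (h k) (of_int n)) = cmod (X (\<nu> k) n)" for k n
      proof -
        have "ft (h k) (of_int n) = (\<Sum>i\<in>UNIV. complex_of_real (u i (\<nu> k)) * ft (G i) (of_int n))"
          unfolding h_def by (subst ft_sum) (auto intro!: l2_on_cmult G simp: ft_cmult)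
        also have "\<dots> = ee (of_int n / 2) * X (\<nu> k) n"
          unfolding gft_inversion[OF card_eq orth, of X "\<nu> k" n] G(3) by (simp add: sum_distrib_left mult_ac)
        finally show ?thesis by (simp add: norm_mult)
      qed
      have summable: "(\<lambda>n. (cmod (X v n))\<^sup>2) summable_on UNIV" for v
        using X by (auto simp: BL_D_def l2_seq_def)
      have slices: "(\<Sum>\<^sub>\<infinity>p\<in>T. (cmod (X (fst p) (snd p)))\<^sup>2) = (\<Sum>k<N. sample_energy {n. (\<nu> k, n) \<in> T} (h k))" for T
      proof -
        have "(\<Sum>\<^sub>\<infinity>p\<in>T. (cmod (X (fst p) (snd p)))\<^sup>2) = (\<Sum>v\<in>UNIV. \<Sum>\<^sub>\<infinity>n\<in>{n. (v, n) \<in> T}. (cmod (X v n))\<^sup>2)"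
          using infsum_slices[of "\<lambda>p. (cmod (X (fst p) (snd p)))\<^sup>2" T] summable by simp
        also have "\<dots> = (\<Sum>k<N. \<Sum>\<^sub>\<infinity>n\<in>{n. (\<nu> k, n) \<in> T}. (cmod (X (\<nu> k) n))\<^sup>2)"
          by (rule sum.reindex_bij_betw[OF \<nu>, symmetric])
        finally show ?thesis by (simp add: sample_energy_def fth)
      qed
      have S_slice: "{n. (\<nu> k, n) \<in> S} = \<Lambda> k" if "k < N" for k
        using inj that by (auto simp: S_def inj_on_def)
      have norm: "sig_norm2 X = (\<Sum>k<N. sample_energy UNIV (h k))"
        unfolding sig_norm2_def slices by simp
      have samp: "(\<Sum>\<^sub>\<infinity>p\<in>S. (cmod (X (fst p) (snd p)))\<^sup>2) = (\<Sum>k<N. sample_energy (\<Lambda> k) (h k))"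
        unfolding slices using S_slice by (intro sum.cong refl) simp
      have "sig_norm2 X \<le> (\<Sum>k<N. energy (h k))"
        unfolding norm by (intro sum_mono sample_energy_le h)
      also have "\<dots> \<le> C * (\<Sum>k<N. sample_energy (\<Lambda> k) (h k))"
        unfolding h_def
      proof (rule conjunct2[OF C, rule_format], intro conjI allI impI)
        fix i x assume "i \<notin> J x"
        then show "G i x = 0"
        proof (cases "x \<in> {0..<1}")
          case True
          then have "x - 1/2 \<notin> F' i" using \<open>i \<notin> J x\<close> by (simp add: J_def frac_eq)
          then show ?thesis by (rule G(2))
        next
          case False
          then show ?thesis using G(1)[of i] by (auto simp: l2_on_def)
        qed
      qed (rule G)
      finally have "sig_norm2 X \<le> C * (\<Sum>k<N. sample_energy (\<Lambda> k) (h k))" .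
      moreover have "(\<Sum>k<N. sample_energy (\<Lambda> k) (h k)) \<le> sig_norm2 X"
        unfolding norm by (intro sum_mono sample_energy_mono h) auto
      ultimately show ?thesis unfolding samp by simp
    qed
    show ?thesis
      unfolding stable_sampling_set_def
    \<comment> \<open>\<open>C\<close> may be 0, and the lower bound must not exceed the upper bound
      1; \<open>1 / (C + 1)\<close> handles both.\<close>
    proof (rule exI[of _ "1 / (C + 1)"], rule exI[of _ 1], intro conjI ballI)
      have C0: "C \<ge> 0" using C by blast
      then show "0 < 1 / (C + 1)" "1 / (C + 1) \<le> 1" by auto
      fix X assume X: "X \<in> BL_D u F"
      let ?s = "\<Sum>\<^sub>\<infinity>p\<in>S. (cmod (X (fst p) (snd p)))\<^sup>2"
      have "?s \<ge> 0" by (intro infsum_nonneg) auto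
      then have "sig_norm2 X \<le> (C + 1) * ?s" using main[OF X] by (simp add: distrib_right)
      then show "1 / (C + 1) * sig_norm2 X \<le> ?s" using C0 by (simp add: field_simps)
      show "?s \<le> 1 * sig_norm2 X" using main[OF X] by simp
    qed
  qed
  ultimately show ?thesis by blast
qed

end
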